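(* Let $X$ be a finite-dimensional simplicial complex, let $q\colon\overline X\to X$ be a covering map (not necessarily regular) with $\overline X$ connected, and let $p\colon E\to\overline X$ be a fibration whose fibre is $(k-1)$-connected for some integer $k\ge0$ (for $k=0$ this means the fibre is nonempty). Then $$\widetilde{\mathrm{secat}}(E\xrightarrow{p}\overline X\xrightarrow{q}X)\le\left\lceil\frac{\dim X-k}{k+1}\right\rceil.$$
   Context: $\widetilde{\mathrm{secat}}(E\xrightarrow{p}\overline X\xrightarrow{q}X)$ is the least integer $c\ge0$ such that $X$ has an open cover $U_0,\dots,U_c$ with the property that for each $i$ the fibration $p$ admits a continuous section over $q^{-1}(U_i)\subset\overline X$. *)

theory Defs
  imports "HOL-Analysis.Analysis" "HOL-Library.Extended_Nat"
begin

definition abstract_simplicial_complex :: "'v set set \<Rightarrow> bool" where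
  "abstract_simplicial_complex K \<longleftrightarrow>
     (\<forall>\<sigma>\<in>K. finite \<sigma> \<and> \<sigma> \<noteq> {}) \<and>
     (\<forall>\<sigma>\<in>K. \<forall>\<tau>. \<tau> \<subseteq> \<sigma> \<and> \<tau> \<noteq> {} \<longrightarrow> \<tau> \<in> K)"

definition finite_dimensional_complex :: "'v set set \<Rightarrow> bool" where
  "finite_dimensional_complex K \<longleftrightarrow> (\<exists>d::nat. \<forall>\<sigma>\<in>K. card \<sigma> \<le> d)"

definition complex_dim :: "'v set set \<Rightarrow> int" where
  "complex_dim K = Max ((\<lambda>\<sigma>. int (card \<sigma>) - 1) ` K)"

text \<open>Points of the geometric realization: barycentric coordinate functions whose support
  is a simplex of K.\<close>
definition realization_set :: "'v set set \<Rightarrow> ('v \<Rightarrow> real) set" where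
  "realization_set K =
     {f. (\<forall>v. 0 \<le> f v) \<and> {v. f v \<noteq> 0} \<in> K \<and> sum f {v. f v \<noteq> 0} = 1}"

definition closed_simplex :: "'v set set \<Rightarrow> 'v set \<Rightarrow> ('v \<Rightarrow> real) set" where
  "closed_simplex K \<sigma> = {f \<in> realization_set K. {v. f v \<noteq> 0} \<subseteq> \<sigma>}"

text \<open>Geometric realization with the weak (coherent) topology: a subset is open iff its
  intersection with every closed simplex is open in that simplex (with the Euclidean
  topology, induced from the product topology).\<close>
definition realization :: "'v set set \<Rightarrow> ('v \<Rightarrow> real) topology" where
  "realization K = topology (\<lambda>U. U \<subseteq> realization_set K \<and>
      (\<forall>\<sigma>\<in>K. openin (subtopology (powertop_real UNIV) (closed_simplex K \<sigma>))
                     (U \<inter> closed_simplex K \<sigma>)))"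

definition covering_map :: "'a topology \<Rightarrow> 'b topology \<Rightarrow> ('a \<Rightarrow> 'b) \<Rightarrow> bool" where
  "covering_map Xb X q \<longleftrightarrow>
     continuous_map Xb X q \<and> q ` topspace Xb = topspace X \<and>
     (\<forall>x \<in> topspace X. \<exists>U. x \<in> U \<and> openin X U \<and>
        (\<exists>\<V>. \<Union>\<V> = {y \<in> topspace Xb. q y \<in> U} \<and>
             (\<forall>V\<in>\<V>. openin Xb V) \<and> pairwise disjnt \<V> \<and>
             (\<forall>V\<in>\<V>. homeomorphic_map (subtopology Xb V) (subtopology X U) q)))"

definition unit_cube :: "nat \<Rightarrow> (nat \<Rightarrow> real) topology" where
  "unit_cube n = subtopology (Euclidean_space n) {x. \<forall>i<n. 0 \<le> x i \<and> x i \<le> 1}"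

text \<open>Fibration in the sense of Serre: homotopy lifting property for all cubes.\<close>
definition fibration :: "'e topology \<Rightarrow> 'b topology \<Rightarrow> ('e \<Rightarrow> 'b) \<Rightarrow> bool" where
  "fibration E B p \<longleftrightarrow>
     continuous_map E B p \<and>
     (\<forall>n g H. continuous_map (unit_cube n) E g \<and>
        continuous_map (prod_topology (unit_cube n) (top_of_set {0..1::real})) B H \<and>
        (\<forall>x\<in>topspace (unit_cube n). H (x, 0) = p (g x)) \<longrightarrow>
        (\<exists>G. continuous_map (prod_topology (unit_cube n) (top_of_set {0..1::real})) E G \<and>
             (\<forall>z\<in>topspace (prod_topology (unit_cube n) (top_of_set {0..1::real})).
                 p (G z) = H z) \<and>
             (\<forall>x\<in>topspace (unit_cube n). G (x, 0) = g x)))"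

definition n_connected_space :: "int \<Rightarrow> 'a topology \<Rightarrow> bool" where
  "n_connected_space m F \<longleftrightarrow>
     topspace F \<noteq> {} \<and>
     (\<forall>i::nat. int i \<le> m \<longrightarrow>
        (\<forall>f. continuous_map (nsphere i) F f \<longrightarrow>
             (\<exists>c\<in>topspace F. homotopic_with (\<lambda>_. True) (nsphere i) F f (\<lambda>_. c))))"

definition secat_tilde_cover ::
  "'e topology \<Rightarrow> 'b topology \<Rightarrow> 'x topology \<Rightarrow> ('e \<Rightarrow> 'b) \<Rightarrow> ('b \<Rightarrow> 'x) \<Rightarrow> nat \<Rightarrow> bool" where
  "secat_tilde_cover E Xb X p q c \<longleftrightarrow>
     (\<exists>U :: nat \<Rightarrow> 'x set.
        (\<forall>i\<le>c. openin X (U i)) \<and> (\<Union>i\<le>c. U i) = topspace X \<and>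
        (\<forall>i\<le>c. \<exists>s. continuous_map (subtopology Xb {y \<in> topspace Xb. q y \<in> U i}) E s \<and>
                   (\<forall>y \<in> topspace Xb. q y \<in> U i \<longrightarrow> p (s y) = y)))"

definition secat_tilde ::
  "'e topology \<Rightarrow> 'b topology \<Rightarrow> 'x topology \<Rightarrow> ('e \<Rightarrow> 'b) \<Rightarrow> ('b \<Rightarrow> 'x) \<Rightarrow> enat" where
  "secat_tilde E Xb X p q = (INF c \<in> {c. secat_tilde_cover E Xb X p q c}. enat c)"

end

theory Submission
  imports Defs
begin

text \<open>Label the vertices of the barycentric subdivision of \<open>X\<close> by the number of vertices of the
  corresponding simplex, and cut the labels \<open>1, \<dots>, dim X + 1\<close> into \<open>c + 1\<close> groups of at most
  \<open>k + 1\<close> consecutive ones.  Let \<open>U\<^sub>i\<close> be the set of points whose barycentric coordinates with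
  labels in the \<open>i\<close>-th group have sum larger than \<open>1 / (c + 2)\<close>; these open sets cover \<open>X\<close>.
  The simplices of the subdivision lift to \<open>Xb\<close>, and a section over the preimage of \<open>U\<^sub>i\<close> is
  built one lifted simplex at a time.  If all labels of the simplex lie in the group, its dimension
  is at most \<open>k\<close> and the section extends from the boundary by the connectivity of the fibre.
  Otherwise only the part of the simplex where the group has weight at least \<open>1 / (c + 2)\<close>
  matters; the truncating face is free, so this part deforms to the union of its remaining faces
  and the section extends by homotopy lifting.\<close>

section \<open>Relative lifting for fibrations\<close>

text \<open>A Serre fibration lifts only over cubes, and sections on neighbouring cells must agree
  exactly, not up to homotopy. So every cell is treated as a retract of a cube and every extension
  as a strict relative lifting problem. This is why the threshold is positive: the pieces
  \<open>\<epsilon> \<le> sum t A\<close> are closed, so finitely many can be pasted, and they are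
  still cube retracts. For the covering any value below 1 / (c + 1) would do, as the heaviest of c +
  1 groups has at least that weight; 1 / (c + 2) is also below 1 when c = 0. In the barycentric
  subdivision no label is repeated within a simplex, so coordinates can be indexed by labels alone
  and all cells with label set \<open>S\<close> share one model. The connectivity of the fibre is
  given over one point only; the lifting problem on a small cell is moved to that fibre along paths.
  The sections are built on \<open>Xb\<close> itself, with independent choices on different lifts of
  a simplex, so no symmetry of the covering is involved.\<close>

lemma prod_topology_top_of_set:
  "prod_topology (top_of_set A) (top_of_set B) = top_of_set (A \<times> B)"
  by (simp add: prod_topology_subtopology_eu)

lemma unit_cube_eq:
  "unit_cube n = top_of_set {x. (\<forall>i<n. 0 \<le> x i \<and> x i \<le> 1) \<and> (\<forall>i\<ge>n. x i = 0)}"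
proof -
  have "{x. \<forall>i\<ge>n. x i = (0::real)} \<inter> {x. \<forall>i<n. 0 \<le> x i \<and> x i \<le> 1}
     = {x. (\<forall>i<n. 0 \<le> x i \<and> x i \<le> 1) \<and> (\<forall>i\<ge>n. x i = 0)}"
    by auto
  then show ?thesis
    by (simp add: unit_cube_def Euclidean_space_def euclidean_product_topology subtopology_subtopology)
qed

lemma continuous_on_apply: "continuous_on A (\<lambda>x. x j)" for A :: "('i \<Rightarrow> 'a::topological_space) set"
  by (rule continuous_on_subset[OF continuous_on_product_coordinates]) simp

lemma continuous_on_apply_compose:
  fixes f :: "'a::topological_space \<Rightarrow> 'i \<Rightarrow> 'b::topological_space"
  shows "continuous_on A f \<Longrightarrow> continuous_on A (\<lambda>x. f x j)"
  by (rule continuous_on_product_then_coordinatewise)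

lemma continuous_on_Min:
  fixes f :: "'j \<Rightarrow> 'a::topological_space \<Rightarrow> real"
  assumes "finite S" "S \<noteq> {}" "\<And>j. j \<in> S \<Longrightarrow> continuous_on A (f j)"
  shows "continuous_on A (\<lambda>x. Min ((\<lambda>j. f j x) ` S))"
  using assms
proof (induction S rule: finite_ne_induct)
  case (singleton x)
  then show ?case by simp
next
  case (insert x F)
  then have "(\<lambda>y. Min ((\<lambda>j. f j y) ` insert x F)) = (\<lambda>y. min (f x y) (Min ((\<lambda>j. f j y) ` F)))"
    by simp
  moreover have "continuous_on A (\<lambda>y. min (f x y) (Min ((\<lambda>j. f j y) ` F)))"
    using insert by (intro continuous_intros) auto
  ultimately show ?case
    by (simp only:)
qed

text \<open>Homotopy lifting is assumed for cubes only, but it passes to retracts. A retraction is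
  easier to write down than a homeomorphism with a cube, notably for truncated simplices and
  horns.\<close>

definition cube_retract :: "(nat \<Rightarrow> real) set \<Rightarrow> bool" where
  "cube_retract P \<longleftrightarrow> (\<exists>n r. continuous_map (unit_cube n) (top_of_set P) r \<and>
      P \<subseteq> topspace (unit_cube n) \<and> (\<forall>x\<in>P. r x = x))"

lemma cube_retract_trans:
  assumes "cube_retract P" "continuous_on P r" "r \<in> P \<rightarrow> Q" "Q \<subseteq> P" "\<And>x. x \<in> Q \<Longrightarrow> r x = x"
  shows "cube_retract Q"
proof -
  obtain n r' where r': "continuous_map (unit_cube n) (top_of_set P) r'"
      "P \<subseteq> topspace (unit_cube n)" "\<forall>x\<in>P. r' x = x"
    using assms unfolding cube_retract_def by blast
  have "continuous_map (unit_cube n) (top_of_set Q) (r \<circ> r')"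
    by (rule continuous_map_compose[OF r'(1)]) (use assms in simp)
  with r' assms show ?thesis
    unfolding cube_retract_def by (intro exI[of _ n] exI[of _ "r \<circ> r'"]) auto
qed

text \<open>Pulling the data back along the retraction gives a lifting problem over the whole cube;
  its solution is restricted to \<open>P\<close>, where the retraction is the identity.\<close>

lemma homotopy_lifting_cube_retract:
  assumes fib: "fibration E B p" and P: "cube_retract P"
    and g: "continuous_map (top_of_set P) E g"
    and H: "continuous_map (top_of_set (P \<times> {0..1::real})) B H"
    and eq: "\<And>x. x \<in> P \<Longrightarrow> p (g x) = H (x, 0)"
  obtains G where "continuous_map (top_of_set (P \<times> {0..1::real})) E G"
    "\<And>z. z \<in> P \<times> {0..1} \<Longrightarrow> p (G z) = H z" "\<And>x. x \<in> P \<Longrightarrow> G (x, 0) = g x"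
proof -
  obtain n r where r: "continuous_map (unit_cube n) (top_of_set P) r"
      "P \<subseteq> topspace (unit_cube n)" "\<forall>x\<in>P. r x = x"
    using P unfolding cube_retract_def by blast
  let ?C = "topspace (unit_cube n)"
  have C: "unit_cube n = top_of_set ?C"
    by (simp add: unit_cube_eq)
  have rC: "continuous_on ?C r" "r \<in> ?C \<rightarrow> P"
    using r(1) by (subst (asm) C, simp)+
  have c1: "continuous_map (unit_cube n) E (g \<circ> r)"
    by (rule continuous_map_compose[OF r(1) g])
  have c2: "continuous_map (prod_topology (unit_cube n) (top_of_set {0..1::real})) B
      (H \<circ> (\<lambda>z. (r (fst z), snd z)))"
  proof (rule continuous_map_compose[OF _ H])
    have "continuous_on (?C \<times> {0..1::real}) (\<lambda>z. (r (fst z), snd z))"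
      by (intro continuous_intros continuous_on_compose2[OF rC(1)]) auto
    then show "continuous_map (prod_topology (unit_cube n) (top_of_set {0..1::real}))
      (top_of_set (P \<times> {0..1})) (\<lambda>z. (r (fst z), snd z))"
      using rC(2) by (subst C) (auto simp: prod_topology_top_of_set)
  qed
  have c3: "\<forall>x\<in>?C. (H \<circ> (\<lambda>z. (r (fst z), snd z))) (x, 0) = p ((g \<circ> r) x)"
  proof
    fix x assume "x \<in> ?C"
    then have "r x \<in> P"
      using rC(2) by auto
    then show "(H \<circ> (\<lambda>z. (r (fst z), snd z))) (x, 0) = p ((g \<circ> r) x)"
      using eq[of "r x"] by simp
  qed
  have "\<exists>G. continuous_map (prod_topology (unit_cube n) (top_of_set {0..1::real})) E G \<and>
      (\<forall>z\<in>topspace (prod_topology (unit_cube n) (top_of_set {0..1::real})).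
         p (G z) = (H \<circ> (\<lambda>z. (r (fst z), snd z))) z) \<and>
      (\<forall>x\<in>?C. G (x, 0) = (g \<circ> r) x)"
    by (rule fib[unfolded fibration_def, THEN conjunct2, THEN spec, THEN spec, THEN spec, THEN mp])
      (intro conjI c1 c2 c3)
  then obtain G where
    G: "continuous_map (prod_topology (unit_cube n) (top_of_set {0..1::real})) E G"
     "\<And>z. z \<in> ?C \<times> {0..1} \<Longrightarrow> p (G z) = (H \<circ> (\<lambda>z. (r (fst z), snd z))) z"
     "\<And>x. x \<in> ?C \<Longrightarrow> G (x, 0) = (g \<circ> r) x"
    by auto
  show ?thesis
  proof
    have "continuous_map (top_of_set (?C \<times> {0..1::real})) E G"
      using G(1) by (subst (asm) C) (simp add: prod_topology_top_of_set)
    then have "continuous_map (subtopology (top_of_set (?C \<times> {0..1::real})) (P \<times> {0..1})) E G"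
      by (rule continuous_map_from_subtopology)
    moreover have "(?C \<times> {0..1}) \<inter> (P \<times> {0..1::real}) = P \<times> {0..1}"
      using r(2) by auto
    ultimately show "continuous_map (top_of_set (P \<times> {0..1::real})) E G"
      by (simp add: subtopology_subtopology)
    have rx: "x \<in> ?C" "r x = x" if "x \<in> P" for x
      using that r by auto
    show "p (G z) = H z" if "z \<in> P \<times> {0..1}" for z
      using that rx G(2)[of z] by (cases z) auto
    show "G (x, 0) = g x" if "x \<in> P" for x
      using that rx G(3)[of x] by simp
  qed
qed

text \<open>The right lifting property of \<open>p\<close> against the inclusion of
  \<open>P \<inter> J\<close> into \<open>P\<close>, with both triangles commuting strictly.
  \<open>J\<close> need not lie in \<open>P\<close>, so one description of the faces serves a
  simplex and its truncations.\<close>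

definition relative_lifting ::
  "'e topology \<Rightarrow> 'b topology \<Rightarrow> ('e \<Rightarrow> 'b) \<Rightarrow> 'a::topological_space set \<Rightarrow> 'a set \<Rightarrow> bool" where
  "relative_lifting E B p P J \<longleftrightarrow>
     (\<forall>f g. continuous_map (top_of_set P) B f \<and> continuous_map (top_of_set (P \<inter> J)) E g \<and>
        (\<forall>x\<in>P \<inter> J. p (g x) = f x) \<longrightarrow>
        (\<exists>s. continuous_map (top_of_set P) E s \<and> (\<forall>x\<in>P. p (s x) = f x) \<and> (\<forall>x\<in>P \<inter> J. s x = g x)))"

lemma relative_liftingE:
  assumes "relative_lifting E B p P J" "continuous_map (top_of_set P) B f"
    "continuous_map (top_of_set (P \<inter> J)) E g" "\<And>x. x \<in> P \<inter> J \<Longrightarrow> p (g x) = f x"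
  obtains s where "continuous_map (top_of_set P) E s" "\<And>x. x \<in> P \<Longrightarrow> p (s x) = f x"
    "\<And>x. x \<in> P \<inter> J \<Longrightarrow> s x = g x"
  using assms unfolding relative_lifting_def by blast

lemma continuous_map_top_of_set_compose:
  assumes "continuous_on A h" "h \<in> A \<rightarrow> B" "continuous_map (top_of_set B) X f"
  shows "continuous_map (top_of_set A) X (\<lambda>x. f (h x))"
  using continuous_map_compose[of "top_of_set A" "top_of_set B" h X f] assms
  by (simp add: o_def)

lemma continuous_map_top_of_set_subset:
  assumes "continuous_map (top_of_set B) X f" "A \<subseteq> B"
  shows "continuous_map (top_of_set A) X f"
  using continuous_map_from_subtopology_mono assms by blast

text \<open>Lifting properties are inherited by retracts of pairs: \<open>i\<close> and
  \<open>r\<close> exhibit the pair of \<open>P\<close> and \<open>J\<close> as a retract of that of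
  \<open>P'\<close> and \<open>J'\<close>.\<close>

lemma relative_lifting_retract:
  assumes RL: "relative_lifting E B p P' J'"
    and i: "continuous_on P i" "i \<in> P \<rightarrow> P'" "\<And>x. x \<in> P \<Longrightarrow> x \<in> J \<Longrightarrow> i x \<in> J'"
    and r: "continuous_on P' r" "r \<in> P' \<rightarrow> P" "\<And>x. x \<in> P' \<Longrightarrow> x \<in> J' \<Longrightarrow> r x \<in> J"
    and ri: "\<And>x. x \<in> P \<Longrightarrow> r (i x) = x"
  shows "relative_lifting E B p P J"
  unfolding relative_lifting_def
proof (intro allI impI; elim conjE)
  fix f g
  assume f: "continuous_map (top_of_set P) B f" and g: "continuous_map (top_of_set (P \<inter> J)) E g"
    and pg: "\<forall>x\<in>P \<inter> J. p (g x) = f x"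
  have fr: "continuous_map (top_of_set P') B (\<lambda>x. f (r x))"
    by (rule continuous_map_top_of_set_compose[OF r(1,2) f])
  have "continuous_on (P' \<inter> J') r"
    by (rule continuous_on_subset[OF r(1)]) auto
  then have gr: "continuous_map (top_of_set (P' \<inter> J')) E (\<lambda>x. g (r x))"
    by (rule continuous_map_top_of_set_compose[OF _ _ g]) (use r(2,3) in auto)
  have pgr: "p (g (r x)) = f (r x)" if "x \<in> P' \<inter> J'" for x
    using that r(2,3) pg by auto
  obtain s where s: "continuous_map (top_of_set P') E s" "\<And>x. x \<in> P' \<Longrightarrow> p (s x) = f (r x)"
    "\<And>x. x \<in> P' \<inter> J' \<Longrightarrow> s x = g (r x)"
    using relative_liftingE[OF RL fr gr pgr] by blast
  show "\<exists>s. continuous_map (top_of_set P) E s \<and> (\<forall>x\<in>P. p (s x) = f x) \<and> (\<forall>x\<in>P \<inter> J. s x = g x)"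
  proof (intro exI[of _ "\<lambda>x. s (i x)"] conjI ballI)
    show "continuous_map (top_of_set P) E (\<lambda>x. s (i x))"
      by (rule continuous_map_top_of_set_compose[OF i(1,2) s(1)])
  next
    fix x assume "x \<in> P"
    then show "p (s (i x)) = f x"
      using s(2)[of "i x"] i(2) ri[of x] by auto
  next
    fix x assume "x \<in> P \<inter> J"
    then show "s (i x) = g x"
      using s(3)[of "i x"] i(2) i(3)[of x] ri[of x] by auto
  qed
qed

text \<open>The path \<open>u \<mapsto> H (x, u)\<close> runs from a point of \<open>J\<close> to \<open>x\<close>, which it reaches at time
  \<open>m x\<close>.  Lifting all these paths and evaluating at time \<open>m x\<close>, rather than at time \<open>1\<close>,
  keeps the lift unchanged on \<open>J\<close>, where \<open>m\<close> vanishes.\<close>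
lemma relative_lifting_deformation:
  assumes fib: "fibration E B p" and P: "cube_retract P"
    and H: "continuous_on (P \<times> {0..1::real}) H" "H \<in> P \<times> {0..1} \<rightarrow> P"
    and m: "continuous_on P m" "m \<in> P \<rightarrow> {0..1::real}"
    and H0: "\<And>x. x \<in> P \<Longrightarrow> H (x, 0) \<in> J" and Hm: "\<And>x. x \<in> P \<Longrightarrow> H (x, m x) = x"
    and J: "\<And>x. x \<in> P \<Longrightarrow> x \<in> J \<Longrightarrow> m x = 0"
  shows "relative_lifting E B p P J"
  unfolding relative_lifting_def
proof (intro allI impI; elim conjE)
  fix f g
  assume f: "continuous_map (top_of_set P) B f" and g: "continuous_map (top_of_set (P \<inter> J)) E g"
    and pg: "\<forall>x\<in>P \<inter> J. p (g x) = f x"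
  have H0': "H (x, 0) \<in> P" if "x \<in> P" for x
    using that H(2) by auto
  have "continuous_on P (\<lambda>x. H (x, 0))"
    by (rule continuous_on_compose2[OF H(1)]) (intro continuous_intros, auto)
  then have gH: "continuous_map (top_of_set P) E (\<lambda>x. g (H (x, 0)))"
    by (rule continuous_map_top_of_set_compose[OF _ _ g]) (use H0 H0' in auto)
  have fH: "continuous_map (top_of_set (P \<times> {0..1})) B (\<lambda>z. f (H z))"
    by (rule continuous_map_top_of_set_compose[OF H f])
  have pgH: "p (g (H (x, 0))) = f (H (x, 0))" if "x \<in> P" for x
    using that pg H0 H0' by auto
  obtain G where G: "continuous_map (top_of_set (P \<times> {0..1::real})) E G"
    "\<And>z. z \<in> P \<times> {0..1} \<Longrightarrow> p (G z) = f (H z)" "\<And>x. x \<in> P \<Longrightarrow> G (x, 0) = g (H (x, 0))"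
    using homotopy_lifting_cube_retract[OF fib P gH fH pgH] by blast
  have "continuous_map (top_of_set P) E (\<lambda>x. G (x, m x))"
    by (rule continuous_map_top_of_set_compose[OF _ _ G(1)])
      (use m in \<open>auto intro: continuous_on_Pair continuous_on_id\<close>)
  moreover have "G (x, m x) = g x" if "x \<in> P" "x \<in> J" for x
    using that G(3)[of x] J[of x] Hm[of x] by simp
  ultimately show "\<exists>s. continuous_map (top_of_set P) E s \<and> (\<forall>x\<in>P. p (s x) = f x) \<and>
      (\<forall>x\<in>P \<inter> J. s x = g x)"
    using G(2) Hm m(2) by (intro exI[of _ "\<lambda>x. G (x, m x)"]) (simp add: Pi_iff)
qed

section \<open>Simplices, truncated simplices and prisms\<close>

lemma continuous_map_finite_closed_Union:
  fixes T :: "'i \<Rightarrow> 'a::topological_space set"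
  assumes "finite I" "\<And>i. i \<in> I \<Longrightarrow> closed (T i)"
    "\<And>i. i \<in> I \<Longrightarrow> continuous_map (top_of_set (T i)) X f"
  shows "continuous_map (top_of_set (\<Union>i\<in>I. T i)) X f"
proof (rule pasting_lemma_closed[where I = I and T = T and f = "\<lambda>_. f"])
  show "closedin (top_of_set (\<Union>i\<in>I. T i)) (T i)" if "i \<in> I" for i
    by (rule closed_subset) (use that assms in auto)
  show "continuous_map (subtopology (top_of_set (\<Union>i\<in>I. T i)) (T i)) X f" if "i \<in> I" for i
  proof -
    have "(\<Union>i\<in>I. T i) \<inter> T i = T i"
      using that by auto
    then show ?thesis
      using assms(3)[OF that] by (simp add: subtopology_subtopology)
  qed
qed (use assms in auto)

lemma continuous_map_closed_Un:
  fixes A B :: "'a::topological_space set"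
  assumes "closed A" "closed B" "continuous_map (top_of_set A) X f" "continuous_map (top_of_set B) X f"
  shows "continuous_map (top_of_set (A \<union> B)) X f"
proof -
  have "continuous_map (top_of_set (\<Union>i\<in>{True, False}. if i then A else B)) X f"
    by (rule continuous_map_finite_closed_Union) (use assms in auto)
  then show ?thesis
    by (simp add: Un_commute)
qed

lemma continuous_map_top_of_set_eq:
  assumes "continuous_map (top_of_set A) X f" "\<And>x. x \<in> A \<Longrightarrow> f x = g x"
  shows "continuous_map (top_of_set A) X g"
  using assms by (intro continuous_map_eq[of _ _ f g]) auto

text \<open>Coordinates are extended by zero outside \<open>S\<close>, so the simplex on a subset of
  \<open>S\<close> is literally a subset, and all simplices lie in one function space.\<close>

definition coord_simplex :: "nat set \<Rightarrow> (nat \<Rightarrow> real) set" where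
  "coord_simplex S = {t. (\<forall>j. 0 \<le> t j) \<and> (\<forall>j. j \<notin> S \<longrightarrow> t j = 0) \<and> sum t S = 1}"

definition trunc_simplex :: "nat set \<Rightarrow> real \<Rightarrow> nat set \<Rightarrow> (nat \<Rightarrow> real) set" where
  "trunc_simplex A \<epsilon> S = {t \<in> coord_simplex S. \<epsilon> \<le> sum t A}"

definition coord_faces :: "nat set \<Rightarrow> (nat \<Rightarrow> real) set" where
  "coord_faces S = {t. \<exists>j\<in>S. t j = 0}"

lemma coord_simplex_empty [simp]: "coord_simplex {} = {}"
  by (simp add: coord_simplex_def)

lemma coord_simplex_mono:
  assumes "finite S" "S' \<subseteq> S" shows "coord_simplex S' \<subseteq> coord_simplex S"
proof
  fix t assume t: "t \<in> coord_simplex S'"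
  then have "sum t S' = sum t S"
    using assms by (intro sum.mono_neutral_left) (auto simp: coord_simplex_def)
  with t assms show "t \<in> coord_simplex S"
    by (auto simp: coord_simplex_def)
qed

lemma coord_simplex_face:
  assumes "finite S" "t \<in> coord_simplex S" "\<And>j. j \<in> S - S' \<Longrightarrow> t j = 0" "S' \<subseteq> S"
  shows "t \<in> coord_simplex S'"
proof -
  have "sum t S' = sum t S"
    using assms by (intro sum.mono_neutral_left) auto
  with assms show ?thesis
    by (auto simp: coord_simplex_def)
qed

lemma sum_coord_simplex:
  assumes "t \<in> coord_simplex S" "finite A"
  shows "sum t A = sum t (S \<inter> A)"
  using assms by (intro sum.mono_neutral_right) (auto simp: coord_simplex_def)

lemma coord_le_one: "t \<in> coord_simplex S \<Longrightarrow> finite S \<Longrightarrow> t j \<le> 1"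
  using member_le_sum[of j S t] by (cases "j \<in> S") (auto simp: coord_simplex_def)

lemma closed_coord_simplex: "closed (coord_simplex S)"
proof -
  have "coord_simplex S = (\<Inter>j. {t. 0 \<le> t j}) \<inter> (\<Inter>j\<in>-S. {t. t j = 0}) \<inter> {t. sum t S = 1}"
    by (auto simp: coord_simplex_def)
  also have "closed \<dots>"
    by (intro closed_Int closed_INT ballI closed_Collect_le closed_Collect_eq
        continuous_on_const continuous_on_apply continuous_on_sum)
  finally show ?thesis .
qed

lemma closed_trunc_simplex: "closed (trunc_simplex A \<epsilon> S)"
proof -
  have "trunc_simplex A \<epsilon> S = coord_simplex S \<inter> {t. \<epsilon> \<le> sum t A}"
    by (auto simp: trunc_simplex_def)
  also have "closed \<dots>"
    by (intro closed_Int closed_coord_simplex closed_Collect_le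
        continuous_on_const continuous_on_apply continuous_on_sum)
  finally show ?thesis .
qed

lemma trunc_simplex_full:
  assumes "finite A" "S \<subseteq> A" "\<epsilon> \<le> 1" shows "trunc_simplex A \<epsilon> S = coord_simplex S"
  using assms sum_coord_simplex[of _ S A]
  by (auto simp: trunc_simplex_def coord_simplex_def Int_absorb2)

text \<open>Coordinates outside \<open>S\<close> are dropped. If those in \<open>S\<close> sum to
  less than 1, the deficit is put on the label \<open>w\<close>; if they sum to more than 1, they
  are rescaled. The two \<open>max\<close> turn this into one continuous formula.\<close>

lemma cube_retract_coord_simplex:
  assumes S: "finite S" "S \<noteq> {}"
  shows "cube_retract (coord_simplex S)"
proof -
  obtain w where w: "w \<in> S" using S by auto
  obtain n where n: "S \<subseteq> {..<n}"
    using S(1) finite_nat_iff_bounded by blast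
  define r where "r t = (\<lambda>j. if j \<in> S then (t j + (if j = w then max 0 (1 - sum t S) else 0)) /
      max 1 (sum t S) else 0)" for t :: "nat \<Rightarrow> real"
  let ?C = "{x. (\<forall>i<n. 0 \<le> x i \<and> x i \<le> 1) \<and> (\<forall>i\<ge>n. x i = (0::real))}"
  have "continuous_on ?C r"
    unfolding r_def
  proof (rule continuous_on_coordinatewise_then_product)
    fix j
    have 1: "continuous_on ?C (\<lambda>t. (t j + (if j = w then max 0 (1 - sum t S) else 0)) / max 1 (sum t S))"
      by (cases "j = w"; simp; intro continuous_intros continuous_on_apply) auto
    show "continuous_on ?C (\<lambda>t. if j \<in> S then (t j + (if j = w then max 0 (1 - sum t S) else 0)) /
      max 1 (sum t S) else 0)"
      using 1 by (cases "j \<in> S") simp_all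
  qed
  moreover have "r t \<in> coord_simplex S" if t: "t \<in> ?C" for t
  proof -
    have t0: "0 \<le> t j" for j
      using t by (cases "j < n") auto
    have "sum (r t) S = (\<Sum>j\<in>S. (t j + (if j = w then max 0 (1 - sum t S) else 0)) / max 1 (sum t S))"
      by (intro sum.cong) (auto simp: r_def)
    also have "\<dots> = (sum t S + max 0 (1 - sum t S)) / max 1 (sum t S)"
      using S w by (simp add: sum_divide_distrib[symmetric] sum.distrib)
    also have "\<dots> = 1"
      by (auto simp: max_def)
    finally show ?thesis
      using t0 by (auto simp: coord_simplex_def r_def)
  qed
  moreover have "r x = x" if "x \<in> coord_simplex S" for x
    using that by (auto simp: coord_simplex_def r_def)
  moreover have "coord_simplex S \<subseteq> ?C"
    using n coord_le_one[OF _ S(1)] by (auto simp: coord_simplex_def subset_iff)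
  ultimately show ?thesis
    unfolding cube_retract_def unit_cube_eq
    by (intro exI[of _ n] exI[of _ r]) (auto simp: Pi_iff)
qed

lemma cube_retract_trunc_simplex:
  assumes S: "finite S" "S \<inter> A \<noteq> {}" and A: "finite A" and \<epsilon>: "0 < \<epsilon>" "\<epsilon> < 1"
  shows "cube_retract (trunc_simplex A \<epsilon> S)"
proof -
  obtain w where w: "w \<in> S" "w \<in> A" using S by auto
  \<comment> \<open>Moving \<open>t\<close> by the fraction l towards the vertex \<open>w\<close> of
    the group changes a group weight a into (1 - l) a + l, which equals \<epsilon> for l =
    (\<epsilon> - a) / (1 - a). The two \<open>max\<close> make \<open>l\<close> vanish for a \<ge>
    \<epsilon> and keep the denominator positive.\<close>
  define l where "l t = max 0 (\<epsilon> - sum t A) / max (1 - sum t A) (1 - \<epsilon>)" for t :: "nat \<Rightarrow> real"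
  define r where "r t = (\<lambda>j. (1 - l t) * t j + (if j = w then l t else 0))" for t
  have l01: "0 \<le> l t" "l t \<le> 1" for t
    using \<epsilon> by (auto simp: l_def divide_simps)
  have "continuous_on (coord_simplex S) l"
    unfolding l_def using \<epsilon> by (intro continuous_intros continuous_on_apply) auto
  then have "continuous_on (coord_simplex S) (\<lambda>t. r t j)" for j
    unfolding r_def by (cases "j = w") (auto intro!: continuous_intros continuous_on_apply)
  then have "continuous_on (coord_simplex S) r"
    by (rule continuous_on_coordinatewise_then_product)
  moreover have "r \<in> coord_simplex S \<rightarrow> trunc_simplex A \<epsilon> S"
  proof
    fix t assume t: "t \<in> coord_simplex S"
    have sum_r: "sum (r t) D = (1 - l t) * sum t D + l t" if "finite D" "w \<in> D" for D
      using that by (simp add: r_def sum.distrib sum_distrib_left)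
    have "\<epsilon> \<le> (1 - l t) * sum t A + l t"
    proof (cases "sum t A < \<epsilon>")
      case True
      then have l: "l t = (\<epsilon> - sum t A) / (1 - sum t A)" and "sum t A < 1"
        using \<epsilon> by (auto simp: l_def)
      then have "l t * (1 - sum t A) = \<epsilon> - sum t A"
        by simp
      then show ?thesis
        by (simp add: algebra_simps)
    next
      case False
      then have "l t = 0" by (simp add: l_def)
      with False show ?thesis by simp
    qed
    then show "r t \<in> trunc_simplex A \<epsilon> S"
      using t w S A l01 by (auto simp: trunc_simplex_def coord_simplex_def sum_r) (auto simp: r_def)
  qed
  moreover have "r x = x" if "x \<in> trunc_simplex A \<epsilon> S" for x
  proof -
    have "l x = 0" using that by (auto simp: trunc_simplex_def l_def)
    then show ?thesis by (auto simp: r_def)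
  qed
  ultimately show ?thesis
    by (intro cube_retract_trans[OF cube_retract_coord_simplex[of S], of r "trunc_simplex A \<epsilon> S"])
      (use S in \<open>auto simp: trunc_simplex_def\<close>)
qed

text \<open>The deformation subtracts from \<open>x\<close> the largest possible multiple of a base point \<open>z\<close> lying
  beyond the truncating face and renormalises, i.e. it projects from \<open>z\<close> to the other faces.\<close>
lemma relative_lifting_trunc_simplex:
  assumes fib: "fibration E B p" and S: "finite S" "S \<inter> A \<noteq> {}" "S - A \<noteq> {}" and A: "finite A"
    and \<epsilon>: "0 < \<epsilon>" "\<epsilon> < 1"
  shows "relative_lifting E B p (trunc_simplex A \<epsilon> S) (coord_faces S)"
proof -
  let ?P = "trunc_simplex A \<epsilon> S"
  \<comment> \<open>The group weight of \<open>z\<close> is \<epsilon> / 2, so \<open>z\<close> lies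
    in the part that is cut off. Spreading the weights evenly makes every coordinate on
    \<open>S\<close> positive, as the quotients by \<open>z j\<close> below require.\<close>
  define z where "z j = (if j \<in> S \<inter> A then \<epsilon> / (2 * card (S \<inter> A)) else
      if j \<in> S - A then (1 - \<epsilon> / 2) / card (S - A) else 0)" for j
  have card: "card (S \<inter> A) > 0" "card (S - A) > 0"
    using S by (auto simp: card_gt_0_iff)
  have zpos: "z j > 0" if "j \<in> S" for j
    using that card \<epsilon> by (auto simp: z_def)
  have "sum z (S \<inter> A) = (\<Sum>j\<in>S \<inter> A. \<epsilon> / (2 * card (S \<inter> A)))"
    by (intro sum.cong) (auto simp: z_def)
  then have zSA: "sum z (S \<inter> A) = \<epsilon> / 2"
    using card by simp
  have "sum z (S - A) = (\<Sum>j\<in>S - A. (1 - \<epsilon> / 2) / card (S - A))"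
    by (intro sum.cong) (auto simp: z_def)
  then have zSnA: "sum z (S - A) = 1 - \<epsilon> / 2"
    using card by simp
  have zS: "sum z S = 1"
    using zSA zSnA S(1) sum.Int_Diff[of S z A] by simp
  have zA: "sum z A = \<epsilon> / 2"
    using zSA A by (subst sum.mono_neutral_right[of A "S \<inter> A"]) (auto simp: z_def)
  have z_out: "z j = 0" if "j \<notin> S" for j
    using that by (auto simp: z_def)
  define m where "m x = Min ((\<lambda>j. x j / z j) ` S)" for x :: "nat \<Rightarrow> real"
  have Sne: "S \<noteq> {}" using S by auto
  have m_le: "m x * z j \<le> x j" if "j \<in> S" for x j
  proof -
    have "m x \<le> x j / z j"
      unfolding m_def using that S by (intro Min_le) auto
    then show ?thesis using zpos[OF that] by (simp add: field_simps)
  qed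
  have m_eq: "\<exists>j\<in>S. x j = m x * z j" for x
  proof -
    have "m x \<in> (\<lambda>j. x j / z j) ` S"
      unfolding m_def using S Sne by (intro Min_in) auto
    then obtain j where "j \<in> S" "m x = x j / z j" by auto
    then show ?thesis using zpos[of j] by (intro bexI[of _ j]) auto
  qed
  have m_nonneg: "0 \<le> m x" if "x \<in> ?P" for x
  proof -
    obtain j where "j \<in> S" "x j = m x * z j" using m_eq by blast
    moreover have "0 \<le> x j" using that by (auto simp: trunc_simplex_def coord_simplex_def)
    ultimately show ?thesis using zpos[of j] by (simp add: zero_le_mult_iff)
  qed
  \<comment> \<open>Outside the group \<open>x\<close> has weight at most 1 - \<epsilon> but
    \<open>z\<close> has weight 1 - \<epsilon> / 2, so \<open>z\<close> cannot be subtracted in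
    full. This keeps the denominator of \<open>H\<close> positive.\<close>
  have m_less: "m x < 1" if x: "x \<in> ?P" for x
  proof (rule ccontr)
    assume "\<not> m x < 1"
    have "z j \<le> x j" if "j \<in> S - A" for j
    proof -
      have "1 * z j \<le> m x * z j"
        using \<open>\<not> m x < 1\<close> zpos[of j] that by (intro mult_right_mono) auto
      then show ?thesis using m_le[of j x] that by simp
    qed
    then have "sum z (S - A) \<le> sum x (S - A)"
      by (intro sum_mono)
    moreover have "sum x S = 1" "\<epsilon> \<le> sum x (S \<inter> A)"
      using x A sum_coord_simplex[of x S A] by (auto simp: trunc_simplex_def coord_simplex_def)
    ultimately show False
      using zSnA \<epsilon> sum.Int_Diff[OF S(1), of x A] by simp
  qed
  have cont_m: "continuous_on ?P m"
    unfolding m_def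
    using S Sne zpos by (intro continuous_on_Min continuous_intros continuous_on_apply) force+
  \<comment> \<open>At time \<open>u\<close> the multiple still subtracted is
    \<open>m x - u\<close>, cut off at 0: at time 0 some coordinate vanishes, and from time
    \<open>m x\<close> on the point is \<open>x\<close> itself.\<close>
  define s where "s v = max 0 (m (fst v) - snd v)" for v :: "(nat \<Rightarrow> real) \<times> real"
  define H where "H v = (\<lambda>j. (fst v j - s v * z j) / (1 - s v))" for v
  have s01: "0 \<le> s v" "s v \<le> m (fst v)" "s v < 1" if "v \<in> ?P \<times> {0..1}" for v
    using that m_less[of "fst v"] m_nonneg[of "fst v"] by (auto simp: s_def max_def)
  have cont_s: "continuous_on (?P \<times> {0..1}) s"
    unfolding s_def
    by (intro continuous_intros continuous_on_compose2[OF cont_m]) auto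
  have "continuous_on (?P \<times> {0..1}) (\<lambda>v. fst v j)" for j
    by (rule continuous_on_apply_compose) (intro continuous_intros)
  then have "continuous_on (?P \<times> {0..1}) (\<lambda>v. (fst v j - s v * z j) / (1 - s v))" for j
    by (intro continuous_on_divide continuous_on_diff continuous_on_mult continuous_on_const cont_s)
      (use s01(3) in fastforce)+
  then have cont_H: "continuous_on (?P \<times> {0..1}) H"
    unfolding H_def by (rule continuous_on_coordinatewise_then_product)
  have H_in: "H v \<in> ?P" if v: "v \<in> ?P \<times> {0..1}" for v
  proof -
    obtain x u where [simp]: "v = (x, u)" by (cases v)
    have x: "x \<in> ?P" using v by auto
    note s = s01[OF v, simplified]
    have "0 \<le> H v j" for j
    proof (cases "j \<in> S")
      case True
      have "s v * z j \<le> m x * z j"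
        using s zpos[OF True] by (intro mult_right_mono) auto
      then have "s v * z j \<le> x j"
        using m_le[OF True, of x] by linarith
      then show ?thesis using s by (simp add: H_def)
    next
      case False
      then show ?thesis using x z_out[of j] by (auto simp: H_def trunc_simplex_def coord_simplex_def)
    qed
    moreover have "H v j = 0" if "j \<notin> S" for j
      using that x z_out[of j] by (auto simp: H_def trunc_simplex_def coord_simplex_def)
    moreover have sum_H: "sum (H v) D = (sum x D - s v * sum z D) / (1 - s v)" for D
      by (simp add: H_def sum_divide_distrib[symmetric] sum_subtractf sum_distrib_left)
    moreover have "sum x S = 1"
      using x by (auto simp: trunc_simplex_def coord_simplex_def)
    \<comment> \<open>The truncating face is never crossed: removing a multiple of \<open>z\<close>,
      whose group weight is below \<epsilon>, and renormalising cannot push the group weight under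
      \<epsilon>.\<close>
    moreover have "\<epsilon> \<le> sum (H v) A"
    proof -
      have "\<epsilon> \<le> sum x A" using x by (auto simp: trunc_simplex_def)
      moreover have "s v * (\<epsilon> / 2) \<le> s v * \<epsilon>"
        using s \<epsilon> by (intro mult_left_mono) auto
      ultimately have "\<epsilon> * (1 - s v) \<le> sum x A - s v * sum z A"
        unfolding zA by (simp add: algebra_simps)
      then show ?thesis
        unfolding sum_H using s by (simp add: pos_le_divide_eq)
    qed
    ultimately show ?thesis
      using s zS by (auto simp: trunc_simplex_def coord_simplex_def)
  qed
  show ?thesis
  proof (rule relative_lifting_deformation[OF fib _ cont_H _ cont_m])
    show "cube_retract ?P"
      using cube_retract_trunc_simplex S A \<epsilon> by blast
    show "H \<in> ?P \<times> {0..1} \<rightarrow> ?P"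
      using H_in by blast
    show "m \<in> ?P \<rightarrow> {0..1}"
      using m_nonneg m_less by (auto simp: less_imp_le)
    show "H (x, 0) \<in> coord_faces S" if "x \<in> ?P" for x
    proof -
      have "s (x, 0) = m x" using m_nonneg[OF that] by (simp add: s_def)
      moreover obtain j where "j \<in> S" "x j = m x * z j" using m_eq by blast
      ultimately show ?thesis by (auto simp: coord_faces_def H_def intro!: bexI[of _ j])
    qed
    show "H (x, m x) = x" if "x \<in> ?P" for x
      by (simp add: H_def s_def)
    show "m x = 0" if "x \<in> ?P" "x \<in> coord_faces S" for x
    proof -
      obtain j where j: "j \<in> S" "x j = 0" using \<open>x \<in> coord_faces S\<close> by (auto simp: coord_faces_def)
      then have "m x * z j \<le> 0" using m_le[of j x] by simp
      then show ?thesis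
        using zpos[OF j(1)] m_nonneg[OF that(1)] by (simp add: mult_le_0_iff)
    qed
  qed
qed

text \<open>A prism is a simplex truncated near the vertex \<open>w\<close>.\<close>
lemma relative_lifting_prism:
  assumes fib: "fibration E B p" and S: "finite S" "S \<noteq> {}"
  shows "relative_lifting E B p (coord_simplex S \<times> {0..1::real}) {v. snd v = 0 \<or> fst v \<in> coord_faces S}"
proof -
  obtain w where w: "w \<notin> S"
    using S(1) ex_new_if_finite infinite_UNIV_nat by blast
  \<comment> \<open>Time becomes the coordinate of the new label \<open>w\<close>. It is halved so
    that time 1 lands on the truncating face, where \<open>S\<close> has weight 1/2; time 0 lands on
    the face opposite \<open>w\<close>. The divisor \<open>1 - y w\<close> in the inverse
    \<open>r\<close> is then at least 1/2.\<close>
  define i where "i v = (\<lambda>j. if j = w then snd v / 2 else (1 - snd v / 2) * fst v j)"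
    for v :: "(nat \<Rightarrow> real) \<times> real"
  define r where "r y = ((\<lambda>j. if j = w then 0 else y j / (1 - y w)), 2 * y w)" for y :: "nat \<Rightarrow> real"
  let ?P = "coord_simplex S \<times> {0..1::real}" and ?Q = "trunc_simplex S (1/2) (insert w S)"
  have Qw: "y w \<le> 1/2" "sum y S = 1 - y w" if "y \<in> ?Q" for y
    using that w S by (auto simp: trunc_simplex_def coord_simplex_def)
  have fst_cont: "continuous_on ?P (\<lambda>v. fst v j)" for j
    by (rule continuous_on_apply_compose) (intro continuous_intros)
  show ?thesis
  proof (rule relative_lifting_retract)
    show "relative_lifting E B p ?Q (coord_faces (insert w S))"
      by (rule relative_lifting_trunc_simplex[OF fib]) (use S w in auto)
    have "continuous_on ?P (\<lambda>v. i v j)" for j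
      unfolding i_def by (cases "j = w") (auto intro!: continuous_intros fst_cont)
    then show "continuous_on ?P i"
      by (rule continuous_on_coordinatewise_then_product)
    show "i \<in> ?P \<rightarrow> ?Q"
    proof
      fix v assume v: "v \<in> ?P"
      have "sum (i v) S = (\<Sum>j\<in>S. (1 - snd v / 2) * fst v j)"
        using w by (intro sum.cong) (auto simp: i_def)
      also have "\<dots> = 1 - snd v / 2"
        using v by (auto simp: sum_distrib_left[symmetric] coord_simplex_def)
      finally have "sum (i v) S = 1 - snd v / 2" .
      then show "i v \<in> ?Q"
        using v w S by (auto simp: trunc_simplex_def coord_simplex_def i_def)
    qed
    show "i v \<in> coord_faces (insert w S)" if "v \<in> ?P" "v \<in> {v. snd v = 0 \<or> fst v \<in> coord_faces S}" for v
      using that w by (auto simp: coord_faces_def i_def)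
    have "continuous_on ?Q (\<lambda>y. if j = w then 0 else y j / (1 - y w))" for j
      using Qw(1) by (cases "j = w") (auto intro!: continuous_intros continuous_on_apply dest: Qw(1))
    then show "continuous_on ?Q r"
      unfolding r_def
      by (intro continuous_on_Pair continuous_on_coordinatewise_then_product continuous_intros continuous_on_apply)
    show "r \<in> ?Q \<rightarrow> ?P"
    proof
      fix y assume y: "y \<in> ?Q"
      have "(\<Sum>j\<in>S. if j = w then 0 else y j / (1 - y w)) = (\<Sum>j\<in>S. y j / (1 - y w))"
        using w by (intro sum.cong) auto
      also have "\<dots> = 1"
        using Qw[OF y] by (simp add: sum_divide_distrib[symmetric])
      finally show "r y \<in> ?P"
        using y Qw[OF y] by (auto simp: r_def trunc_simplex_def coord_simplex_def)
    qed
    show "r y \<in> {v. snd v = 0 \<or> fst v \<in> coord_faces S}" if "y \<in> ?Q" "y \<in> coord_faces (insert w S)" for y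
      using that w by (auto simp: coord_faces_def r_def)
    show "r (i v) = v" if "v \<in> ?P" for v
      using that w by (cases v) (auto simp: r_def i_def coord_simplex_def fun_eq_iff)
  qed
qed

text \<open>Time reversal. This form extends a lift prescribed at the end of a homotopy, as needed
  for the way back from the fibre.\<close>

lemma relative_lifting_prism':
  assumes fib: "fibration E B p" and S: "finite S" "S \<noteq> {}"
  shows "relative_lifting E B p (coord_simplex S \<times> {0..1::real}) {v. snd v = 1 \<or> fst v \<in> coord_faces S}"
  by (rule relative_lifting_retract[OF relative_lifting_prism[OF assms],
        where i = "\<lambda>v. (fst v, 1 - snd v)" and r = "\<lambda>v. (fst v, 1 - snd v)"])
    (auto intro!: continuous_on_Pair continuous_on_fst continuous_on_snd continuous_on_diff
      continuous_on_const continuous_on_id)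

text \<open>The set is a horn: the union of the faces that contain the vertex \<open>w\<close>. The
  retraction moves weight from all other labels to \<open>w\<close> at equal speed until one of them
  is empty.\<close>

lemma cube_retract_horn:
  assumes S: "finite S" "w \<in> S" "S - {w} \<noteq> {}"
  shows "cube_retract (coord_simplex S \<inter> coord_faces (S - {w}))"
proof -
  let ?S = "S - {w}"
  define m where "m x = Min ((\<lambda>j. x j) ` ?S)" for x :: "nat \<Rightarrow> real"
  define r where "r x = (\<lambda>j. if j \<in> ?S then x j - m x else if j = w then x w + card ?S * m x else 0)" for x
  have m_le: "m x \<le> x j" if "j \<in> ?S" for x j
    unfolding m_def using that S by (intro Min_le) auto
  have m_eq: "\<exists>j\<in>?S. m x = x j" for x
  proof -
    have "m x \<in> (\<lambda>j. x j) ` ?S"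
      unfolding m_def using S by (intro Min_in) auto
    then show ?thesis by auto
  qed
  have m0: "0 \<le> m x" if "x \<in> coord_simplex S" for x
    using m_eq[of x] that by (auto simp: coord_simplex_def)
  have "continuous_on (coord_simplex S) m"
    unfolding m_def using S by (intro continuous_on_Min continuous_on_apply) auto
  then have "continuous_on (coord_simplex S) (\<lambda>x. r x j)" for j
    unfolding r_def
    by (cases "j \<in> ?S"; cases "j = w") (auto intro!: continuous_intros continuous_on_apply)
  then have cont: "continuous_on (coord_simplex S) r"
    by (rule continuous_on_coordinatewise_then_product)
  show ?thesis
  proof (rule cube_retract_trans[OF cube_retract_coord_simplex cont])
    show "r \<in> coord_simplex S \<rightarrow> coord_simplex S \<inter> coord_faces ?S"
    proof
      fix x assume x: "x \<in> coord_simplex S"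
      have "sum (r x) ?S = (\<Sum>j\<in>?S. x j - m x)"
        by (intro sum.cong) (auto simp: r_def)
      moreover have "r x w = x w + card ?S * m x"
        by (simp add: r_def)
      ultimately have "sum (r x) S = sum x S"
        using S(1,2) by (simp add: sum.remove[of S w] sum_subtractf)
      moreover have "0 \<le> r x j" for j
        using x m_le[of j x] m0[OF x] by (auto simp: r_def coord_simplex_def)
      moreover have "r x j = 0" if "j \<notin> S" for j
        using that S by (auto simp: r_def)
      moreover obtain j where "j \<in> ?S" "m x = x j" using m_eq by blast
      ultimately show "r x \<in> coord_simplex S \<inter> coord_faces ?S"
        using x by (auto simp: coord_simplex_def coord_faces_def r_def)
    qed
    show "r x = x" if x: "x \<in> coord_simplex S \<inter> coord_faces ?S" for x
    proof -
      obtain j where "j \<in> ?S" "x j = 0" using x by (auto simp: coord_faces_def)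
      then have "m x = 0" using m_le[of j x] m0[of x] x by auto
      then show ?thesis using x S by (auto simp: r_def coord_simplex_def fun_eq_iff)
    qed
  qed (use S in auto)
qed

lemma closed_coord_faces: "finite S \<Longrightarrow> closed (coord_faces S)"
proof -
  assume "finite S"
  then have "closed (\<Union>j\<in>S. {t. t j = (0::real)})"
    by (intro closed_UN ballI closed_Collect_eq continuous_on_const continuous_on_apply)
  moreover have "coord_faces S = (\<Union>j\<in>S. {t. t j = 0})"
    by (auto simp: coord_faces_def)
  ultimately show ?thesis by simp
qed

text \<open>A sphere is no retract of a cube, so the boundary cannot be handled in one step. It is
  split into a horn, which is such a retract, and the remaining face; the boundary of that face lies
  in the horn, so the lift over the horn prescribes the sides of the prism over it.\<close>

lemma homotopy_lifting_simplex_boundary: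
  assumes fib: "fibration E B p" and S: "finite S" "w \<in> S" "S - {w} \<noteq> {}"
    and g: "continuous_map (top_of_set (coord_simplex S \<inter> coord_faces S)) E g"
    and F: "continuous_map (top_of_set ((coord_simplex S \<inter> coord_faces S) \<times> {0..1::real})) B F"
    and eq: "\<And>x. x \<in> coord_simplex S \<inter> coord_faces S \<Longrightarrow> p (g x) = F (x, 0)"
  obtains G where "continuous_map (top_of_set ((coord_simplex S \<inter> coord_faces S) \<times> {0..1::real})) E G"
    "\<And>z. z \<in> (coord_simplex S \<inter> coord_faces S) \<times> {0..1} \<Longrightarrow> p (G z) = F z"
    "\<And>x. x \<in> coord_simplex S \<inter> coord_faces S \<Longrightarrow> G (x, 0) = g x"
proof -
  let ?S = "S - {w}"
  let ?bd = "coord_simplex S \<inter> coord_faces S"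
  let ?L = "coord_simplex S \<inter> coord_faces ?S"
  let ?D = "coord_simplex ?S"
  let ?J = "{v. snd v = 0 \<or> fst v \<in> coord_faces ?S} :: ((nat \<Rightarrow> real) \<times> real) set"
  have Lbd: "?L \<subseteq> ?bd" by (auto simp: coord_faces_def)
  have Dbd: "?D \<subseteq> ?bd"
    using coord_simplex_mono[of S ?S] S by (auto simp: coord_faces_def coord_simplex_def)
  have bd: "?bd = ?L \<union> ?D"
  proof
    show "?bd \<subseteq> ?L \<union> ?D"
    proof
      fix x assume x: "x \<in> ?bd"
      show "x \<in> ?L \<union> ?D"
      proof (cases "x w = 0")
        case True
        have "x \<in> ?D"
          by (rule coord_simplex_face[OF S(1)]) (use x True in blast)+
        then show ?thesis by simp
      next
        case False
        then show ?thesis using x by (auto simp: coord_faces_def)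
      qed
    qed
  qed (use Lbd Dbd in auto)
  have cl: "closed ?L" "closed ?D"
    using S by (auto intro!: closed_Int closed_coord_simplex closed_coord_faces)
  have gL: "continuous_map (top_of_set ?L) E g"
    by (rule continuous_map_top_of_set_subset[OF g Lbd])
  have FL: "continuous_map (top_of_set (?L \<times> {0..1})) B F"
    by (rule continuous_map_top_of_set_subset[OF F]) (use Lbd in auto)
  have FD: "continuous_map (top_of_set (?D \<times> {0..1})) B F"
    by (rule continuous_map_top_of_set_subset[OF F]) (use Dbd in auto)
  have eqL: "p (g x) = F (x, 0)" if "x \<in> ?L" for x
    using eq that Lbd by auto
  obtain G1 where G1: "continuous_map (top_of_set (?L \<times> {0..1::real})) E G1"
    "\<And>z. z \<in> ?L \<times> {0..1} \<Longrightarrow> p (G1 z) = F z" "\<And>x. x \<in> ?L \<Longrightarrow> G1 (x, 0) = g x"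
    using homotopy_lifting_cube_retract[OF fib cube_retract_horn[OF S] gL FL eqL] by blast
  define g' where "g' v = (if fst v \<in> ?L then G1 v else g (fst v))" for v
  have DJ: "(?D \<times> {0..1}) \<inter> ?J = (?D \<times> {0}) \<union> ((?D \<inter> ?L) \<times> {0..1})"
    using coord_simplex_mono[of S ?S] S by auto
  have "continuous_map (top_of_set ((?D \<times> {0}) \<union> ((?D \<inter> ?L) \<times> {0..1}))) E g'"
  proof (rule continuous_map_closed_Un)
    have "continuous_map (top_of_set (?D \<times> {0::real})) E (\<lambda>v. g (fst v))"
      by (rule continuous_map_top_of_set_compose[OF _ _ g]) (use Dbd in \<open>auto intro!: continuous_on_fst continuous_on_id\<close>)
    then show "continuous_map (top_of_set (?D \<times> {0::real})) E g'"
      by (rule continuous_map_top_of_set_eq) (use G1(3) in \<open>auto simp: g'_def\<close>)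
    have "continuous_map (top_of_set ((?D \<inter> ?L) \<times> {0..1})) E G1"
      by (rule continuous_map_top_of_set_subset[OF G1(1)]) auto
    then show "continuous_map (top_of_set ((?D \<inter> ?L) \<times> {0..1})) E g'"
      by (rule continuous_map_top_of_set_eq) (auto simp: g'_def)
  qed (use cl in \<open>auto intro!: closed_Times\<close>)
  then have g': "continuous_map (top_of_set ((?D \<times> {0..1}) \<inter> ?J)) E g'"
    by (simp only: DJ)
  have pg': "p (g' v) = F v" if "v \<in> (?D \<times> {0..1}) \<inter> ?J" for v
  proof (cases "fst v \<in> ?L")
    case True
    then show ?thesis using that G1(2)[of v] by (cases v) (auto simp: g'_def)
  next
    case False
    then have "v \<in> ?D \<times> {0}" using that unfolding DJ by auto
    then show ?thesis using False eq Dbd by (cases v) (auto simp: g'_def)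
  qed
  obtain G2 where G2: "continuous_map (top_of_set (?D \<times> {0..1::real})) E G2"
    "\<And>z. z \<in> ?D \<times> {0..1} \<Longrightarrow> p (G2 z) = F z" "\<And>z. z \<in> (?D \<times> {0..1}) \<inter> ?J \<Longrightarrow> G2 z = g' z"
    using relative_liftingE[OF relative_lifting_prism[OF fib _ S(3)] FD g' pg'] S(1) by blast
  define G where "G v = (if fst v \<in> ?L then G1 v else G2 v)" for v
  have G_D: "G v = G2 v" if "v \<in> ?D \<times> {0..1}" for v
  proof (cases "fst v \<in> ?L")
    case True
    then have "v \<in> (?D \<times> {0..1}) \<inter> ?J" using that by auto
    then have "G2 v = g' v" by (rule G2(3))
    with True show ?thesis by (simp only: G_def g'_def if_True)
  next
    case False
    then show ?thesis by (simp only: G_def if_False)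
  qed
  show ?thesis
  proof
    have *: "?bd \<times> {0..1::real} = (?L \<times> {0..1}) \<union> (?D \<times> {0..1})"
      using bd by blast
    show "continuous_map (top_of_set (?bd \<times> {0..1::real})) E G"
      unfolding *
    proof (rule continuous_map_closed_Un)
      show "continuous_map (top_of_set (?L \<times> {0..1})) E G"
        by (rule continuous_map_top_of_set_eq[OF G1(1)]) (auto simp: G_def)
      show "continuous_map (top_of_set (?D \<times> {0..1})) E G"
        by (rule continuous_map_top_of_set_eq[OF G2(1)]) (simp add: G_D)
    qed (use cl in \<open>auto intro!: closed_Times\<close>)
    show "p (G z) = F z" if "z \<in> ?bd \<times> {0..1}" for z
    proof (cases "fst z \<in> ?L")
      case True
      then have "z \<in> ?L \<times> {0..1}" using that by (simp add: mem_Times_iff)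
      then have "p (G1 z) = F z" by (rule G1(2))
      with True show ?thesis by (simp only: G_def if_True)
    next
      case False
      then have "z \<in> ?D \<times> {0..1}" using that bd unfolding mem_Times_iff by blast
      then show ?thesis by (simp only: G_D G2(2))
    qed
    show "G (x, 0) = g x" if "x \<in> ?bd" for x
    proof (cases "x \<in> ?L")
      case True
      then have "G1 (x, 0) = g x" by (rule G1(3))
      with True show ?thesis by (simp only: G_def if_True fst_conv)
    next
      case False
      then have "x \<in> ?D" using that bd by blast
      then have "(x, 0) \<in> (?D \<times> {0..1}) \<inter> ?J" by simp
      then have "G2 (x, 0) = g' (x, 0)" by (rule G2(3))
      with False show ?thesis by (simp only: G_def g'_def if_False fst_conv)
    qed
  qed
qed

section \<open>Extending lifts over cells of low dimension\<close>

lemma nsphere_eq: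
  "nsphere n = top_of_set {x. (\<Sum>i\<le>n. x i ^ 2) = 1 \<and> (\<forall>i>n. x i = 0)}"
proof -
  have "{x. \<forall>i\<ge>Suc n. x i = (0::real)} \<inter> {x. (\<Sum>i\<le>n. x i ^ 2) = 1} =
      {x. (\<Sum>i\<le>n. x i ^ 2) = 1 \<and> (\<forall>i>n. x i = 0)}"
    by (auto simp: Suc_le_eq)
  then show ?thesis
    by (simp add: nsphere_def Euclidean_space_def euclidean_product_topology subtopology_subtopology)
qed

text \<open>The sphere is identified with the boundary of the simplex by radial projection from the
  barycentre; the coordinate \<open>w\<close> is determined by the others.\<close>
lemma simplex_boundary_extension:
  fixes g :: "(nat \<Rightarrow> real) \<Rightarrow> 'a"
  assumes S: "finite S" "card S = i + 2"
    and null: "\<And>f. continuous_map (nsphere i) X f \<Longrightarrow>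
        \<exists>c\<in>topspace X. homotopic_with (\<lambda>_. True) (nsphere i) X f (\<lambda>_. c)"
    and g: "continuous_map (top_of_set (coord_simplex S \<inter> coord_faces S)) X g"
  obtains h where "continuous_map (top_of_set (coord_simplex S)) X h"
    "\<And>x. x \<in> coord_simplex S \<inter> coord_faces S \<Longrightarrow> h x = g x"
proof -
  let ?D = "coord_simplex S" and ?bd = "coord_simplex S \<inter> coord_faces S"
  let ?U = "{x. (\<Sum>j\<le>i. x j ^ 2) = (1::real) \<and> (\<forall>j>i. x j = 0)}"
  define n where "n = real (card S)"
  have n: "n > 0" "n = real i + 2" using S by (auto simp: n_def)
  obtain w where w: "w \<in> S" using S by fastforce
  let ?S = "S - {w}"
  have cardS': "card ?S = Suc i" using S w by simp
  obtain e where e: "bij_betw e {..i} ?S"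
    using ex_bij_betw_nat_finite[of ?S] S(1) cardS'
    by (metis finite_Diff atLeast0LessThan lessThan_Suc_atMost)
  define e' where "e' = inv_into {..i} e"
  have e'e: "e' (e j) = j" if "j \<le> i" for j
    using e that by (auto simp: e'_def bij_betw_def)
  have ee': "e (e' s) = s" "e' s \<le> i" if "s \<in> ?S" for s
    using e that by (auto simp: e'_def bij_betw_def f_inv_into_f inv_into_into)
      (use inv_into_into[of s e "{..i}"] in auto)
  have eS: "e j \<in> ?S" if "j \<le> i" for j
    using e that by (auto simp: bij_betw_def)
  have sum_e: "(\<Sum>j\<le>i. F (e j)) = sum F ?S" for F :: "nat \<Rightarrow> real"
    using sum.reindex_bij_betw[OF e] .
  \<comment> \<open>\<open>v u\<close> is a direction in the plane of the simplex: the entries of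
    \<open>u\<close> are placed on \<open>S - {w}\<close> by the bijection \<open>e\<close>, and the
    entry at \<open>w\<close> makes the sum 0.\<close>
  define v where "v u s = (if s = w then - (\<Sum>j\<le>i. u j) else u (e' s))" for u :: "nat \<Rightarrow> real" and s
  have sum_v: "sum (v u) S = 0" for u
  proof -
    have "sum (v u) ?S = (\<Sum>j\<le>i. v u (e j))" by (simp add: sum_e)
    also have "\<dots> = (\<Sum>j\<le>i. u j)"
      using eS by (intro sum.cong) (auto simp: v_def e'e)
    finally have "sum (v u) ?S = (\<Sum>j\<le>i. u j)" .
    then show ?thesis
      using sum.remove[OF S(1) w, of "v u"] by (simp add: v_def)
  qed
  \<comment> \<open>On the ray from the barycentre in direction \<open>v u\<close>, the fastest
    decreasing coordinate has speed \<open>\<mu> u\<close> and uses up its initial value 1 / n at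
    parameter 1 / (n * \<mu> u). The ray leaves the simplex there, at the point
    \<open>\<theta> u\<close>.\<close>
  define \<mu> where "\<mu> u = Max ((\<lambda>s. - v u s) ` S)" for u
  have \<mu>_ge: "- v u s \<le> \<mu> u" if "s \<in> S" for u s
    unfolding \<mu>_def using that S by (intro Max_ge) auto
  have \<mu>_eq: "\<exists>s\<in>S. \<mu> u = - v u s" for u
  proof -
    have "\<mu> u \<in> (\<lambda>s. - v u s) ` S"
      unfolding \<mu>_def using S w by (intro Max_in) auto
    then show ?thesis by auto
  qed
  have \<mu>_pos: "\<mu> u > 0" if u: "u \<in> ?U" for u
  proof (rule ccontr)
    assume "\<not> \<mu> u > 0"
    then have nn: "0 \<le> v u s" if "s \<in> S" for s using \<mu>_ge[OF that, of u] by linarith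
    then have "\<forall>s\<in>S. v u s = 0"
      using sum_v[of u] sum_nonneg_eq_0_iff[OF S(1), of "v u"] by auto
    then have "u j = 0" if "j \<le> i" for j
      using eS[OF that] e'e[OF that] by (auto simp: v_def dest!: bspec[of _ _ "e j"])
    then have "(\<Sum>j\<le>i. u j ^ 2) = 0" by simp
    then show False using u by simp
  qed
  have cont_v: "continuous_on A (\<lambda>u. v u s)" for A s
    unfolding v_def by (cases "s = w") (auto intro!: continuous_intros continuous_on_apply)
  have "continuous_on ?U (\<lambda>u. - Min ((\<lambda>s. v u s) ` S))"
    using S w by (intro continuous_on_minus continuous_on_Min cont_v) auto
  moreover have "\<mu> u = - Min ((\<lambda>s. v u s) ` S)" for u
  proof -
    obtain s where s: "s \<in> S" "\<mu> u = - v u s" using \<mu>_eq by blast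
    have "Min ((\<lambda>s. v u s) ` S) = v u s"
    proof (rule Min_eqI)
      fix y assume "y \<in> v u ` S"
      then obtain t where "t \<in> S" "y = v u t" by auto
      then show "v u s \<le> y" using \<mu>_ge[of t u] s by auto
    qed (use S s in auto)
    then show ?thesis using s by simp
  qed
  ultimately have cont_\<mu>: "continuous_on ?U \<mu>" by simp
  define \<theta> where "\<theta> u = (\<lambda>s. if s \<in> S then 1 / n + v u s / (n * \<mu> u) else 0)" for u
  have "continuous_on ?U (\<lambda>u. 1 / n + v u s / (n * \<mu> u))" for s
    using n \<mu>_pos by (intro continuous_on_add continuous_on_divide continuous_on_mult cont_v cont_\<mu>
        continuous_on_const) fastforce+
  then have "continuous_on ?U (\<lambda>u. \<theta> u s)" for s
    unfolding \<theta>_def by (cases "s \<in> S") auto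
  then have cont_\<theta>: "continuous_on ?U \<theta>"
    by (rule continuous_on_coordinatewise_then_product)
  have \<theta>_in: "\<theta> u \<in> ?bd" if u: "u \<in> ?U" for u
  proof -
    have pos: "n * \<mu> u > 0" using n \<mu>_pos[OF u] by simp
    have "0 \<le> \<theta> u s" for s
    proof (cases "s \<in> S")
      case True
      have "- \<mu> u / (n * \<mu> u) \<le> v u s / (n * \<mu> u)"
        using \<mu>_ge[OF True, of u] pos by (intro divide_right_mono) auto
      then show ?thesis
        using True \<mu>_pos[OF u] by (simp add: \<theta>_def)
    qed (simp add: \<theta>_def)
    moreover have "sum (\<theta> u) S = 1"
    proof -
      have "sum (\<theta> u) S = (\<Sum>s\<in>S. 1 / n + v u s / (n * \<mu> u))"
        by (intro sum.cong) (auto simp: \<theta>_def)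
      also have "\<dots> = 1"
        using sum_v n by (simp add: sum.distrib sum_divide_distrib[symmetric] n_def[symmetric])
      finally show ?thesis .
    qed
    moreover obtain s where s: "s \<in> S" "\<mu> u = - v u s" using \<mu>_eq by blast
    then have "\<theta> u s = 1 / n + (- \<mu> u) / (n * \<mu> u)"
      by (simp add: \<theta>_def)
    then have "\<theta> u s = 0"
      using n(1) \<mu>_pos[OF u] by simp
    ultimately show ?thesis
      using s(1) by (auto simp: coord_simplex_def coord_faces_def \<theta>_def)
  qed
  \<comment> \<open>The length of the displacement from the barycentre in the coordinates other than
    \<open>w\<close>. Dividing by it, \<open>\<psi>\<close> gives the direction of \<open>x\<close>
    as a point of the unit sphere.\<close>
  define N where "N x = sqrt (\<Sum>j\<le>i. (x (e j) - 1 / n)^2)" for x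
  define \<psi> where "\<psi> x = (\<lambda>j. if j \<le> i then (x (e j) - 1 / n) / N x else 0)" for x
  \<comment> \<open>Radial parameter: 0 on the boundary and 1 at the barycentre, the only point of
    the simplex where \<open>N\<close> vanishes.\<close>
  define M where "M x = n * Min ((\<lambda>s. x s) ` S)" for x
  have M_le: "M x \<le> n * x s" if "s \<in> S" for x s
    unfolding M_def using that S n by (intro mult_left_mono Min_le) auto
  have M_eq: "\<exists>s\<in>S. M x = n * x s" for x
  proof -
    have "Min ((\<lambda>s. x s) ` S) \<in> (\<lambda>s. x s) ` S"
      using S w by (intro Min_in) auto
    then show ?thesis by (auto simp: M_def)
  qed
  have M0: "0 \<le> M x" if "x \<in> ?D" for x
    using M_eq[of x] that n by (auto simp: coord_simplex_def)
  have cont_M: "continuous_on A M" for A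
    unfolding M_def using S w
    by (intro continuous_on_mult continuous_on_const continuous_on_Min continuous_on_apply) auto
  have w_coord: "x w - 1 / n = - (\<Sum>j\<le>i. x (e j) - 1 / n)" if "x \<in> ?D" for x
  proof -
    have "(\<Sum>j\<le>i. x (e j) - 1 / n) = (\<Sum>s\<in>?S. x s - 1 / n)" by (rule sum_e)
    also have "\<dots> = sum x ?S - (n - 1) / n"
      using cardS' n by (simp add: sum_subtractf)
    also have "sum x ?S = 1 - x w"
      using that sum.remove[OF S(1) w, of x] by (simp add: coord_simplex_def)
    finally show ?thesis using n by (simp add: field_simps)
  qed
  have N_pos: "N x > 0" if x: "x \<in> ?D" "M x < 1" for x
  proof (rule ccontr)
    assume "\<not> N x > 0"
    moreover have "0 \<le> (\<Sum>j\<le>i. (x (e j) - 1 / n)^2)" by (intro sum_nonneg) auto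
    ultimately have "(\<Sum>j\<le>i. (x (e j) - 1 / n)^2) = 0"
      by (simp add: N_def)
    then have *: "x (e j) - 1 / n = 0" if "j \<le> i" for j
      using that by (subst (asm) sum_nonneg_eq_0_iff) auto
    then have "x w - 1 / n = 0" using w_coord[OF x(1)] by simp
    moreover have "x s - 1 / n = 0" if "s \<in> ?S" for s
      using *[of "e' s"] ee'[OF that] by simp
    ultimately have "x s = 1 / n" if "s \<in> S" for s using that by (cases "s = w") auto
    moreover obtain s where "s \<in> S" "M x = n * x s" using M_eq by blast
    ultimately have "M x = 1" using n by simp
    with x show False by simp
  qed
  let ?A = "{x \<in> ?D. M x \<le> 1/2}" and ?B = "{x \<in> ?D. 1/2 \<le> M x}"
  have cont_N: "continuous_on A N" for A
    unfolding N_def by (intro continuous_intros continuous_on_apply)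
  have "continuous_on ?A (\<lambda>x. (x (e j) - 1 / n) / N x)" for j
    by (intro continuous_on_divide continuous_on_diff continuous_on_apply continuous_on_const cont_N)
      (use N_pos in fastforce)
  then have "continuous_on ?A (\<lambda>x. \<psi> x j)" for j
    unfolding \<psi>_def by (cases "j \<le> i") auto
  then have cont_\<psi>: "continuous_on ?A \<psi>"
    by (rule continuous_on_coordinatewise_then_product)
  have \<psi>_in: "\<psi> x \<in> ?U" if "x \<in> ?D" "M x < 1" for x
  proof -
    have "(\<Sum>j\<le>i. \<psi> x j ^ 2) = (\<Sum>j\<le>i. (x (e j) - 1 / n)^2) / (N x)^2"
      by (simp add: \<psi>_def power_divide sum_divide_distrib)
    also have "(N x)^2 = (\<Sum>j\<le>i. (x (e j) - 1 / n)^2)"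
      unfolding N_def by (intro real_sqrt_pow2 sum_nonneg) auto
    also have "(\<Sum>j\<le>i. (x (e j) - 1 / n)^2) / (\<Sum>j\<le>i. (x (e j) - 1 / n)^2) = 1"
      using N_pos[OF that] by (intro divide_self) (auto simp: N_def)
    finally show ?thesis by (simp add: \<psi>_def)
  qed
  have \<theta>\<psi>: "\<theta> (\<psi> x) = x" if x: "x \<in> ?bd" for x
  proof -
    obtain s0 where s0: "s0 \<in> S" "x s0 = 0" using x by (auto simp: coord_faces_def)
    have xD: "x \<in> ?D" and Mx: "M x = 0"
      using x M_le[OF s0(1), of x] M0[of x] s0 by auto
    note Np = N_pos[OF xD, unfolded Mx, simplified]
    have v_eq: "v (\<psi> x) s = (x s - 1 / n) / N x" if "s \<in> S" for s
    proof (cases "s = w")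
      case True
      have "(\<Sum>j\<le>i. \<psi> x j) = (\<Sum>j\<le>i. x (e j) - 1 / n) / N x"
        by (simp add: \<psi>_def sum_divide_distrib)
      then show ?thesis
        using True w_coord[OF xD] by (simp add: v_def)
    next
      case False
      then show ?thesis using that ee'[of s] by (simp add: v_def \<psi>_def)
    qed
    have "\<mu> (\<psi> x) = 1 / (n * N x)"
    proof -
      obtain s where s: "s \<in> S" "\<mu> (\<psi> x) = - v (\<psi> x) s" using \<mu>_eq by blast
      have "(1 / n - x s) / N x \<le> (1 / n) / N x"
        using xD Np by (intro divide_right_mono) (auto simp: coord_simplex_def)
      then have "\<mu> (\<psi> x) \<le> 1 / (n * N x)"
        using v_eq[OF s(1)] s(2) by (simp add: minus_divide_left)
      moreover have "1 / (n * N x) \<le> \<mu> (\<psi> x)"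
        using \<mu>_ge[OF s0(1), of "\<psi> x"] v_eq[OF s0(1)] s0(2) by simp
      ultimately show ?thesis by simp
    qed
    then show ?thesis
      using v_eq Np n xD by (auto simp: \<theta>_def coord_simplex_def fun_eq_iff)
  qed
  have "continuous_map (top_of_set ?U) X (\<lambda>u. g (\<theta> u))"
    by (rule continuous_map_top_of_set_compose[OF cont_\<theta> _ g]) (use \<theta>_in in blast)
  then obtain c h where c: "c \<in> topspace X"
    and h: "continuous_map (top_of_set ({0..1::real} \<times> ?U)) X h"
      "\<And>u. h (0, u) = g (\<theta> u)" "\<And>u. h (1, u) = c"
    using null[of "\<lambda>u. g (\<theta> u)"]
    unfolding homotopic_with_def nsphere_eq prod_topology_top_of_set by auto
  \<comment> \<open>The null-homotopy runs at double speed, so that \<open>\<psi>\<close> is used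
    only for \<open>M x \<le> 1/2\<close>, away from the barycentre where no direction is defined;
    the inner part of the simplex goes to \<open>c\<close>.\<close>
  define k where "k x = (if M x \<le> 1/2 then h (2 * M x, \<psi> x) else c)" for x
  show ?thesis
  proof
    have "continuous_map (top_of_set (?A \<union> ?B)) X k"
    proof (rule continuous_map_closed_Un)
      have "?A = ?D \<inter> {x. M x \<le> 1/2}" "?B = ?D \<inter> {x. 1/2 \<le> M x}" by auto
      moreover have "closed {x. M x \<le> 1/2}" "closed {x. 1/2 \<le> M x}"
        by (intro closed_Collect_le cont_M continuous_on_const)+
      ultimately show "closed ?A" "closed ?B"
        using closed_coord_simplex by (auto intro!: closed_Int)
      have "continuous_map (top_of_set ?A) X (\<lambda>x. h (2 * M x, \<psi> x))"
      proof (rule continuous_map_top_of_set_compose[OF _ _ h(1)])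
        show "continuous_on ?A (\<lambda>x. (2 * M x, \<psi> x))"
          by (intro continuous_on_Pair continuous_on_mult continuous_on_const cont_M cont_\<psi>)
        show "(\<lambda>x. (2 * M x, \<psi> x)) \<in> ?A \<rightarrow> {0..1} \<times> ?U"
        proof
          fix x assume x: "x \<in> ?A"
          then have "\<psi> x \<in> ?U" by (intro \<psi>_in) auto
          then show "(2 * M x, \<psi> x) \<in> {0..1} \<times> ?U" using x M0[of x] by auto
        qed
      qed
      then show "continuous_map (top_of_set ?A) X k"
        by (rule continuous_map_top_of_set_eq) (simp add: k_def)
      have "continuous_map (top_of_set ?B) X (\<lambda>x. c)"
        using c by simp
      then show "continuous_map (top_of_set ?B) X k"
      proof (rule continuous_map_top_of_set_eq)
        fix x assume "x \<in> ?B"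
        show "c = k x"
        proof (cases "M x \<le> 1/2")
          case True
          then have "2 * M x = 1" using \<open>x \<in> ?B\<close> by simp
          with True h(3) show ?thesis by (simp add: k_def)
        qed (simp add: k_def)
      qed
    qed
    moreover have "?A \<union> ?B = ?D" by auto
    ultimately show "continuous_map (top_of_set ?D) X k" by simp
    show "k x = g x" if x: "x \<in> ?bd" for x
    proof -
      obtain s0 where s0: "s0 \<in> S" "x s0 = 0" using x by (auto simp: coord_faces_def)
      then have "M x = 0" using x M_le[OF s0(1), of x] M0[of x] by auto
      then show ?thesis using h(2) \<theta>\<psi>[OF x] by (simp add: k_def)
    qed
  qed
qed

section \<open>Extending a lift over a simplex of dimension at most k\<close>

definition coord_vertex :: "nat \<Rightarrow> nat \<Rightarrow> real" where
  "coord_vertex w = (\<lambda>j. if j = w then 1 else 0)"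

lemma coord_vertex_in: "finite S \<Longrightarrow> w \<in> S \<Longrightarrow> coord_vertex w \<in> coord_simplex S"
  by (auto simp: coord_vertex_def coord_simplex_def)

text \<open>The first half of the homotopy contracts the simplex linearly to a vertex; the second
  follows a path in \<open>B\<close> from the image of that vertex to \<open>b\<close>.\<close>

lemma continuous_map_simplex_nullhomotopic:
  assumes S: "finite S" "S \<noteq> {}" and f: "continuous_map (top_of_set (coord_simplex S)) B f"
    and path: "\<And>x. x \<in> topspace B \<Longrightarrow> path_component_of B x b"
  obtains F where "continuous_map (top_of_set (coord_simplex S \<times> {0..1::real})) B F"
    "\<And>x. x \<in> coord_simplex S \<Longrightarrow> F (x, 0) = f x" "\<And>x. x \<in> coord_simplex S \<Longrightarrow> F (x, 1) = b"
proof -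
  let ?D = "coord_simplex S"
  obtain w where w: "w \<in> S" using S by auto
  have wD: "coord_vertex w \<in> ?D" using coord_vertex_in S w by blast
  then have "f (coord_vertex w) \<in> topspace B"
    using f by (auto simp: continuous_map_def)
  then obtain \<gamma> where \<gamma>: "continuous_map (top_of_set {0..1::real}) B \<gamma>" "\<gamma> 0 = f (coord_vertex w)" "\<gamma> 1 = b"
    using path unfolding path_component_of_def pathin_def by blast
  define m where "m v = (\<lambda>j. (1 - 2 * snd v) * fst v j + 2 * snd v * coord_vertex w j)"
    for v :: "(nat \<Rightarrow> real) \<times> real"
  define F where "F v = (if snd v \<le> 1/2 then f (m v) else \<gamma> (2 * snd v - 1))" for v
  let ?A = "?D \<times> {0..1/2::real}" and ?B = "?D \<times> {1/2..1::real}"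
  have m_in: "m v \<in> ?D" if "v \<in> ?A" for v
  proof -
    have "sum (m v) S = (1 - 2 * snd v) * sum (fst v) S + 2 * snd v * sum (coord_vertex w) S"
      by (simp add: m_def sum.distrib sum_distrib_left)
    also have "\<dots> = 1" using that wD by (auto simp: coord_simplex_def)
    finally show ?thesis using that wD by (auto simp: m_def coord_simplex_def)
  qed
  show ?thesis
  proof
    have "continuous_map (top_of_set (?A \<union> ?B)) B F"
    proof (rule continuous_map_closed_Un)
      show "closed ?A" "closed ?B"
        by (intro closed_Times closed_coord_simplex closed_atLeastAtMost)+
      have "continuous_on ?A (\<lambda>v. fst v j)" for j
        by (rule continuous_on_apply_compose) (intro continuous_intros)
      then have "continuous_on ?A m"
        unfolding m_def by (intro continuous_on_coordinatewise_then_product continuous_intros)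
      then have "continuous_map (top_of_set ?A) B (\<lambda>v. f (m v))"
        by (rule continuous_map_top_of_set_compose[OF _ _ f]) (use m_in in blast)
      then show "continuous_map (top_of_set ?A) B F"
        by (rule continuous_map_top_of_set_eq) (auto simp: F_def)
      have "continuous_on ?B (\<lambda>v. 2 * snd v - 1)" by (intro continuous_intros)
      then have "continuous_map (top_of_set ?B) B (\<lambda>v. \<gamma> (2 * snd v - 1))"
        by (rule continuous_map_top_of_set_compose[OF _ _ \<gamma>(1)]) auto
      then show "continuous_map (top_of_set ?B) B F"
      proof (rule continuous_map_top_of_set_eq)
        fix v assume v: "v \<in> ?B"
        show "\<gamma> (2 * snd v - 1) = F v"
        proof (cases "snd v \<le> 1/2")
          case True
          then have "snd v = 1/2" using v by auto
          then have "m v = coord_vertex w" "2 * snd v - 1 = 0"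
            by (simp_all only: m_def) auto
          with True \<gamma>(2) show ?thesis by (simp add: F_def)
        qed (simp add: F_def)
      qed
    qed
    moreover have "?A \<union> ?B = ?D \<times> {0..1}" by auto
    ultimately show "continuous_map (top_of_set (?D \<times> {0..1::real})) B F" by simp
  qed (simp_all add: F_def m_def \<gamma>)
qed

text \<open>Contract the base of the lifting problem to the point \<open>b\<close>, carry the given partial lift along
  into the fibre over \<open>b\<close>, extend it there, and transport the extension back.\<close>
lemma relative_lifting_simplex:
  assumes fib: "fibration E B p" and S: "finite S" "S \<noteq> {}" "card S \<le> k + 1"
    and path: "\<And>x. x \<in> topspace B \<Longrightarrow> path_component_of B x b"
    and conn: "n_connected_space (int k - 1) (subtopology E {e \<in> topspace E. p e = b})"
  shows "relative_lifting E B p (coord_simplex S) (coord_faces S)"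
  unfolding relative_lifting_def
proof (intro allI impI; elim conjE)
  fix f g
  let ?D = "coord_simplex S" and ?bd = "coord_simplex S \<inter> coord_faces S"
  let ?F = "subtopology E {e \<in> topspace E. p e = b}"
  let ?J = "{v. snd v = 1 \<or> fst v \<in> coord_faces S} :: ((nat \<Rightarrow> real) \<times> real) set"
  assume f: "continuous_map (top_of_set ?D) B f" and g: "continuous_map (top_of_set ?bd) E g"
    and pg: "\<forall>x\<in>?bd. p (g x) = f x"
  obtain F where F: "continuous_map (top_of_set (?D \<times> {0..1::real})) B F"
    "\<And>x. x \<in> ?D \<Longrightarrow> F (x, 0) = f x" "\<And>x. x \<in> ?D \<Longrightarrow> F (x, 1) = b"
    using continuous_map_simplex_nullhomotopic[OF S(1,2) f path] by blast
  obtain w where w: "w \<in> S" using S by auto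
  obtain G h where G: "continuous_map (top_of_set (?bd \<times> {0..1::real})) E G"
      "\<And>z. z \<in> ?bd \<times> {0..1} \<Longrightarrow> p (G z) = F z" "\<And>x. x \<in> ?bd \<Longrightarrow> G (x, 0) = g x"
    and h: "continuous_map (top_of_set ?D) ?F h" "\<And>x. x \<in> ?bd \<Longrightarrow> h x = G (x, 1)"
  proof (cases "S - {w} = {}")
    \<comment> \<open>A single vertex has empty boundary, and only a point of the fibre is asked
      for; for k = 0 this is the only case.\<close>
    case True
    then have "S = {w}" using w by auto
    then have bd: "?bd = {}" by (auto simp: coord_simplex_def coord_faces_def)
    obtain c where "c \<in> topspace ?F" using conn by (auto simp: n_connected_space_def)
    then have "continuous_map (top_of_set ?D) ?F (\<lambda>_. c)" by simp
    moreover have "continuous_map (top_of_set (?bd \<times> {0..1::real})) E (\<lambda>_. undefined)"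
      unfolding bd by (auto simp: continuous_map_def)
    ultimately show thesis
      using that[of "\<lambda>_. undefined" "\<lambda>_. c"] unfolding bd by simp
  next
    case False
    have FL: "continuous_map (top_of_set (?bd \<times> {0..1::real})) B F"
      by (rule continuous_map_top_of_set_subset[OF F(1)]) auto
    have eq: "p (g x) = F (x, 0)" if "x \<in> ?bd" for x
      using that pg F(2) by simp
    obtain G where G: "continuous_map (top_of_set (?bd \<times> {0..1::real})) E G"
      "\<And>z. z \<in> ?bd \<times> {0..1} \<Longrightarrow> p (G z) = F z" "\<And>x. x \<in> ?bd \<Longrightarrow> G (x, 0) = g x"
      using homotopy_lifting_simplex_boundary[OF fib S(1) w False g FL eq] by blast
    have "card S > 1"
      using False w S(1) by (metis One_nat_def card_Suc_Diff1 card_gt_0_iff finite_Diff Suc_less_eq)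
    \<comment> \<open>The boundary of a simplex with i + 2 vertices is an i-sphere, and
      \<open>card S \<le> k + 1\<close> gives i \<le> k - 1, the range in which spheres in the fibre
      can be contracted.\<close>
    define i where "i = card S - 2"
    have i: "card S = i + 2" "int i \<le> int k - 1"
      using \<open>card S > 1\<close> S(3) by (auto simp: i_def)
    have null: "\<exists>c\<in>topspace ?F. homotopic_with (\<lambda>_. True) (nsphere i) ?F f (\<lambda>_. c)"
      if "continuous_map (nsphere i) ?F f" for f
      using conn i(2) that unfolding n_connected_space_def by blast
    have "continuous_on ?bd (\<lambda>x. (x, 1::real))" by (intro continuous_intros)
    then have G1: "continuous_map (top_of_set ?bd) E (\<lambda>x. G (x, 1))"
      by (rule continuous_map_top_of_set_compose[OF _ _ G(1)]) auto
    have "continuous_map (top_of_set ?bd) ?F (\<lambda>x. G (x, 1))"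
    proof (rule continuous_map_into_subtopology[OF G1], rule funcsetI)
      fix x assume "x \<in> topspace (top_of_set ?bd)"
      then have x: "x \<in> ?bd" by simp
      then have "G (x, 1) \<in> topspace E"
        using G1 by (auto simp: continuous_map_def)
      moreover have "p (G (x, 1)) = b"
        using G(2)[of "(x, 1)"] F(3)[of x] x by auto
      ultimately show "G (x, 1) \<in> {e \<in> topspace E. p e = b}" by simp
    qed
    then obtain h where "continuous_map (top_of_set ?D) ?F h" "\<And>x. x \<in> ?bd \<Longrightarrow> h x = G (x, 1)"
      using simplex_boundary_extension[OF S(1) i(1) null] by blast
    with G show thesis using that by blast
  qed
  have hE: "continuous_map (top_of_set ?D) E h" and ph: "\<And>x. x \<in> ?D \<Longrightarrow> p (h x) = b"
    using h(1) by (auto simp: continuous_map_in_subtopology)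
  \<comment> \<open>Data on the prism: the lifted homotopy on the sides, the extension inside the
    fibre over \<open>b\<close> at time 1. They match where they meet because \<open>h\<close>
    extends the end of \<open>G\<close>.\<close>
  define g' where "g' v = (if fst v \<in> coord_faces S then G v else h (fst v))" for v
  have DJ: "(?D \<times> {0..1}) \<inter> ?J = (?D \<times> {1}) \<union> (?bd \<times> {0..1})"
    by auto
  have "continuous_map (top_of_set ((?D \<times> {1}) \<union> (?bd \<times> {0..1}))) E g'"
  proof (rule continuous_map_closed_Un)
    have "continuous_map (top_of_set (?D \<times> {1::real})) E (\<lambda>v. h (fst v))"
      by (rule continuous_map_top_of_set_compose[OF _ _ hE])
        (auto intro!: continuous_on_fst continuous_on_id)
    then show "continuous_map (top_of_set (?D \<times> {1::real})) E g'"
      by (rule continuous_map_top_of_set_eq) (use h(2) in \<open>auto simp: g'_def\<close>)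
    show "continuous_map (top_of_set (?bd \<times> {0..1})) E g'"
      by (rule continuous_map_top_of_set_eq[OF G(1)]) (auto simp: g'_def)
  qed (use S in \<open>auto intro!: closed_Times closed_Int closed_coord_simplex closed_coord_faces\<close>)
  then have g': "continuous_map (top_of_set ((?D \<times> {0..1}) \<inter> ?J)) E g'"
    by (simp only: DJ)
  have pg': "p (g' v) = F v" if "v \<in> (?D \<times> {0..1}) \<inter> ?J" for v
  proof (cases "fst v \<in> coord_faces S")
    case True
    then have "v \<in> ?bd \<times> {0..1}" using that by (auto simp: mem_Times_iff)
    then have "p (G v) = F v" by (rule G(2))
    with True show ?thesis by (simp only: g'_def if_True)
  next
    case False
    then have v: "fst v \<in> ?D" "snd v = 1" using that by (auto simp: mem_Times_iff)
    then have "F v = b" using F(3)[of "fst v"] by (metis prod.collapse)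
    with False ph[OF v(1)] show ?thesis by (simp only: g'_def if_False)
  qed
  obtain s where s: "continuous_map (top_of_set (?D \<times> {0..1::real})) E s"
    "\<And>z. z \<in> ?D \<times> {0..1} \<Longrightarrow> p (s z) = F z" "\<And>z. z \<in> (?D \<times> {0..1}) \<inter> ?J \<Longrightarrow> s z = g' z"
    using relative_liftingE[OF relative_lifting_prism'[OF fib S(1,2)] F(1) g' pg'] by blast
  show "\<exists>s. continuous_map (top_of_set ?D) E s \<and> (\<forall>x\<in>?D. p (s x) = f x) \<and> (\<forall>x\<in>?bd. s x = g x)"
  proof (intro exI[of _ "\<lambda>x. s (x, 0)"] conjI ballI)
    have "continuous_on ?D (\<lambda>x. (x, 0::real))" by (intro continuous_intros)
    then show "continuous_map (top_of_set ?D) E (\<lambda>x. s (x, 0))"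
      by (rule continuous_map_top_of_set_compose[OF _ _ s(1)]) auto
    show "p (s (x, 0)) = f x" if "x \<in> ?D" for x
      using that s(2)[of "(x, 0)"] F(2) by auto
    show "s (x, 0) = g x" if x: "x \<in> ?bd" for x
    proof -
      have "s (x, 0) = g' (x, 0)" using x by (intro s(3)) auto
      then show ?thesis using x G(3)[OF x] by (simp add: g'_def)
    qed
  qed
qed

section \<open>Sections built cell by cell\<close>

lemma trunc_simplex_mono:
  "finite S \<Longrightarrow> S' \<subseteq> S \<Longrightarrow> trunc_simplex A \<epsilon> S' \<subseteq> trunc_simplex A \<epsilon> S"
  using coord_simplex_mono by (auto simp: trunc_simplex_def)

text \<open>The truncating face does not occur on the right: the smaller cells prescribe the lift
  exactly on \<open>coord_faces S\<close> and leave that face free.\<close>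

lemma trunc_simplex_faces:
  assumes "finite S"
  shows "trunc_simplex A \<epsilon> S \<inter> coord_faces S = (\<Union>j\<in>S. trunc_simplex A \<epsilon> (S - {j}))"
proof (intro equalityI subsetI)
  fix t assume t: "t \<in> trunc_simplex A \<epsilon> S \<inter> coord_faces S"
  then obtain j where j: "j \<in> S" "t j = 0" by (auto simp: coord_faces_def)
  have "t \<in> coord_simplex (S - {j})"
    by (rule coord_simplex_face[OF assms]) (use t j in \<open>auto simp: trunc_simplex_def\<close>)
  then show "t \<in> (\<Union>j\<in>S. trunc_simplex A \<epsilon> (S - {j}))"
    using t j by (auto simp: trunc_simplex_def)
next
  fix t assume "t \<in> (\<Union>j\<in>S. trunc_simplex A \<epsilon> (S - {j}))"
  then obtain j where j: "j \<in> S" "t \<in> trunc_simplex A \<epsilon> (S - {j})" by auto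
  then have "t j = 0" by (auto simp: trunc_simplex_def coord_simplex_def)
  then show "t \<in> trunc_simplex A \<epsilon> S \<inter> coord_faces S"
    using j trunc_simplex_mono[OF assms, of "S - {j}"] by (auto simp: coord_faces_def)
qed

lemma coord_simplex_support:
  assumes "t \<in> coord_simplex S" "t \<notin> coord_faces S" shows "{j. t j \<noteq> 0} = S"
  using assms by (auto simp: coord_simplex_def coord_faces_def)

text \<open>\<open>C S\<close> is the set of characteristic maps of
  the cells with label set \<open>S\<close>, and \<open>T\<close> recovers the coordinates of a point in its cell.\<close>
lemma section_by_cells:
  fixes C :: "nat set \<Rightarrow> ((nat \<Rightarrow> real) \<Rightarrow> 'b) set" and T :: "'b \<Rightarrow> nat \<Rightarrow> real"
  assumes fin: "\<And>S \<kappa>. \<kappa> \<in> C S \<Longrightarrow> finite S \<and> card S \<le> N"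
    and cont: "\<And>S \<kappa>. \<kappa> \<in> C S \<Longrightarrow> continuous_map (top_of_set (coord_simplex S)) B \<kappa>"
    and T: "\<And>S \<kappa> t. \<kappa> \<in> C S \<Longrightarrow> t \<in> coord_simplex S \<Longrightarrow> T (\<kappa> t) = t"
    and face: "\<And>S S' \<kappa>. \<kappa> \<in> C S \<Longrightarrow> S' \<subseteq> S \<Longrightarrow> S' \<noteq> {} \<Longrightarrow> restrict \<kappa> (coord_simplex S') \<in> C S'"
    and unique: "\<And>S \<kappa> \<kappa>' t. \<kappa> \<in> C S \<Longrightarrow> \<kappa>' \<in> C S \<Longrightarrow>
        t \<in> coord_simplex S \<Longrightarrow> t \<notin> coord_faces S \<Longrightarrow> \<kappa> t = \<kappa>' t \<Longrightarrow> \<kappa> = \<kappa>'"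
    and lift: "\<And>S \<kappa>. \<kappa> \<in> C S \<Longrightarrow> S \<inter> A \<noteq> {} \<Longrightarrow>
        relative_lifting E B p (trunc_simplex A \<epsilon> S) (coord_faces S)"
    and A: "finite A" and \<epsilon>: "0 < \<epsilon>"
  shows "\<exists>s. \<forall>S. \<forall>\<kappa>\<in>C S. continuous_map (top_of_set (trunc_simplex A \<epsilon> S)) E (\<lambda>t. s (\<kappa> t)) \<and>
    (\<forall>t\<in>trunc_simplex A \<epsilon> S. p (s (\<kappa> t)) = \<kappa> t)"
proof -
  let ?P = "trunc_simplex A \<epsilon>"
  have PD: "?P S \<subseteq> coord_simplex S" for S by (auto simp: trunc_simplex_def)
  have empty: "?P S = {}" if "S \<inter> A = {}" for S
    using that \<epsilon> sum_coord_simplex[of _ S A] A by (auto simp: trunc_simplex_def)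
  have "\<exists>s. \<forall>S \<kappa>. \<kappa> \<in> C S \<and> card S \<le> m \<longrightarrow>
      continuous_map (top_of_set (?P S)) E (\<lambda>t. s (\<kappa> t)) \<and> (\<forall>t\<in>?P S. p (s (\<kappa> t)) = \<kappa> t)" for m
  proof (induction m)
    case 0
    have "?P S = {}" if "\<kappa> \<in> C S" "card S \<le> 0" for S \<kappa>
      using that fin[of \<kappa> S] by (intro empty) auto
    then show ?case
      by (intro exI[of _ undefined]) (auto simp: continuous_map_def)
  next
    case (Suc m)
    then obtain s where s: "\<And>S \<kappa>. \<kappa> \<in> C S \<Longrightarrow> card S \<le> m \<Longrightarrow>
        continuous_map (top_of_set (?P S)) E (\<lambda>t. s (\<kappa> t))"
      and ps: "\<And>S \<kappa> t. \<kappa> \<in> C S \<Longrightarrow> card S \<le> m \<Longrightarrow> t \<in> ?P S \<Longrightarrow> p (s (\<kappa> t)) = \<kappa> t"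
      by blast
    \<comment> \<open>\<open>e\<close> solves the lifting problem over a new cell relative to the
      values already fixed on its faces. Solutions for different new cells can be chosen
      independently, since such cells have no interior points in common.\<close>
    define extends where "extends S \<kappa> e \<longleftrightarrow> continuous_map (top_of_set (?P S)) E e \<and>
        (\<forall>t\<in>?P S. p (e t) = \<kappa> t) \<and> (\<forall>t\<in>?P S \<inter> coord_faces S. e t = s (\<kappa> t))" for S \<kappa> e
    have ex: "\<exists>e. extends S \<kappa> e" if \<kappa>: "\<kappa> \<in> C S" and S: "card S = Suc m" for S \<kappa>
    proof (cases "S \<inter> A = {}")
      case True
      then show ?thesis by (simp add: extends_def empty continuous_map_def)
    next
      case False
      have finS: "finite S" using fin[OF \<kappa>] by simp
      have face_j: "continuous_map (top_of_set (?P (S - {j}))) E (\<lambda>t. s (\<kappa> t)) \<and>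
          (\<forall>t\<in>?P (S - {j}). p (s (\<kappa> t)) = \<kappa> t)" if j: "j \<in> S" for j
      proof (cases "S - {j} = {}")
        case True
        have "(S - {j}) \<inter> A = {}" unfolding True by simp
        then have "?P (S - {j}) = {}" by (rule empty)
        then show ?thesis by (simp only: continuous_map_def) simp
      next
        case False
        let ?\<kappa> = "restrict \<kappa> (coord_simplex (S - {j}))"
        have \<kappa>': "?\<kappa> \<in> C (S - {j})" by (rule face[OF \<kappa> _ False]) auto
        have card: "card (S - {j}) \<le> m" using S j finS by simp
        have eq: "?\<kappa> t = \<kappa> t" if "t \<in> ?P (S - {j})" for t
        proof -
          have "t \<in> coord_simplex (S - {j})" using that PD by blast
          then show ?thesis by simp
        qed
        have "continuous_map (top_of_set (?P (S - {j}))) E (\<lambda>t. s (\<kappa> t))"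
          by (rule continuous_map_top_of_set_eq[OF s[OF \<kappa>' card]]) (simp only: eq)
        moreover have "\<forall>t\<in>?P (S - {j}). p (s (\<kappa> t)) = \<kappa> t"
        proof
          fix t assume t: "t \<in> ?P (S - {j})"
          show "p (s (\<kappa> t)) = \<kappa> t"
            using ps[OF \<kappa>' card t] unfolding eq[OF t] .
        qed
        ultimately show ?thesis by blast
      qed
      have c1: "continuous_map (top_of_set (?P S \<inter> coord_faces S)) E (\<lambda>t. s (\<kappa> t))"
        unfolding trunc_simplex_faces[OF finS]
        by (rule continuous_map_finite_closed_Union) (use finS face_j closed_trunc_simplex in auto)
      have c2: "p (s (\<kappa> t)) = \<kappa> t" if "t \<in> ?P S \<inter> coord_faces S" for t
        using that face_j unfolding trunc_simplex_faces[OF finS] by blast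
      have c3: "continuous_map (top_of_set (?P S)) B \<kappa>"
        by (rule continuous_map_top_of_set_subset[OF cont[OF \<kappa>] PD])
      show ?thesis
        unfolding extends_def
        by (rule lift[OF \<kappa> False, unfolded relative_lifting_def, THEN spec, THEN spec, THEN mp])
          (intro conjI ballI c1 c2 c3)
    qed
    have extends: "extends S \<kappa> (SOME e. extends S \<kappa> e)" if "\<kappa> \<in> C S" "card S = Suc m" for S \<kappa>
      by (rule someI_ex[OF ex[OF that]])
    define e where "e S \<kappa> = (SOME e. extends S \<kappa> e)" for S \<kappa>
    have e: "continuous_map (top_of_set (?P S)) E (e S \<kappa>)" if "\<kappa> \<in> C S" "card S = Suc m" for S \<kappa>
      using extends[OF that] by (simp add: extends_def e_def)
    have pe: "p (e S \<kappa> t) = \<kappa> t" if "\<kappa> \<in> C S" "card S = Suc m" "t \<in> ?P S" for S \<kappa> t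
      using extends[OF that(1,2)] that(3) by (simp add: extends_def e_def)
    have es: "e S \<kappa> t = s (\<kappa> t)"
      if "\<kappa> \<in> C S" "card S = Suc m" "t \<in> ?P S \<inter> coord_faces S" for S \<kappa> t
      using extends[OF that(1,2)] that(3) by (simp add: extends_def e_def)
    \<comment> \<open>A point whose coordinates have support of size m + 1 is interior to at most
      one new cell: the support of \<open>T y\<close> is the label set, and the hypothesis on
      interior points singles out the cell. All other points keep their old value.\<close>
    define s' where "s' y = (let S = {j. T y j \<noteq> 0} in if card S = Suc m
        then e S (THE \<kappa>. \<kappa> \<in> C S \<and> \<kappa> (T y) = y) (T y) else s y)" for y
    have s'_top: "s' (\<kappa> t) = e S \<kappa> t" if \<kappa>: "\<kappa> \<in> C S" and S: "card S = Suc m" and t: "t \<in> ?P S" for S \<kappa> t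
    proof (cases "t \<in> coord_faces S")
      case True
      have "T (\<kappa> t) = t" using T \<kappa> t PD by blast
      moreover have "{j. t j \<noteq> 0} \<subset> S"
        using True t by (auto simp: trunc_simplex_def coord_simplex_def coord_faces_def)
      then have "card {j. t j \<noteq> 0} \<noteq> Suc m"
        using psubset_card_mono[of S "{j. t j \<noteq> 0}"] fin[OF \<kappa>] S by simp
      ultimately show ?thesis
        using es[OF \<kappa> S, of t] t True by (simp add: s'_def)
    next
      case False
      have tD: "t \<in> coord_simplex S" using t PD by blast
      have "T (\<kappa> t) = t" using T \<kappa> tD by blast
      moreover have "{j. t j \<noteq> 0} = S"
        by (rule coord_simplex_support[OF tD False])
      moreover have "(THE \<kappa>'. \<kappa>' \<in> C S \<and> \<kappa>' t = \<kappa> t) = \<kappa>"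
        by (rule the_equality) (use \<kappa> unique[OF _ \<kappa> tD False] in auto)
      ultimately show ?thesis using S by (simp add: s'_def)
    qed
    have s'_low: "s' (\<kappa> t) = s (\<kappa> t)" if \<kappa>: "\<kappa> \<in> C S" and S: "card S \<le> m" and t: "t \<in> ?P S" for S \<kappa> t
    proof -
      have "T (\<kappa> t) = t" using T \<kappa> t PD by blast
      moreover have "{j. t j \<noteq> 0} \<subseteq> S"
        using t by (auto simp: trunc_simplex_def coord_simplex_def)
      then have "card {j. t j \<noteq> 0} \<noteq> Suc m"
        using card_mono[of S "{j. t j \<noteq> 0}"] fin[OF \<kappa>] S by simp
      ultimately show ?thesis by (simp add: s'_def)
    qed
    show ?case
    proof (intro exI[of _ s'] allI impI; elim conjE)
      fix S \<kappa> assume \<kappa>: "\<kappa> \<in> C S" and S: "card S \<le> Suc m"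
      show "continuous_map (top_of_set (?P S)) E (\<lambda>t. s' (\<kappa> t)) \<and> (\<forall>t\<in>?P S. p (s' (\<kappa> t)) = \<kappa> t)"
      proof (cases "card S = Suc m")
        case True
        have "continuous_map (top_of_set (?P S)) E (\<lambda>t. s' (\<kappa> t))"
          by (rule continuous_map_top_of_set_eq[OF e[OF \<kappa> True]]) (simp add: s'_top[OF \<kappa> True])
        then show ?thesis using pe[OF \<kappa> True] s'_top[OF \<kappa> True] by simp
      next
        case False
        then have S: "card S \<le> m" using S by simp
        have "continuous_map (top_of_set (?P S)) E (\<lambda>t. s' (\<kappa> t))"
          by (rule continuous_map_top_of_set_eq[OF s[OF \<kappa> S]]) (simp add: s'_low[OF \<kappa> S])
        then show ?thesis using ps[OF \<kappa> S] s'_low[OF \<kappa> S] by simp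
      qed
    qed
  qed
  \<comment> \<open>No cell has more than \<open>N\<close> labels, so stage \<open>N\<close> has
    treated them all.\<close>
  from this[of N] show ?thesis
    using fin by meson
qed

section \<open>Lifting through covering maps\<close>

definition evenly_covered_by ::
  "'b topology \<Rightarrow> 'x topology \<Rightarrow> ('b \<Rightarrow> 'x) \<Rightarrow> 'x set \<Rightarrow> 'b set set \<Rightarrow> bool" where
  "evenly_covered_by Y X q U \<V> \<longleftrightarrow> openin X U \<and> \<Union>\<V> = {y \<in> topspace Y. q y \<in> U} \<and>
     (\<forall>V\<in>\<V>. openin Y V) \<and> pairwise disjnt \<V> \<and>
     (\<forall>V\<in>\<V>. homeomorphic_map (subtopology Y V) (subtopology X U) q)"

lemma covering_map_evenly_covered:
  assumes "covering_map Y X q" "x \<in> topspace X"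
  obtains U \<V> where "x \<in> U" "evenly_covered_by Y X q U \<V>"
  using assms(1)[unfolded covering_map_def, THEN conjunct2, THEN conjunct2, THEN bspec, OF assms(2)]
  unfolding evenly_covered_by_def by auto

lemma evenly_covered_by_sheet:
  assumes "evenly_covered_by Y X q U \<V>" "V \<in> \<V>"
  shows "openin Y V" "inj_on q V" "homeomorphic_map (subtopology Y V) (subtopology X U) q"
proof -
  show V: "openin Y V" and h: "homeomorphic_map (subtopology Y V) (subtopology X U) q"
    using assms by (auto simp: evenly_covered_by_def)
  have "topspace (subtopology Y V) = V"
    using openin_subset[OF V] by auto
  then show "inj_on q V" using h by (simp add: homeomorphic_map_def)
qed

lemma evenly_covered_by_sheet_exists:
  assumes "evenly_covered_by Y X q U \<V>" "y \<in> topspace Y" "q y \<in> U"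
  obtains V where "V \<in> \<V>" "y \<in> V"
proof -
  have "y \<in> \<Union>\<V>" using assms by (simp add: evenly_covered_by_def)
  then show thesis using that by blast
qed

lemma covering_map_injective_sheet:
  assumes cov: "covering_map Y X q" and y: "y \<in> topspace Y"
  obtains V where "openin Y V" "y \<in> V" "inj_on q V"
proof -
  have "q y \<in> topspace X"
    using cov y by (auto simp: covering_map_def)
  then obtain U \<V> where U: "q y \<in> U" "evenly_covered_by Y X q U \<V>"
    by (rule covering_map_evenly_covered[OF cov])
  obtain V where V: "V \<in> \<V>" "y \<in> V"
    by (rule evenly_covered_by_sheet_exists[OF U(2) y U(1)])
  show thesis
    by (rule that[OF evenly_covered_by_sheet(1)[OF U(2) V(1)] V(2) evenly_covered_by_sheet(2)[OF U(2) V(1)]])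
qed

text \<open>The set of agreement is open because \<open>q\<close> is injective on each sheet, and
  its complement is open because different sheets are disjoint; it contains \<open>z0\<close>, so
  connectedness makes it everything.\<close>

lemma covering_map_lift_unique:
  assumes cov: "covering_map Y X q" and Z: "connected_space Z"
    and f: "continuous_map Z Y f" and g: "continuous_map Z Y g"
    and eq: "\<And>z. z \<in> topspace Z \<Longrightarrow> q (f z) = q (g z)"
    and z0: "z0 \<in> topspace Z" "f z0 = g z0" and z: "z \<in> topspace Z"
  shows "f z = g z"
proof -
  let ?D = "{z \<in> topspace Z. f z = g z}"
  have fY: "f z \<in> topspace Y" "g z \<in> topspace Y" if "z \<in> topspace Z" for z
    using f g that by (auto simp: continuous_map_def)
  have sheet: "openin Z {z \<in> topspace Z. f z \<in> V \<and> g z \<in> W}" if "openin Y V" "openin Y W" for V W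
  proof -
    have "{z \<in> topspace Z. f z \<in> V \<and> g z \<in> W} = {z \<in> topspace Z. f z \<in> V} \<inter> {z \<in> topspace Z. g z \<in> W}"
      by auto
    then show ?thesis
      using f g that by (auto intro!: openin_Int openin_continuous_map_preimage)
  qed
  have "openin Z ?D"
  proof (subst openin_subopen, intro ballI)
    fix z assume z: "z \<in> ?D"
    then obtain V where V: "openin Y V" "f z \<in> V" "inj_on q V"
      using covering_map_injective_sheet[OF cov, of "f z"] fY by auto
    have "{z \<in> topspace Z. f z \<in> V \<and> g z \<in> V} \<subseteq> ?D"
      using V(3) eq by (auto simp: inj_on_def)
    with V z show "\<exists>T. openin Z T \<and> z \<in> T \<and> T \<subseteq> ?D"
      using sheet[OF V(1,1)] by (intro exI[of _ "{z \<in> topspace Z. f z \<in> V \<and> g z \<in> V}"]) auto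
  qed
  moreover have "openin Z (topspace Z - ?D)"
  proof (subst openin_subopen, intro ballI)
    fix z assume z: "z \<in> topspace Z - ?D"
    then have "q (f z) \<in> topspace X"
      using cov fY by (auto simp: covering_map_def)
    then obtain U \<V> where U: "q (f z) \<in> U" "evenly_covered_by Y X q U \<V>"
      by (rule covering_map_evenly_covered[OF cov])
    have zZ: "z \<in> topspace Z" using z by simp
    have "q (g z) \<in> U" using U(1) eq[OF zZ] by simp
    obtain V where V: "V \<in> \<V>" "f z \<in> V"
      by (rule evenly_covered_by_sheet_exists[OF U(2) fY(1)[OF zZ] U(1)])
    obtain W where W: "W \<in> \<V>" "g z \<in> W"
      by (rule evenly_covered_by_sheet_exists[OF U(2) fY(2)[OF zZ] \<open>q (g z) \<in> U\<close>])
    have "V \<noteq> W"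
    proof
      assume "V = W"
      moreover have "inj_on q V" by (rule evenly_covered_by_sheet(2)[OF U(2) V(1)])
      ultimately have "f z = g z" using V W eq z by (auto simp: inj_on_def)
      then show False using z by auto
    qed
    then have "V \<inter> W = {}"
      using U(2) V W by (auto simp: evenly_covered_by_def pairwise_def disjnt_def)
    then have "{z \<in> topspace Z. f z \<in> V \<and> g z \<in> W} \<subseteq> topspace Z - ?D" by auto
    with V W z show "\<exists>T. openin Z T \<and> z \<in> T \<and> T \<subseteq> topspace Z - ?D"
      using sheet[OF evenly_covered_by_sheet(1)[OF U(2) V(1)] evenly_covered_by_sheet(1)[OF U(2) W(1)]]
      by (intro exI[of _ "{z \<in> topspace Z. f z \<in> V \<and> g z \<in> W}"]) auto
  qed
  then have "closedin Z ?D" by (auto simp: closedin_def)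
  ultimately have "?D = {} \<or> ?D = topspace Z"
    using Z unfolding connected_space_clopen_in by blast
  then show ?thesis using z0 z by blast
qed

text \<open>Lifts are demanded through every point over every \<open>b\<close> in \<open>B\<close>,
  not only over one base point. So the property passes to subsets, and pieces can be glued starting
  from either side.\<close>

definition has_lifts :: "'b topology \<Rightarrow> ('b \<Rightarrow> 'x) \<Rightarrow> ('a::topological_space \<Rightarrow> 'x) \<Rightarrow> 'a set \<Rightarrow> bool" where
  "has_lifts Y q f B \<longleftrightarrow> (\<forall>b\<in>B. \<forall>y\<in>topspace Y. q y = f b \<longrightarrow>
     (\<exists>\<kappa>. continuous_map (top_of_set B) Y \<kappa> \<and> (\<forall>x\<in>B. q (\<kappa> x) = f x) \<and> \<kappa> b = y))"

lemma has_liftsE: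
  assumes "has_lifts Y q f B" "b \<in> B" "y \<in> topspace Y" "q y = f b"
  obtains \<kappa> where "continuous_map (top_of_set B) Y \<kappa>" "\<And>x. x \<in> B \<Longrightarrow> q (\<kappa> x) = f x" "\<kappa> b = y"
  using assms unfolding has_lifts_def by blast

lemma has_lifts_subset:
  assumes "has_lifts Y q f B" "A \<subseteq> B" shows "has_lifts Y q f A"
  unfolding has_lifts_def
proof (intro ballI impI)
  fix b y assume "b \<in> A" "y \<in> topspace Y" "q y = f b"
  then obtain \<kappa> where \<kappa>: "continuous_map (top_of_set B) Y \<kappa>" "\<And>x. x \<in> B \<Longrightarrow> q (\<kappa> x) = f x" "\<kappa> b = y"
    using has_liftsE[OF assms(1), of b y] assms(2) by blast
  then show "\<exists>\<kappa>. continuous_map (top_of_set A) Y \<kappa> \<and> (\<forall>x\<in>A. q (\<kappa> x) = f x) \<and> \<kappa> b = y"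
    using continuous_map_top_of_set_subset[OF \<kappa>(1) assms(2)] assms(2) by blast
qed

text \<open>Over an evenly covered set, the lift through \<open>y\<close> is \<open>f\<close>
  followed by the inverse of \<open>q\<close> on the sheet containing \<open>y\<close>.\<close>

lemma has_lifts_evenly_covered:
  assumes cov: "covering_map Y X q" and f: "continuous_map (top_of_set C) X f" and x: "x \<in> C"
  obtains W where "openin (top_of_set C) W" "x \<in> W" "has_lifts Y q f W"
proof -
  have "f x \<in> topspace X" using f x by (auto simp: continuous_map_def)
  then obtain U \<V> where fxU: "f x \<in> U" and U: "evenly_covered_by Y X q U \<V>"
    by (rule covering_map_evenly_covered[OF cov])
  have openU: "openin X U" using U by (simp add: evenly_covered_by_def)
  let ?W = "{z \<in> topspace (top_of_set C). f z \<in> U}"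
  have "openin (top_of_set C) ?W"
    by (rule openin_continuous_map_preimage[OF f openU])
  moreover have "has_lifts Y q f ?W"
    unfolding has_lifts_def
  proof (intro ballI impI)
    fix b y assume b: "b \<in> ?W" and y: "y \<in> topspace Y" "q y = f b"
    have "q y \<in> U" using b y by simp
    obtain V where V: "V \<in> \<V>" "y \<in> V"
      by (rule evenly_covered_by_sheet_exists[OF U y(1) \<open>q y \<in> U\<close>])
    obtain h where h: "homeomorphic_maps (subtopology Y V) (subtopology X U) q h"
      using evenly_covered_by_sheet(3)[OF U V(1)] homeomorphic_map_maps by blast
    have hY: "continuous_map (subtopology X U) Y h"
      using h by (auto simp: homeomorphic_maps_def continuous_map_in_subtopology)
    have hq: "h (q z) = z" if "z \<in> V" for z
      using h that openin_subset[OF evenly_covered_by_sheet(1)[OF U V(1)]] by (auto simp: homeomorphic_maps_def)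
    have qh: "q (h z) = z" if "z \<in> U" for z
      using h that openin_subset[OF openU] by (auto simp: homeomorphic_maps_def)
    have "continuous_map (top_of_set ?W) X f"
      by (rule continuous_map_top_of_set_subset[OF f]) auto
    then have "continuous_map (top_of_set ?W) (subtopology X U) f"
      by (rule continuous_map_into_subtopology) auto
    then have "continuous_map (top_of_set ?W) Y (h \<circ> f)"
      using hY by (rule continuous_map_compose)
    moreover have "\<forall>z\<in>?W. q ((h \<circ> f) z) = f z" using qh by simp
    moreover have "(h \<circ> f) b = y" using hq[OF V(2)] y by simp
    ultimately show "\<exists>\<kappa>. continuous_map (top_of_set ?W) Y \<kappa> \<and> (\<forall>z\<in>?W. q (\<kappa> z) = f z) \<and> \<kappa> b = y"
      by blast
  qed
  moreover have "x \<in> ?W" using fxU x by simp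
  ultimately show thesis using that by blast
qed

text \<open>A lift over one piece fixes the start of a lift over the other at a common point.
  Connectedness of the intersection forces them to agree on all of it, and closedness permits
  pasting.\<close>

lemma has_lifts_Un:
  assumes cov: "covering_map Y X q" and cl: "closed A" "closed B" and AB: "connected (A \<inter> B)" "A \<inter> B \<noteq> {}"
    and A: "has_lifts Y q f A" and B: "has_lifts Y q f B"
  shows "has_lifts Y q f (A \<union> B)"
proof -
  have *: "\<exists>\<kappa>. continuous_map (top_of_set (A \<union> B)) Y \<kappa> \<and> (\<forall>x\<in>A \<union> B. q (\<kappa> x) = f x) \<and> \<kappa> b = y"
    if A: "has_lifts Y q f A" and B: "has_lifts Y q f B" and cl: "closed A" "closed B"
      and AB: "connected (A \<inter> B)" "A \<inter> B \<noteq> {}" and b: "b \<in> A" "y \<in> topspace Y" "q y = f b" for A B b y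
  proof -
    obtain \<kappa> where \<kappa>: "continuous_map (top_of_set A) Y \<kappa>" "\<And>x. x \<in> A \<Longrightarrow> q (\<kappa> x) = f x" "\<kappa> b = y"
      using has_liftsE[OF A b] by blast
    obtain w where w: "w \<in> A" "w \<in> B" using AB by auto
    have "\<kappa> w \<in> topspace Y" using \<kappa>(1) w by (auto simp: continuous_map_def)
    then obtain \<kappa>' where \<kappa>': "continuous_map (top_of_set B) Y \<kappa>'" "\<And>x. x \<in> B \<Longrightarrow> q (\<kappa>' x) = f x" "\<kappa>' w = \<kappa> w"
      using has_liftsE[OF B w(2)] \<kappa>(2)[OF w(1)] by metis
    have eq: "\<kappa> x = \<kappa>' x" if "x \<in> A \<inter> B" for x
    proof (rule covering_map_lift_unique[OF cov, of "top_of_set (A \<inter> B)" \<kappa> \<kappa>' w x])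
      show "connected_space (top_of_set (A \<inter> B))"
        using AB(1) connectedin_iff_connected connectedin_def by blast
      show "continuous_map (top_of_set (A \<inter> B)) Y \<kappa>" "continuous_map (top_of_set (A \<inter> B)) Y \<kappa>'"
        using \<kappa>(1) \<kappa>'(1) by (auto elim: continuous_map_top_of_set_subset)
    qed (use \<kappa> \<kappa>' w that in auto)
    define l where "l x = (if x \<in> A then \<kappa> x else \<kappa>' x)" for x
    have "continuous_map (top_of_set (A \<union> B)) Y l"
    proof (rule continuous_map_closed_Un[OF cl])
      show "continuous_map (top_of_set A) Y l"
        by (rule continuous_map_top_of_set_eq[OF \<kappa>(1)]) (simp add: l_def)
      show "continuous_map (top_of_set B) Y l"
        by (rule continuous_map_top_of_set_eq[OF \<kappa>'(1)]) (use eq in \<open>simp add: l_def\<close>)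
    qed
    moreover have "\<forall>x\<in>A \<union> B. q (l x) = f x" "l b = y"
      using \<kappa> \<kappa>' b by (auto simp: l_def)
    ultimately show ?thesis by blast
  qed
  show ?thesis
    unfolding has_lifts_def
  proof (intro ballI impI)
    fix b y assume b: "b \<in> A \<union> B" and y: "y \<in> topspace Y" "q y = f b"
    show "\<exists>\<kappa>. continuous_map (top_of_set (A \<union> B)) Y \<kappa> \<and> (\<forall>x\<in>A \<union> B. q (\<kappa> x) = f x) \<and> \<kappa> b = y"
    proof (cases "b \<in> A")
      case True
      show ?thesis by (rule *[OF A B cl AB True y])
    next
      case False
      then have "b \<in> B" using b by simp
      then show ?thesis
        using *[OF B A cl(2,1) _ _ _ y] AB by (simp add: Un_commute Int_commute)
    qed
  qed
qed

section \<open>Existence of lifts over boxes and their retracts\<close>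

lemma connected_box:
  fixes I :: "'i \<Rightarrow> real set"
  assumes "\<And>i. connected (I i)" shows "connected {y. \<forall>i. y i \<in> I i}"
proof -
  have "connectedin (powertop_real UNIV) (PiE UNIV I)"
    using assms by (subst connectedin_PiE) simp
  moreover have "PiE UNIV I = {y. \<forall>i. y i \<in> I i}" by auto
  ultimately show ?thesis
    by (simp add: euclidean_product_topology)
qed

lemma closed_box:
  fixes I :: "'i \<Rightarrow> real set"
  assumes "\<And>i. closed (I i)" shows "closed {y. \<forall>i. y i \<in> I i}"
proof -
  have "closedin (powertop_real UNIV) (PiE UNIV I)"
    using assms by (subst closedin_product_topology) auto
  moreover have "PiE UNIV I = {y. \<forall>i. y i \<in> I i}" by auto
  ultimately show ?thesis
    by (simp add: euclidean_product_topology)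
qed

definition unit_box :: "nat \<Rightarrow> (nat \<Rightarrow> real) set" where
  "unit_box n = {x. (\<forall>i<n. 0 \<le> x i \<and> x i \<le> 1) \<and> (\<forall>i\<ge>n. x i = 0)}"

lemma openin_unit_box_nbhd:
  assumes "openin (top_of_set (unit_box n)) W" "x \<in> W"
  obtains \<delta> where "\<delta> > 0" "{y \<in> unit_box n. \<forall>i<n. \<bar>y i - x i\<bar> \<le> \<delta>} \<subseteq> W"
proof -
  obtain O' where O': "open O'" "W = unit_box n \<inter> O'"
    using assms(1) by (auto simp: openin_open)
  have "openin (powertop_real UNIV) O'"
    using O'(1) by (simp add: euclidean_product_topology)
  then obtain X where X: "x \<in> PiE UNIV X" "\<And>i. open (X i)" "PiE UNIV X \<subseteq> O'"
    using product_topology_open_contains_basis[of "\<lambda>_. euclidean" UNIV O' x] assms(2) O' by auto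
  have "\<exists>e>0. \<forall>z. \<bar>z - x i\<bar> \<le> e \<longrightarrow> z \<in> X i" for i
  proof -
    have "x i \<in> X i" using X(1) by auto
    then obtain e where "e > 0" "cball (x i) e \<subseteq> X i"
      using X(2) open_contains_cball by blast
    then show ?thesis
      by (intro exI[of _ e]) (auto simp: dist_real_def abs_minus_commute subset_iff)
  qed
  then obtain e where e: "\<And>i. e i > 0" "\<And>i z. \<bar>z - x i\<bar> \<le> e i \<Longrightarrow> z \<in> X i" by metis
  define \<delta> where "\<delta> = Min (insert 1 (e ` {..<n}))"
  have "\<delta> > 0" using e(1) by (simp add: \<delta>_def)
  moreover have "{y \<in> unit_box n. \<forall>i<n. \<bar>y i - x i\<bar> \<le> \<delta>} \<subseteq> W"
  proof
    fix y assume y: "y \<in> {y \<in> unit_box n. \<forall>i<n. \<bar>y i - x i\<bar> \<le> \<delta>}"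
    have "y i \<in> X i" for i
    proof (cases "i < n")
      case True
      then have "\<delta> \<le> e i" unfolding \<delta>_def by (intro Min_le) auto
      then show ?thesis using e(2)[of "y i" i] y True by force
    next
      case False
      then have "y i = x i" using y assms(2) O'(2) by (auto simp: unit_box_def)
      then show ?thesis using X(1) by auto
    qed
    then have "y \<in> O'" using X(3) by auto
    then show "y \<in> W" using y O' by auto
  qed
  ultimately show thesis using that by blast
qed

text \<open>Subdivision is done one coordinate at a time: near every point there is a slab, full in the
  first \<open>j\<close> coordinates, over which lifts exist.\<close>
lemma has_lifts_unit_box:
  assumes cov: "covering_map Y X q" and f: "continuous_map (top_of_set (unit_box n)) X f"
  shows "has_lifts Y q f (unit_box n)"
proof -
  \<comment> \<open>For \<open>j = 0\<close> this is a small cube around \<open>x\<close>, for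
    \<open>j = n\<close> the whole box.\<close>
  define slab where "slab j x \<delta> = {y \<in> unit_box n. \<forall>i. j \<le> i \<and> i < n \<longrightarrow> \<bar>y i - x i\<bar> \<le> \<delta>}" for j x \<delta>
  have slabs: "j \<le> n \<Longrightarrow> \<forall>x\<in>unit_box n. \<exists>\<delta>>0. has_lifts Y q f (slab j x \<delta>)" for j
  proof (induction j)
    case 0
    show ?case
    proof
      fix x assume "x \<in> unit_box n"
      then obtain W where W: "openin (top_of_set (unit_box n)) W" "x \<in> W" "has_lifts Y q f W"
        using has_lifts_evenly_covered[OF cov f] by blast
      obtain \<delta> where "\<delta> > 0" "{y \<in> unit_box n. \<forall>i<n. \<bar>y i - x i\<bar> \<le> \<delta>} \<subseteq> W"
        using openin_unit_box_nbhd[OF W(1,2)] by blast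
      then show "\<exists>\<delta>>0. has_lifts Y q f (slab 0 x \<delta>)"
        using has_lifts_subset[OF W(3)] by (auto simp: slab_def)
    qed
  next
    case (Suc j)
    then have j: "j < n" by simp
    show ?case
    proof
      fix x assume x: "x \<in> unit_box n"
      \<comment> \<open>The wanted slab with coordinate \<open>j\<close> confined to the interval
        from \<open>a\<close> to \<open>b\<close>. The thickness \<delta> may depend on the
        interval; gluing two intervals takes the smaller one.\<close>
      define L where "L a b \<delta> = {y \<in> slab (Suc j) x \<delta>. a \<le> y j \<and> y j \<le> b}" for a b \<delta>
      have L_box: "L a b \<delta> = {y. \<forall>i. y i \<in> (if i < n then {0..1} \<inter> (if i = j then {a..b}
          else if j < i then {x i - \<delta>..x i + \<delta>} else UNIV) else {0})}" for a b \<delta>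
      proof (intro set_eqI iffI)
        fix y assume y: "y \<in> L a b \<delta>"
        have "y i \<in> (if i < n then {0..1} \<inter> (if i = j then {a..b}
          else if j < i then {x i - \<delta>..x i + \<delta>} else UNIV) else {0})" for i
        proof -
          have "x i - \<delta> \<le> y i \<and> y i \<le> x i + \<delta>" if "j < i" "i < n"
          proof -
            have "\<bar>y i - x i\<bar> \<le> \<delta>" using y that by (simp add: L_def slab_def)
            then show ?thesis by linarith
          qed
          then show ?thesis
            using y by (auto simp: L_def slab_def unit_box_def)
        qed
        then show "y \<in> {y. \<forall>i. y i \<in> (if i < n then {0..1} \<inter> (if i = j then {a..b}
          else if j < i then {x i - \<delta>..x i + \<delta>} else UNIV) else {0})}"
          by simp
      next
        fix y assume "y \<in> {y. \<forall>i. y i \<in> (if i < n then {0..1} \<inter> (if i = j then {a..b}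
          else if j < i then {x i - \<delta>..x i + \<delta>} else UNIV) else {0})}"
        then have y: "y i \<in> (if i < n then {0..1} \<inter> (if i = j then {a..b}
          else if j < i then {x i - \<delta>..x i + \<delta>} else UNIV) else {0})" for i
          by simp
        have "0 \<le> y i" "y i \<le> 1" if "i < n" for i
          using y[of i] that by auto
        moreover have "y i = 0" if "n \<le> i" for i
          using y[of i] that by auto
        ultimately have "y \<in> unit_box n"
          unfolding unit_box_def by auto
        moreover have "\<bar>y i - x i\<bar> \<le> \<delta>" if "Suc j \<le> i" "i < n" for i
          using y[of i] that by (auto simp: abs_le_iff)
        moreover have "a \<le> y j" "y j \<le> b" using y[of j] j by auto
        ultimately show "y \<in> L a b \<delta>" by (simp add: L_def slab_def)
      qed
      \<comment> \<open>Bisection, the compactness of the interval in disguise: a property that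
        passes to unions of adjacent intervals and holds for all short intervals around each point
        holds for the whole interval.\<close>
      have "0 \<le> (0::real) \<and> (1::real) \<le> 1 \<longrightarrow> (\<exists>\<delta>>0. has_lifts Y q f (L 0 1 \<delta>))"
      proof (rule Bolzano[where P = "\<lambda>a b. 0 \<le> a \<and> b \<le> 1 \<longrightarrow> (\<exists>\<delta>>0. has_lifts Y q f (L a b \<delta>))"])
        fix a b c :: real
        assume ab: "0 \<le> a \<and> b \<le> 1 \<longrightarrow> (\<exists>\<delta>>0. has_lifts Y q f (L a b \<delta>))"
          and bc: "0 \<le> b \<and> c \<le> 1 \<longrightarrow> (\<exists>\<delta>>0. has_lifts Y q f (L b c \<delta>))"
          and abc: "a \<le> b" "b \<le> c"
        show "0 \<le> a \<and> c \<le> 1 \<longrightarrow> (\<exists>\<delta>>0. has_lifts Y q f (L a c \<delta>))"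
        proof
          assume ac: "0 \<le> a \<and> c \<le> 1"
          obtain \<delta>1 \<delta>2 where \<delta>: "\<delta>1 > 0" "has_lifts Y q f (L a b \<delta>1)" "\<delta>2 > 0" "has_lifts Y q f (L b c \<delta>2)"
            using ab bc ac abc by auto
          let ?\<delta> = "min \<delta>1 \<delta>2"
          have 1: "has_lifts Y q f (L a b ?\<delta>)"
            by (rule has_lifts_subset[OF \<delta>(2)]) (auto simp: L_def slab_def)
          have 2: "has_lifts Y q f (L b c ?\<delta>)"
            by (rule has_lifts_subset[OF \<delta>(4)]) (auto simp: L_def slab_def)
          have int: "L a b ?\<delta> \<inter> L b c ?\<delta> = L b b ?\<delta>"
            using abc by (auto simp: L_def)
          have un: "L a b ?\<delta> \<union> L b c ?\<delta> = L a c ?\<delta>"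
            using abc by (auto simp: L_def)
          have closed_L: "closed (L a' b' ?\<delta>)" for a' b'
            unfolding L_box by (rule closed_box) auto
          \<comment> \<open>The two slabs meet in the slice where coordinate \<open>j\<close> equals
            \<open>b\<close>. It is a product of intervals, and it contains \<open>x\<close> with
            that coordinate replaced by \<open>b\<close>.\<close>
          have "connected (L b b ?\<delta>)"
            unfolding L_box by (rule connected_box, rule convex_connected) (simp add: convex_Int)
          moreover have "x(j := b) \<in> L b b ?\<delta>"
            using x j ac abc \<delta> by (auto simp: L_def slab_def unit_box_def)
          ultimately have "has_lifts Y q f (L a b ?\<delta> \<union> L b c ?\<delta>)"
            by (intro has_lifts_Un[OF cov] closed_L 1 2) (auto simp: int)
          then show "\<exists>\<delta>>0. has_lifts Y q f (L a c \<delta>)"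
            using \<delta> unfolding un by (intro exI[of _ ?\<delta>]) simp
        qed
      next
        fix s :: real assume s: "0 \<le> s" "s \<le> 1"
        then have "x(j := s) \<in> unit_box n" using x j by (auto simp: unit_box_def)
        then obtain \<delta> where \<delta>: "\<delta> > 0" "has_lifts Y q f (slab j (x(j := s)) \<delta>)"
          using Suc j by force
        have "has_lifts Y q f (L a b \<delta>)" if "a \<le> s" "s \<le> b" "b - a < \<delta>" for a b
        proof (rule has_lifts_subset[OF \<delta>(2)])
          show "L a b \<delta> \<subseteq> slab j (x(j := s)) \<delta>"
            using that by (auto simp: L_def slab_def abs_le_iff)
        qed
        then show "\<exists>d>0. \<forall>a b. a \<le> s \<and> s \<le> b \<and> b - a < d \<longrightarrow>
            0 \<le> a \<and> b \<le> 1 \<longrightarrow> (\<exists>\<delta>>0. has_lifts Y q f (L a b \<delta>))"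
          using \<delta>(1) by blast
      qed simp
      then obtain \<delta> where "\<delta> > 0" "has_lifts Y q f (L 0 1 \<delta>)" by auto
      moreover have "L 0 1 \<delta> = slab (Suc j) x \<delta>"
        using j by (auto simp: L_def slab_def unit_box_def)
      ultimately show "\<exists>\<delta>>0. has_lifts Y q f (slab (Suc j) x \<delta>)" by auto
    qed
  qed
  have "(\<lambda>_. 0) \<in> unit_box n" by (auto simp: unit_box_def)
  then obtain \<delta> where "has_lifts Y q f (slab n (\<lambda>_. 0) \<delta>)" using slabs[of n] by auto
  moreover have "slab n (\<lambda>_. 0) \<delta> = unit_box n" by (auto simp: slab_def)
  ultimately show ?thesis by simp
qed

lemma cube_retract_unit_box:
  assumes "cube_retract P"
  obtains n r where "continuous_on (unit_box n) r" "r \<in> unit_box n \<rightarrow> P" "P \<subseteq> unit_box n" "\<And>x. x \<in> P \<Longrightarrow> r x = x"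
  using assms unfolding cube_retract_def unit_cube_eq unit_box_def[symmetric] by auto

lemma has_lifts_cube_retract:
  assumes cov: "covering_map Y X q" and P: "cube_retract P" and f: "continuous_map (top_of_set P) X f"
  shows "has_lifts Y q f P"
proof -
  obtain n r where r: "continuous_on (unit_box n) r" "r \<in> unit_box n \<rightarrow> P" "P \<subseteq> unit_box n" "\<And>x. x \<in> P \<Longrightarrow> r x = x"
    using cube_retract_unit_box[OF P] by blast
  have "has_lifts Y q (\<lambda>x. f (r x)) (unit_box n)"
    by (rule has_lifts_unit_box[OF cov continuous_map_top_of_set_compose[OF r(1,2) f]])
  then have "has_lifts Y q (\<lambda>x. f (r x)) P"
    by (rule has_lifts_subset[OF _ r(3)])
  then show ?thesis
    using r(4) by (simp add: has_lifts_def)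
qed

lemma cube_retract_path_connected:
  assumes "cube_retract P" shows "path_connected_space (top_of_set P)"
proof -
  obtain n r where r: "continuous_on (unit_box n) r" "r \<in> unit_box n \<rightarrow> P" "P \<subseteq> unit_box n" "\<And>x. x \<in> P \<Longrightarrow> r x = x"
    using cube_retract_unit_box[OF assms] by blast
  have box: "unit_box n = PiE UNIV (\<lambda>i. if i < n then {0..1} else {0})"
    by (auto simp: unit_box_def PiE_iff split: if_splits)
  have "path_connectedin (powertop_real UNIV) (unit_box n)"
    unfolding box by (subst path_connectedin_PiE) simp
  then have "path_connected_space (top_of_set (unit_box n))"
    by (simp add: path_connectedin_def euclidean_product_topology)
  moreover have "continuous_map (top_of_set (unit_box n)) (top_of_set P) r"
    using r by simp
  moreover have "r ` unit_box n = P"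
    using r by (auto simp: image_iff subset_iff Pi_iff) metis
  ultimately show ?thesis
    using path_connectedin_continuous_map_image[of "top_of_set (unit_box n)" "top_of_set P" r "unit_box n"]
    by (simp add: path_connectedin_def path_connectedin_topspace subtopology_subtopology)
qed

section \<open>Barycentric flags and the cells of a covering\<close>

text \<open>The index of a set is its cardinality, so inclusions between different indices are
  proper. The empty \<open>S\<close> is allowed, so that inductions can peel off the largest set
  until nothing is left.\<close>

definition chain_on :: "nat set \<Rightarrow> (nat \<Rightarrow> 'v set) \<Rightarrow> bool" where
  "chain_on S \<phi> \<longleftrightarrow> finite S \<and> (\<forall>j\<in>S. 0 < j \<and> finite (\<phi> j) \<and> card (\<phi> j) = j) \<and>
     (\<forall>i\<in>S. \<forall>j\<in>S. i \<le> j \<longrightarrow> \<phi> i \<subseteq> \<phi> j)"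

text \<open>The point with coordinates \<open>t\<close> in the simplex of the barycentric subdivision spanned by the
  barycentres of the \<open>\<phi> j\<close>, where \<open>\<phi> j\<close> has \<open>j\<close> vertices.\<close>
definition chain_point :: "(nat \<Rightarrow> 'v set) \<Rightarrow> nat set \<Rightarrow> (nat \<Rightarrow> real) \<Rightarrow> 'v \<Rightarrow> real" where
  "chain_point \<phi> S t = (\<lambda>v. \<Sum>j\<in>S. if v \<in> \<phi> j then t j / real j else 0)"

section \<open>Recovering chain and coordinates from a point\<close>

lemma chain_on_subset: "chain_on S \<phi> \<Longrightarrow> S' \<subseteq> S \<Longrightarrow> chain_on S' \<phi>"
  unfolding chain_on_def by (meson finite_subset subsetD)

lemma chain_point_subset:
  assumes "finite S" "S' \<subseteq> S" "\<And>j. j \<in> S - S' \<Longrightarrow> t j = 0"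
  shows "chain_point \<phi> S t = chain_point \<phi> S' t"
  unfolding chain_point_def using assms
  by (intro ext sum.mono_neutral_right) auto

lemma chain_on_Union:
  assumes "chain_on S \<phi>" "S \<noteq> {}" shows "\<Union>(\<phi> ` S) = \<phi> (Max S)"
proof -
  have "finite S" using assms by (simp add: chain_on_def)
  then have "Max S \<in> S" "\<And>j. j \<in> S \<Longrightarrow> j \<le> Max S" using assms by auto
  then show ?thesis using assms unfolding chain_on_def by blast
qed

lemma chain_point_nonneg: "(\<And>j. j \<in> S \<Longrightarrow> 0 \<le> t j) \<Longrightarrow> 0 \<le> chain_point \<phi> S t v"
  unfolding chain_point_def by (intro sum_nonneg) auto

lemma chain_point_support:
  assumes "chain_on S \<phi>" "\<And>j. j \<in> S \<Longrightarrow> 0 < t j"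
  shows "{v. chain_point \<phi> S t v \<noteq> 0} = \<Union>(\<phi> ` S)"
proof -
  have fin: "finite S" and pos: "\<And>j. j \<in> S \<Longrightarrow> 0 < j" using assms by (auto simp: chain_on_def)
  have "chain_point \<phi> S t v = 0 \<longleftrightarrow> (\<forall>j\<in>S. v \<notin> \<phi> j)" for v
  proof -
    have "chain_point \<phi> S t v = 0 \<longleftrightarrow> (\<forall>j\<in>S. (if v \<in> \<phi> j then t j / real j else 0) = 0)"
      unfolding chain_point_def
      by (rule sum_nonneg_eq_0_iff[OF fin]) (use assms(2) in \<open>auto simp: less_imp_le\<close>)
    moreover have "t j / real j \<noteq> 0" if "j \<in> S" for j
      using pos[OF that] assms(2)[OF that] by simp
    ultimately show ?thesis by auto
  qed
  then show ?thesis by auto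
qed

text \<open>By cardinality some vertex of the largest set lies in no smaller set of the chain. There
  only the top summand contributes, while elsewhere on the set further nonnegative terms are added;
  so the minimum reads off the top coordinate.\<close>

lemma chain_point_min:
  assumes ch: "chain_on S \<phi>" and S: "S \<noteq> {}" and t: "\<And>j. j \<in> S \<Longrightarrow> 0 < t j"
  shows "Min (chain_point \<phi> S t ` \<phi> (Max S)) = t (Max S) / Max S"
proof -
  let ?n = "Max S" and ?S = "S - {Max S}"
  have fin: "finite S" using ch by (simp add: chain_on_def)
  have n: "?n \<in> S" using fin S by simp
  have split: "chain_point \<phi> S t v = t ?n / ?n + chain_point \<phi> ?S t v" if "v \<in> \<phi> ?n" for v
    unfolding chain_point_def
    using sum.remove[OF fin n, of "\<lambda>j. if v \<in> \<phi> j then t j / real j else 0"] that by simp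
  have ch': "chain_on ?S \<phi>" using chain_on_subset[OF ch] by blast
  have "\<not> \<phi> ?n \<subseteq> \<Union>(\<phi> ` ?S)"
  proof
    assume sub: "\<phi> ?n \<subseteq> \<Union>(\<phi> ` ?S)"
    have "\<phi> ?n \<noteq> {}" using ch n by (fastforce simp: chain_on_def)
    then have ne: "?S \<noteq> {}" using sub by blast
    have m: "Max ?S \<in> ?S" using fin ne by (intro Max_in) auto
    have "?n = card (\<phi> ?n)" using ch n by (simp add: chain_on_def)
    also have "\<dots> \<le> card (\<phi> (Max ?S))"
      using sub chain_on_Union[OF ch' ne] m ch by (intro card_mono) (auto simp: chain_on_def)
    also have "\<dots> = Max ?S" using ch m by (simp add: chain_on_def)
    finally have "?n \<le> Max ?S" .
    moreover have "Max ?S \<le> ?n" using m fin by simp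
    ultimately show False using m by simp
  qed
  then obtain v where v: "v \<in> \<phi> ?n" "v \<notin> \<Union>(\<phi> ` ?S)" by blast
  show ?thesis
  proof (rule Min_eqI)
    show "finite (chain_point \<phi> S t ` \<phi> ?n)" using ch n by (simp add: chain_on_def)
    have "chain_point \<phi> ?S t v = 0" unfolding chain_point_def by (rule sum.neutral) (use v in auto)
    then have "chain_point \<phi> S t v = t ?n / ?n" using split[OF v(1)] by simp
    then show "t ?n / ?n \<in> chain_point \<phi> S t ` \<phi> ?n" using v(1) by (metis image_eqI)
    fix y assume "y \<in> chain_point \<phi> S t ` \<phi> ?n"
    then obtain u where "u \<in> \<phi> ?n" "y = chain_point \<phi> S t u" by auto
    then show "t ?n / ?n \<le> y"
      using split[of u] chain_point_nonneg[of ?S t \<phi> u] t by (auto simp: less_imp_le)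
  qed
qed

text \<open>Peeling from the top: the support is the largest set, the minimal value on it gives the
  top coordinate, and subtracting the top summand leaves a point of a shorter chain. The coordinates
  are not normalised, as the subtraction would destroy this.\<close>

lemma chain_point_unique:
  assumes "chain_on S \<phi>" "\<And>j. j \<in> S \<Longrightarrow> 0 < t j" "chain_on S' \<phi>'" "\<And>j. j \<in> S' \<Longrightarrow> 0 < t' j"
    and "chain_point \<phi> S t = chain_point \<phi>' S' t'"
  shows "S = S' \<and> (\<forall>j\<in>S. \<phi> j = \<phi>' j \<and> t j = t' j)"
  using assms
proof (induction "card S" arbitrary: S S' rule: less_induct)
  case less
  note ch = less.prems(1) and ch' = less.prems(3) and t = less.prems(2) and t' = less.prems(4)
  have fin: "finite S" "finite S'" using ch ch' by (auto simp: chain_on_def)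
  have U: "\<Union>(\<phi> ` S) = \<Union>(\<phi>' ` S')"
  proof -
    have "{v. chain_point \<phi> S t v \<noteq> 0} = \<Union>(\<phi> ` S)"
      by (rule chain_point_support[OF ch]) (rule t)
    moreover have "{v. chain_point \<phi>' S' t' v \<noteq> 0} = \<Union>(\<phi>' ` S')"
      by (rule chain_point_support[OF ch']) (rule t')
    ultimately show ?thesis using less.prems(5) by simp
  qed
  have ne: "\<phi> j \<noteq> {}" if "j \<in> S" for j using ch that by (fastforce simp: chain_on_def)
  have ne': "\<phi>' j \<noteq> {}" if "j \<in> S'" for j using ch' that by (fastforce simp: chain_on_def)
  show ?case
  proof (cases "S = {}")
    case True
    then have "\<Union>(\<phi>' ` S') = {}" using U by simp
    then have "S' = {}" using ne' by blast
    with True show ?thesis by simp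
  next
    case False
    then have "\<Union>(\<phi> ` S) \<noteq> {}" using ne by blast
    then have False': "S' \<noteq> {}" using U by auto
    let ?n = "Max S"
    have n: "?n \<in> S" "Max S' \<in> S'" using fin False False' by auto
    have eq: "\<phi> ?n = \<phi>' (Max S')" using U chain_on_Union[OF ch False] chain_on_Union[OF ch' False'] by simp
    moreover have "card (\<phi> ?n) = ?n" "card (\<phi>' (Max S')) = Max S'"
      using n ch ch' by (auto simp: chain_on_def)
    ultimately have max: "Max S' = ?n" by simp
    have "?n > 0" using n ch by (simp add: chain_on_def)
    have "Min (chain_point \<phi> S t ` \<phi> ?n) = t ?n / ?n"
      by (rule chain_point_min[OF ch False]) (rule t)
    moreover have "Min (chain_point \<phi>' S' t' ` \<phi>' (Max S')) = t' (Max S') / Max S'"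
      by (rule chain_point_min[OF ch' False']) (rule t')
    ultimately have "t ?n / ?n = t' ?n / ?n"
      using eq max less.prems(5) by simp
    then have tn: "t ?n = t' ?n" using \<open>?n > 0\<close> by simp
    have n': "?n \<in> S'" using n(2) max by simp
    have "chain_point \<phi> (S - {?n}) t v = chain_point \<phi>' (S' - {?n}) t' v" for v
    proof -
      have "chain_point \<phi> S t v = (if v \<in> \<phi> ?n then t ?n / ?n else 0) + chain_point \<phi> (S - {?n}) t v"
        unfolding chain_point_def by (rule sum.remove[OF fin(1) n(1)])
      moreover have "chain_point \<phi>' S' t' v = (if v \<in> \<phi>' ?n then t' ?n / ?n else 0) + chain_point \<phi>' (S' - {?n}) t' v"
        unfolding chain_point_def by (rule sum.remove[OF fin(2) n'])
      ultimately show ?thesis using less.prems(5) eq max tn by (simp split: if_splits)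
    qed
    then have eq': "chain_point \<phi> (S - {?n}) t = chain_point \<phi>' (S' - {?n}) t'" by (rule ext)
    have IH: "S - {?n} = S' - {?n} \<and> (\<forall>j\<in>S - {?n}. \<phi> j = \<phi>' j \<and> t j = t' j)"
    proof (rule less.hyps[OF _ _ _ _ _ eq'])
      show "card (S - {?n}) < card S" by (rule card_Diff1_less[OF fin(1) n(1)])
      show "chain_on (S - {?n}) \<phi>" by (rule chain_on_subset[OF ch]) blast
      show "chain_on (S' - {?n}) \<phi>'" by (rule chain_on_subset[OF ch']) blast
      show "0 < t j" if "j \<in> S - {?n}" for j by (rule t) (use that in blast)
      show "0 < t' j" if "j \<in> S' - {?n}" for j by (rule t') (use that in blast)
    qed
    have "insert ?n (S - {?n}) = insert ?n (S' - {?n})" using IH by simp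
    then have "S = S'" by (simp only: insert_Diff[OF n(1)] insert_Diff[OF n'])
    moreover have "\<phi> j = \<phi>' j \<and> t j = t' j" if "j \<in> S" for j
    proof (cases "j = ?n")
      case True
      then show ?thesis using eq max tn by simp
    next
      case False
      then have "j \<in> S - {?n}" using that by simp
      then show ?thesis using IH by simp
    qed
    ultimately show ?thesis by simp
  qed
qed

text \<open>Subtracting the minimal value of \<open>f\<close> on its support makes the support
  strictly smaller; the old support then becomes the top set over the chain found for the
  rest.\<close>

lemma chain_point_exists:
  fixes f :: "'v \<Rightarrow> real"
  assumes "finite {v. f v \<noteq> 0}" "\<And>v. 0 \<le> f v"
    and K: "\<And>\<tau>. \<tau> \<subseteq> {v. f v \<noteq> 0} \<Longrightarrow> \<tau> \<noteq> {} \<Longrightarrow> \<tau> \<in> K"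
  shows "\<exists>S \<phi> t. chain_on S \<phi> \<and> \<phi> ` S \<subseteq> K \<and> \<Union>(\<phi> ` S) \<subseteq> {v. f v \<noteq> 0} \<and>
     (\<forall>j\<in>S. 0 < t j) \<and> (\<forall>j. j \<notin> S \<longrightarrow> t j = 0) \<and> f = chain_point \<phi> S t"
  using assms
proof (induction "card {v. f v \<noteq> 0}" arbitrary: f rule: less_induct)
  case less
  let ?\<tau> = "{v. f v \<noteq> 0}"
  note fin = less.prems(1) and nonneg = less.prems(2) and K = less.prems(3)
  show ?case
  proof (cases "?\<tau> = {}")
    case True
    then show ?thesis
      by (intro exI[of _ "{}"] exI[of _ undefined] exI[of _ "\<lambda>_. 0"])
        (auto simp: chain_on_def chain_point_def)
  next
    case False
    define a where "a = Min (f ` ?\<tau>)"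
    have a_in: "a \<in> f ` ?\<tau>" unfolding a_def using fin False by (intro Min_in) auto
    have a_le: "a \<le> f v" if "f v \<noteq> 0" for v unfolding a_def using fin that by (intro Min_le) auto
    have a_pos: "0 < a" using a_in nonneg by (auto simp: less_le)
    define g where "g v = (if f v \<noteq> 0 then f v - a else 0)" for v
    obtain v0 where v0: "f v0 \<noteq> 0" "a = f v0" using a_in by blast
    have "g v0 = 0" by (simp add: g_def v0)
    moreover have "{v. g v \<noteq> 0} \<subseteq> ?\<tau>" by (auto simp: g_def)
    ultimately have supp: "{v. g v \<noteq> 0} \<subset> ?\<tau>" using v0(1) by blast
    have lt: "card {v. g v \<noteq> 0} < card ?\<tau>" by (rule psubset_card_mono[OF fin supp])
    have "\<exists>S \<phi> t. chain_on S \<phi> \<and> \<phi> ` S \<subseteq> K \<and> \<Union>(\<phi> ` S) \<subseteq> {v. g v \<noteq> 0} \<and>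
      (\<forall>j\<in>S. 0 < t j) \<and> (\<forall>j. j \<notin> S \<longrightarrow> t j = 0) \<and> g = chain_point \<phi> S t"
    proof (rule less.hyps[OF lt])
      show "finite {v. g v \<noteq> 0}" using finite_subset[OF _ fin] supp by blast
      show "0 \<le> g v" for v using a_le by (auto simp: g_def)
      show "\<sigma> \<in> K" if "\<sigma> \<subseteq> {v. g v \<noteq> 0}" "\<sigma> \<noteq> {}" for \<sigma>
        using K[of \<sigma>] that supp by blast
    qed
    then obtain S \<phi> t where ch: "chain_on S \<phi>" and \<phi>K: "\<phi> ` S \<subseteq> K" and \<phi>g: "\<Union>(\<phi> ` S) \<subseteq> {v. g v \<noteq> 0}"
      and t: "\<And>j. j \<in> S \<Longrightarrow> 0 < t j" "\<And>j. j \<notin> S \<Longrightarrow> t j = 0" and g: "g = chain_point \<phi> S t" by blast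
    define n where "n = card ?\<tau>"
    have n0: "n > 0" using fin False by (simp add: n_def card_gt_0_iff)
    have less_n: "j < n" if "j \<in> S" for j
    proof -
      have "j = card (\<phi> j)" using ch that by (simp add: chain_on_def)
      also have "\<dots> \<le> card {v. g v \<noteq> 0}"
        using \<phi>g that finite_subset[OF psubset_imp_subset[OF supp] fin] by (intro card_mono) auto
      finally show ?thesis using lt by (simp add: n_def)
    qed
    then have nS: "n \<notin> S" by blast
    define \<phi>' where "\<phi>' = \<phi>(n := ?\<tau>)"
    \<comment> \<open>The barycentre of n vertices has value 1 / n at each of them, so a layer of
      height \<open>a\<close> has coordinate \<open>n * a\<close>.\<close>
    define t' where "t' = t(n := n * a)"
    have \<phi>': "\<phi>' j = \<phi> j" "t' j = t j" if "j \<in> S" for j using that nS by (auto simp: \<phi>'_def t'_def)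
    have \<phi>n: "\<phi>' n = ?\<tau>" "t' n = n * a" by (auto simp: \<phi>'_def t'_def)
    have sub: "\<phi> j \<subseteq> ?\<tau>" if "j \<in> S" for j using \<phi>g supp that by blast
    have "chain_on (insert n S) \<phi>'"
      unfolding chain_on_def
    proof (intro conjI ballI impI)
      show "finite (insert n S)" using ch by (simp add: chain_on_def)
      fix j assume j: "j \<in> insert n S"
      show "0 < j" "finite (\<phi>' j)" "card (\<phi>' j) = j"
        using j ch n0 fin \<phi>' \<phi>n by (auto simp: chain_on_def n_def)
      fix i assume i: "i \<in> insert n S" and "j \<le> i"
      show "\<phi>' j \<subseteq> \<phi>' i"
      proof (cases "i = n")
        case True
        then show ?thesis using j sub \<phi>' \<phi>n by (cases "j = n") auto
      next
        case False
        then have "i \<in> S" using i by simp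
        then have "j \<noteq> n" using less_n \<open>j \<le> i\<close> by fastforce
        then show ?thesis using j \<open>i \<in> S\<close> \<phi>' ch \<open>j \<le> i\<close> by (auto simp: chain_on_def)
      qed
    qed
    moreover have "\<phi>' ` insert n S \<subseteq> K"
      using \<phi>K \<phi>' \<phi>n K[of ?\<tau>] False by auto
    moreover have "\<Union>(\<phi>' ` insert n S) \<subseteq> ?\<tau>"
      using sub \<phi>' \<phi>n by auto
    moreover have "\<forall>j\<in>insert n S. 0 < t' j" using t \<phi>' \<phi>n n0 a_pos by auto
    moreover have "\<forall>j. j \<notin> insert n S \<longrightarrow> t' j = 0" using t by (auto simp: t'_def)
    moreover have "f = chain_point \<phi>' (insert n S) t'"
    proof
      fix v
      have finS: "finite S" using ch by (simp add: chain_on_def)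
      have "chain_point \<phi>' (insert n S) t' v = (if v \<in> ?\<tau> then a else 0) + chain_point \<phi>' S t' v"
        unfolding chain_point_def using finS nS n0 \<phi>n by simp
      also have "chain_point \<phi>' S t' v = chain_point \<phi> S t v"
        unfolding chain_point_def by (intro sum.cong) (auto simp: \<phi>')
      also have "\<dots> = g v" using g by simp
      finally show "f v = chain_point \<phi>' (insert n S) t' v"
        by (simp add: g_def)
    qed
    ultimately show ?thesis by blast
  qed
qed

text \<open>Each summand spreads \<open>t j\<close> evenly over the \<open>j\<close> elements of
  \<open>\<phi> j\<close>. So normalised coordinates correspond to normalised points.\<close>

lemma sum_chain_point:
  assumes ch: "chain_on S \<phi>" and \<tau>: "finite \<tau>" "\<Union>(\<phi> ` S) \<subseteq> \<tau>"
  shows "sum (chain_point \<phi> S t) \<tau> = sum t S"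
proof -
  have "sum (chain_point \<phi> S t) \<tau> = (\<Sum>j\<in>S. \<Sum>v\<in>\<tau>. if v \<in> \<phi> j then t j / real j else 0)"
    unfolding chain_point_def by (rule sum.swap)
  also have "\<dots> = (\<Sum>j\<in>S. t j)"
  proof (rule sum.cong)
    fix j assume j: "j \<in> S"
    have "(\<Sum>v\<in>\<tau>. if v \<in> \<phi> j then t j / real j else 0) = (\<Sum>v\<in>\<tau> \<inter> \<phi> j. t j / real j)"
      by (rule sum.inter_restrict[OF \<tau>(1), symmetric])
    also have "\<tau> \<inter> \<phi> j = \<phi> j" using \<tau>(2) j by auto
    finally show "(\<Sum>v\<in>\<tau>. if v \<in> \<phi> j then t j / real j else 0) = t j"
      using ch j by (simp add: chain_on_def)
  qed simp
  finally show ?thesis .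
qed

lemma continuous_on_chain_point: "continuous_on A (chain_point \<phi> S)"
  unfolding chain_point_def
proof (rule continuous_on_coordinatewise_then_product)
  fix v
  have "continuous_on A (\<lambda>t. if v \<in> \<phi> j then t j / real j else 0)" if "j \<in> S" for j
    by (cases "v \<in> \<phi> j"; cases "j = 0") (auto simp: divide_inverse intro!: continuous_intros continuous_on_apply)
  then show "continuous_on A (\<lambda>t. \<Sum>j\<in>S. if v \<in> \<phi> j then t j / real j else 0)"
    by (intro continuous_on_sum) auto
qed

section \<open>Flags and the topology of the realization\<close>

definition flag :: "'v set set \<Rightarrow> nat set \<Rightarrow> (nat \<Rightarrow> 'v set) \<Rightarrow> bool" where
  "flag K S \<phi> \<longleftrightarrow> chain_on S \<phi> \<and> S \<noteq> {} \<and> \<phi> ` S \<subseteq> K"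

lemma flag_subset: "flag K S \<phi> \<Longrightarrow> S' \<subseteq> S \<Longrightarrow> S' \<noteq> {} \<Longrightarrow> flag K S' \<phi>"
  unfolding flag_def using chain_on_subset by blast

text \<open>Passing to the support of \<open>t\<close> puts a point of a closed cell into the
  interior of a face, where the results for positive coordinates apply.\<close>

lemma flag_face:
  assumes fl: "flag K S \<phi>" and t: "t \<in> coord_simplex S"
  defines "S' \<equiv> {j. t j \<noteq> 0}"
  shows "flag K S' \<phi>" "S' \<subseteq> S" "t \<in> coord_simplex S'" "\<And>j. j \<in> S' \<Longrightarrow> 0 < t j"
    "chain_point \<phi> S t = chain_point \<phi> S' t"
proof -
  have fin: "finite S" using fl by (simp add: flag_def chain_on_def)
  show sub: "S' \<subseteq> S" using t by (auto simp: S'_def coord_simplex_def)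
  have "S' \<noteq> {}"
  proof
    assume "S' = {}"
    then have "sum t S = 0" by (simp add: S'_def)
    then show False using t by (simp add: coord_simplex_def)
  qed
  then show "flag K S' \<phi>" using flag_subset[OF fl sub] by simp
  show "t \<in> coord_simplex S'"
    by (rule coord_simplex_face[OF fin t _ sub]) (simp add: S'_def)
  show "0 < t j" if "j \<in> S'" for j
    using that t by (auto simp: S'_def coord_simplex_def less_le)
  show "chain_point \<phi> S t = chain_point \<phi> S' t"
    by (rule chain_point_subset[OF fin sub]) (simp add: S'_def)
qed

lemma flag_point_in_closed_simplex:
  assumes K: "abstract_simplicial_complex K" and fl: "flag K S \<phi>" and t: "t \<in> coord_simplex S"
    and \<sigma>: "\<Union>(\<phi> ` S) \<subseteq> \<sigma>"
  shows "chain_point \<phi> S t \<in> closed_simplex K \<sigma>"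
proof -
  let ?S = "{j. t j \<noteq> 0}"
  note f = flag_face[OF fl t]
  have ch: "chain_on ?S \<phi>" and ne: "?S \<noteq> {}" and inK: "\<phi> ` ?S \<subseteq> K" using f(1) by (auto simp: flag_def)
  have U: "\<Union>(\<phi> ` ?S) = \<phi> (Max ?S)" by (rule chain_on_Union[OF ch ne])
  have "finite ?S" using ch by (simp add: chain_on_def)
  then have "Max ?S \<in> ?S" using ne by (rule Max_in)
  then have \<tau>K: "\<phi> (Max ?S) \<in> K" using inK by blast
  then have fin: "finite (\<phi> (Max ?S))" using K by (auto simp: abstract_simplicial_complex_def)
  have supp: "{v. chain_point \<phi> S t v \<noteq> 0} = \<phi> (Max ?S)"
  proof -
    have "{v. chain_point \<phi> ?S t v \<noteq> 0} = \<Union>(\<phi> ` ?S)"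
      by (rule chain_point_support[OF ch]) (rule f(4))
    then show ?thesis using U f(5) by simp
  qed
  have "sum (chain_point \<phi> S t) (\<phi> (Max ?S)) = 1"
    using sum_chain_point[OF ch fin] U f(3,5) by (simp add: coord_simplex_def)
  moreover have "0 \<le> chain_point \<phi> S t v" for v
    using t by (intro chain_point_nonneg) (simp add: coord_simplex_def)
  moreover have "\<phi> (Max ?S) \<subseteq> \<sigma>" using f(2) \<open>Max ?S \<in> ?S\<close> \<sigma> by blast
  ultimately show ?thesis
    using supp \<tau>K by (simp add: closed_simplex_def realization_set_def)
qed

lemma flag_point_in_realization:
  assumes "abstract_simplicial_complex K" "flag K S \<phi>" "t \<in> coord_simplex S"
  shows "chain_point \<phi> S t \<in> realization_set K"
  using flag_point_in_closed_simplex[OF assms order_refl] by (simp add: closed_simplex_def)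

lemma realization_flag_exists:
  assumes K: "abstract_simplicial_complex K" and f: "f \<in> realization_set K"
  obtains S \<phi> t where "flag K S \<phi>" "\<Union>(\<phi> ` S) \<subseteq> {v. f v \<noteq> 0}" "t \<in> coord_simplex S"
    "f = chain_point \<phi> S t"
proof -
  let ?\<tau> = "{v. f v \<noteq> 0}"
  have \<tau>: "?\<tau> \<in> K" using f by (simp add: realization_set_def)
  then have fin: "finite ?\<tau>" using K by (auto simp: abstract_simplicial_complex_def)
  have "\<sigma> \<in> K" if "\<sigma> \<subseteq> ?\<tau>" "\<sigma> \<noteq> {}" for \<sigma>
    using K \<tau> that unfolding abstract_simplicial_complex_def by blast
  moreover have "0 \<le> f v" for v using f by (simp add: realization_set_def)
  ultimately obtain S \<phi> t where ch: "chain_on S \<phi>" "\<phi> ` S \<subseteq> K" "\<Union>(\<phi> ` S) \<subseteq> ?\<tau>"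
     and t: "\<forall>j\<in>S. 0 < t j" "\<forall>j. j \<notin> S \<longrightarrow> t j = 0" and eq: "f = chain_point \<phi> S t"
    using chain_point_exists[OF fin, of K] by blast
  have "sum f ?\<tau> = 1" using f by (simp add: realization_set_def)
  then have "sum t S = 1" using sum_chain_point[OF ch(1) fin ch(3), of t] eq by simp
  moreover have "0 \<le> t j" for j using t by (cases "j \<in> S") (auto simp: less_imp_le)
  ultimately have "t \<in> coord_simplex S" using t(2) by (simp add: coord_simplex_def)
  moreover have "flag K S \<phi>" using ch \<open>sum t S = 1\<close> by (auto simp: flag_def)
  ultimately show thesis using that ch(3) eq by blast
qed

text \<open>Well defined although a point may lie in several cells: these share the face spanned by
  its support. As coordinates are indexed by labels, one function serves the whole realization and,
  after \<open>q\<close>, the covering.\<close>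

definition flag_coords :: "'v set set \<Rightarrow> ('v \<Rightarrow> real) \<Rightarrow> nat \<Rightarrow> real" where
  "flag_coords K f = (THE t. \<exists>S \<phi>. flag K S \<phi> \<and> t \<in> coord_simplex S \<and> f = chain_point \<phi> S t)"

lemma flag_point_unique:
  assumes fl: "flag K S \<phi>" "flag K S' \<phi>'" and t: "t \<in> coord_simplex S" "t' \<in> coord_simplex S'"
    and eq: "chain_point \<phi> S t = chain_point \<phi>' S' t'"
  shows "t = t'" "\<And>j. t j \<noteq> 0 \<Longrightarrow> \<phi> j = \<phi>' j"
proof -
  note f = flag_face[OF fl(1) t(1)] and f' = flag_face[OF fl(2) t(2)]
  have u: "{j. t j \<noteq> 0} = {j. t' j \<noteq> 0} \<and> (\<forall>j\<in>{j. t j \<noteq> 0}. \<phi> j = \<phi>' j \<and> t j = t' j)"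
    using f f' eq by (intro chain_point_unique) (auto simp: flag_def)
  have "t j = t' j" for j
  proof (cases "t j = 0")
    case True
    then have "j \<notin> {j. t' j \<noteq> 0}" using u by blast
    with True show ?thesis by simp
  qed (use u in blast)
  then show "t = t'" by (rule ext)
  show "\<phi> j = \<phi>' j" if "t j \<noteq> 0" for j using u that by blast
qed

lemma flag_coords_eq:
  assumes "flag K S \<phi>" "t \<in> coord_simplex S"
  shows "flag_coords K (chain_point \<phi> S t) = t"
  unfolding flag_coords_def
proof (rule the_equality)
  show "\<exists>S' \<phi>'. flag K S' \<phi>' \<and> t \<in> coord_simplex S' \<and> chain_point \<phi> S t = chain_point \<phi>' S' t"
    using assms by blast
  fix t' assume "\<exists>S' \<phi>'. flag K S' \<phi>' \<and> t' \<in> coord_simplex S' \<and> chain_point \<phi> S t = chain_point \<phi>' S' t'"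
  then show "t' = t" using flag_point_unique(1)[OF assms(1) _ assms(2)] by metis
qed

lemma openin_realization:
  "openin (realization K) U \<longleftrightarrow> U \<subseteq> realization_set K \<and>
      (\<forall>\<sigma>\<in>K. openin (top_of_set (closed_simplex K \<sigma>)) (U \<inter> closed_simplex K \<sigma>))"
proof -
  have "istopology (\<lambda>U. U \<subseteq> realization_set K \<and>
      (\<forall>\<sigma>\<in>K. openin (top_of_set (closed_simplex K \<sigma>)) (U \<inter> closed_simplex K \<sigma>)))"
    unfolding istopology_def
  proof (intro conjI allI impI ballI; (elim conjE)?)
    fix S T \<sigma> assume "\<sigma> \<in> K"
      "\<forall>\<sigma>\<in>K. openin (top_of_set (closed_simplex K \<sigma>)) (S \<inter> closed_simplex K \<sigma>)"
      "\<forall>\<sigma>\<in>K. openin (top_of_set (closed_simplex K \<sigma>)) (T \<inter> closed_simplex K \<sigma>)"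
    then have "openin (top_of_set (closed_simplex K \<sigma>)) (S \<inter> closed_simplex K \<sigma>)"
      "openin (top_of_set (closed_simplex K \<sigma>)) (T \<inter> closed_simplex K \<sigma>)" by blast+
    then have "openin (top_of_set (closed_simplex K \<sigma>)) ((S \<inter> closed_simplex K \<sigma>) \<inter> (T \<inter> closed_simplex K \<sigma>))"
      by (rule openin_Int)
    moreover have "(S \<inter> closed_simplex K \<sigma>) \<inter> (T \<inter> closed_simplex K \<sigma>) = S \<inter> T \<inter> closed_simplex K \<sigma>"
      by blast
    ultimately show "openin (top_of_set (closed_simplex K \<sigma>)) (S \<inter> T \<inter> closed_simplex K \<sigma>)"
      by (simp only:)
  next
    fix \<K> \<sigma> assume \<K>: "\<forall>U\<in>\<K>. U \<subseteq> realization_set K \<and>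
      (\<forall>\<sigma>\<in>K. openin (top_of_set (closed_simplex K \<sigma>)) (U \<inter> closed_simplex K \<sigma>))" and "\<sigma> \<in> K"
    have "openin (top_of_set (closed_simplex K \<sigma>)) (\<Union>((\<lambda>U. U \<inter> closed_simplex K \<sigma>) ` \<K>))"
      using \<K> \<open>\<sigma> \<in> K\<close> by (intro openin_Union) auto
    moreover have "\<Union>((\<lambda>U. U \<inter> closed_simplex K \<sigma>) ` \<K>) = \<Union>\<K> \<inter> closed_simplex K \<sigma>" by auto
    ultimately show "openin (top_of_set (closed_simplex K \<sigma>)) (\<Union>\<K> \<inter> closed_simplex K \<sigma>)" by simp
  qed auto
  then show ?thesis
    by (simp add: realization_def euclidean_product_topology)
qed

lemma topspace_realization [simp]: "topspace (realization K) = realization_set K"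
proof -
  have "realization_set K \<inter> closed_simplex K \<sigma> = closed_simplex K \<sigma>" for \<sigma>
    by (auto simp: closed_simplex_def)
  then have "openin (realization K) (realization_set K)"
    by (auto simp: openin_realization)
  then show ?thesis
    by (meson openin_realization openin_subset openin_topspace subset_antisym)
qed

text \<open>The image lies in the closed simplex of the largest set of the flag, where the weak
  topology is the Euclidean one.\<close>

lemma continuous_map_flag_point:
  assumes K: "abstract_simplicial_complex K" and fl: "flag K S \<phi>"
  shows "continuous_map (top_of_set (coord_simplex S)) (realization K) (chain_point \<phi> S)"
  unfolding continuous_map_def
proof (intro conjI allI impI)
  show "chain_point \<phi> S \<in> topspace (top_of_set (coord_simplex S)) \<rightarrow> topspace (realization K)"
    using flag_point_in_realization[OF K fl] by auto
  fix U assume U: "openin (realization K) U"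
  let ?\<sigma> = "\<phi> (Max S)"
  have ch: "chain_on S \<phi>" "S \<noteq> {}" "\<phi> ` S \<subseteq> K" using fl by (auto simp: flag_def)
  have "finite S" using ch by (simp add: chain_on_def)
  then have \<sigma>: "?\<sigma> \<in> K" using ch Max_in by blast
  have in\<sigma>: "chain_point \<phi> S t \<in> closed_simplex K ?\<sigma>" if "t \<in> coord_simplex S" for t
    using flag_point_in_closed_simplex[OF K fl that] chain_on_Union[OF ch(1,2)] by simp
  have "openin (top_of_set (closed_simplex K ?\<sigma>)) (U \<inter> closed_simplex K ?\<sigma>)"
    using U \<sigma> by (simp add: openin_realization)
  then obtain O' where O': "open O'" "U \<inter> closed_simplex K ?\<sigma> = closed_simplex K ?\<sigma> \<inter> O'"
    by (auto simp: openin_open)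
  have "{t \<in> coord_simplex S. chain_point \<phi> S t \<in> U} = coord_simplex S \<inter> chain_point \<phi> S -` O'"
    using in\<sigma> O'(2) by blast
  moreover have "openin (top_of_set (coord_simplex S)) (coord_simplex S \<inter> chain_point \<phi> S -` O')"
    by (rule continuous_openin_preimage_gen[OF continuous_on_chain_point O'(1)])
  ultimately show "openin (top_of_set (coord_simplex S)) {t \<in> topspace (top_of_set (coord_simplex S)). chain_point \<phi> S t \<in> U}"
    by simp
qed

lemma compact_coord_simplex:
  assumes "finite S" shows "compact (coord_simplex S)"
proof (cases "S = {}")
  case False
  obtain n r where r: "continuous_on (unit_box n) r" "r \<in> unit_box n \<rightarrow> coord_simplex S"
    "coord_simplex S \<subseteq> unit_box n" "\<And>x. x \<in> coord_simplex S \<Longrightarrow> r x = x"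
    using cube_retract_unit_box[OF cube_retract_coord_simplex[OF assms False]] by blast
  have box: "unit_box n = PiE UNIV (\<lambda>i. if i < n then {0..1} else {0})"
    by (auto simp: unit_box_def PiE_iff split: if_splits)
  have "compactin (powertop_real UNIV) (unit_box n)"
    unfolding box by (subst compactin_PiE) simp
  then have "compact (unit_box n)"
    by (simp add: euclidean_product_topology)
  moreover have "r ` unit_box n = coord_simplex S"
    using r(2,3,4) by (auto simp: subset_iff image_iff) metis
  ultimately show ?thesis
    using compact_continuous_image[OF r(1)] by simp
qed simp

lemma compact_imp_closed_fun:
  fixes A :: "('v \<Rightarrow> real) set" assumes "compact A" shows "closed A"
proof -
  have "Hausdorff_space (powertop_real (UNIV :: 'v set))"
    by (simp add: Hausdorff_space_product_topology)
  moreover have "compactin (powertop_real UNIV) A"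
    using assms by (simp add: euclidean_product_topology)
  ultimately have "closedin (powertop_real UNIV) A"
    by (rule compactin_imp_closedin)
  then show ?thesis by (simp add: euclidean_product_topology)
qed

text \<open>The weak topology is also coherent with the subdivision: a closed simplex is covered by
  finitely many cells of flags, and in each the points outside \<open>W\<close> form a compact,
  hence closed, set.\<close>

lemma openin_realization_flags:
  assumes K: "abstract_simplicial_complex K" and W: "W \<subseteq> realization_set K"
    and op: "\<And>S \<phi>. flag K S \<phi> \<Longrightarrow>
        openin (top_of_set (coord_simplex S)) {t \<in> coord_simplex S. chain_point \<phi> S t \<in> W}"
  shows "openin (realization K) W"
  unfolding openin_realization
proof (intro conjI ballI W)
  fix \<sigma> assume "\<sigma> \<in> K"
  then have fin: "finite \<sigma>" using K by (auto simp: abstract_simplicial_complex_def)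
  let ?c = "closed_simplex K \<sigma>"
  \<comment> \<open>Requiring \<open>\<phi>\<close> to be extensional leaves only finitely many
    flags inside \<sigma>.\<close>
  define Fl where "Fl = {(S, \<phi>). flag K S \<phi> \<and> \<Union>(\<phi> ` S) \<subseteq> \<sigma> \<and> \<phi> \<in> extensional S}"
  have "Fl \<subseteq> (SIGMA S:Pow {..card \<sigma>}. PiE S (\<lambda>_. Pow \<sigma>))"
  proof
    fix F assume "F \<in> Fl"
    then obtain S \<phi> where F: "F = (S, \<phi>)" "flag K S \<phi>" "\<Union>(\<phi> ` S) \<subseteq> \<sigma>" "\<phi> \<in> extensional S"
      by (auto simp: Fl_def)
    have "j \<le> card \<sigma>" if "j \<in> S" for j
    proof -
      have "j = card (\<phi> j)" using F(2) that by (simp add: flag_def chain_on_def)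
      also have "\<dots> \<le> card \<sigma>" using F(3) that fin by (intro card_mono) auto
      finally show ?thesis .
    qed
    then show "F \<in> (SIGMA S:Pow {..card \<sigma>}. PiE S (\<lambda>_. Pow \<sigma>))"
      using F by (auto simp: PiE_iff)
  qed
  moreover have "finite (SIGMA S:Pow {..card \<sigma>}. PiE S (\<lambda>_. Pow \<sigma>))"
    using fin by (intro finite_SigmaI finite_PiE) (auto intro: finite_subset)
  ultimately have finFl: "finite Fl" by (rule finite_subset)
  define Z where "Z F = (case F of (S, \<phi>) \<Rightarrow> chain_point \<phi> S ` {t \<in> coord_simplex S. chain_point \<phi> S t \<notin> W})" for F
  have "closed (Z F)" if FFl: "F \<in> Fl" for F
  proof -
    obtain S \<phi> where F: "F = (S, \<phi>)" "flag K S \<phi>" using FFl by (auto simp: Fl_def)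
    have finS: "finite S" using F(2) by (simp add: flag_def chain_on_def)
    have "{t \<in> coord_simplex S. chain_point \<phi> S t \<notin> W} = coord_simplex S - {t \<in> coord_simplex S. chain_point \<phi> S t \<in> W}"
      by auto
    then have "closedin (top_of_set (coord_simplex S)) {t \<in> coord_simplex S. chain_point \<phi> S t \<notin> W}"
      using op[OF F(2)] by (auto simp: closedin_def Diff_Diff_Int Int_absorb1)
    then have "compact {t \<in> coord_simplex S. chain_point \<phi> S t \<notin> W}"
      using compact_coord_simplex[OF finS] closedin_compact by blast
    then have "compact (Z F)"
      unfolding Z_def F by (simp add: compact_continuous_image[OF continuous_on_chain_point])
    then show ?thesis by (rule compact_imp_closed_fun)
  qed
  then have "closed (\<Union>F\<in>Fl. Z F)" using finFl by (intro closed_UN) auto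
  moreover have "W \<inter> ?c = ?c - (\<Union>F\<in>Fl. Z F)"
  proof
    show "W \<inter> ?c \<subseteq> ?c - (\<Union>F\<in>Fl. Z F)" by (auto simp: Z_def)
    show "?c - (\<Union>F\<in>Fl. Z F) \<subseteq> W \<inter> ?c"
    proof
      fix f assume f: "f \<in> ?c - (\<Union>F\<in>Fl. Z F)"
      then have fr: "f \<in> realization_set K" and f\<sigma>: "{v. f v \<noteq> 0} \<subseteq> \<sigma>" by (auto simp: closed_simplex_def)
      obtain S \<phi> t where fl: "flag K S \<phi>" "\<Union>(\<phi> ` S) \<subseteq> {v. f v \<noteq> 0}" "t \<in> coord_simplex S" "f = chain_point \<phi> S t"
        using realization_flag_exists[OF K fr] by blast
      let ?\<phi> = "restrict \<phi> S"
      have fl': "flag K S ?\<phi>" using fl(1) by (auto simp: flag_def chain_on_def)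
      have eq: "chain_point ?\<phi> S = chain_point \<phi> S"
        unfolding chain_point_def by (intro ext sum.cong) auto
      have "(S, ?\<phi>) \<in> Fl" using fl' fl(2) f\<sigma> by (auto simp: Fl_def)
      then have "f \<notin> Z (S, ?\<phi>)" using f by blast
      then show "f \<in> W \<inter> ?c" using fl(3,4) f by (auto simp: Z_def eq)
    qed
  qed
  ultimately show "openin (top_of_set ?c) (W \<inter> ?c)"
    by (metis Diff_eq open_closed openin_open_Int open_Compl)
qed

text \<open>The cells of the subdivision lifted to the covering. Extensionality makes two cells
  equal once they agree on the simplex. The flag may stay hidden, since an interior point determines
  it on \<open>S\<close>.\<close>

definition flag_cells ::
  "'v set set \<Rightarrow> 'b topology \<Rightarrow> ('b \<Rightarrow> 'v \<Rightarrow> real) \<Rightarrow> nat set \<Rightarrow> ((nat \<Rightarrow> real) \<Rightarrow> 'b) set" where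
  "flag_cells K Y q S = {\<kappa> \<in> extensional (coord_simplex S).
     continuous_map (top_of_set (coord_simplex S)) Y \<kappa> \<and>
     (\<exists>\<phi>. flag K S \<phi> \<and> (\<forall>t\<in>coord_simplex S. q (\<kappa> t) = chain_point \<phi> S t))}"

lemma flag_cellsE:
  assumes "\<kappa> \<in> flag_cells K Y q S"
  obtains \<phi> where "\<kappa> \<in> extensional (coord_simplex S)" "continuous_map (top_of_set (coord_simplex S)) Y \<kappa>"
    "flag K S \<phi>" "\<And>t. t \<in> coord_simplex S \<Longrightarrow> q (\<kappa> t) = chain_point \<phi> S t"
  using assms unfolding flag_cells_def by blast

lemma flag_cells_coords:
  assumes "\<kappa> \<in> flag_cells K Y q S" "t \<in> coord_simplex S"
  shows "flag_coords K (q (\<kappa> t)) = t"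
  using assms flag_coords_eq by (metis flag_cellsE)

lemma flag_cells_face:
  assumes \<kappa>: "\<kappa> \<in> flag_cells K Y q S" and S': "S' \<subseteq> S" "S' \<noteq> {}"
  shows "restrict \<kappa> (coord_simplex S') \<in> flag_cells K Y q S'"
proof -
  obtain \<phi> where \<phi>: "\<kappa> \<in> extensional (coord_simplex S)" "continuous_map (top_of_set (coord_simplex S)) Y \<kappa>"
    "flag K S \<phi>" "\<And>t. t \<in> coord_simplex S \<Longrightarrow> q (\<kappa> t) = chain_point \<phi> S t"
    using flag_cellsE[OF \<kappa>] by blast
  have fin: "finite S" using \<phi>(3) by (simp add: flag_def chain_on_def)
  have sub: "coord_simplex S' \<subseteq> coord_simplex S" by (rule coord_simplex_mono[OF fin S'(1)])
  have "continuous_map (top_of_set (coord_simplex S')) Y (restrict \<kappa> (coord_simplex S'))"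
    by (rule continuous_map_top_of_set_eq[OF continuous_map_top_of_set_subset[OF \<phi>(2) sub]]) simp
  moreover have "q (restrict \<kappa> (coord_simplex S') t) = chain_point \<phi> S' t" if t: "t \<in> coord_simplex S'" for t
  proof -
    have "chain_point \<phi> S t = chain_point \<phi> S' t"
      by (rule chain_point_subset[OF fin S'(1)]) (use t in \<open>auto simp: coord_simplex_def\<close>)
    then show ?thesis using \<phi>(4) sub t by auto
  qed
  ultimately show ?thesis
    using flag_subset[OF \<phi>(3) S'] by (auto simp: flag_cells_def)
qed

text \<open>The image of a common interior point forces both flags to coincide on \<open>S\<close>,
  so both cells lift the same map; lifts of a connected simplex that meet are equal.\<close>

lemma flag_cells_unique:
  assumes cov: "covering_map Y X q" and \<kappa>: "\<kappa> \<in> flag_cells K Y q S" "\<kappa>' \<in> flag_cells K Y q S"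
    and t: "t \<in> coord_simplex S" "t \<notin> coord_faces S" "\<kappa> t = \<kappa>' t"
  shows "\<kappa> = \<kappa>'"
proof -
  obtain \<phi> where \<phi>: "\<kappa> \<in> extensional (coord_simplex S)" "continuous_map (top_of_set (coord_simplex S)) Y \<kappa>"
    "flag K S \<phi>" "\<And>t. t \<in> coord_simplex S \<Longrightarrow> q (\<kappa> t) = chain_point \<phi> S t"
    using flag_cellsE[OF \<kappa>(1)] by blast
  obtain \<phi>' where \<phi>': "\<kappa>' \<in> extensional (coord_simplex S)" "continuous_map (top_of_set (coord_simplex S)) Y \<kappa>'"
    "flag K S \<phi>'" "\<And>t. t \<in> coord_simplex S \<Longrightarrow> q (\<kappa>' t) = chain_point \<phi>' S t"
    using flag_cellsE[OF \<kappa>(2)] by blast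
  have S: "finite S" "S \<noteq> {}" using \<phi>(3) by (auto simp: flag_def chain_on_def)
  have "chain_point \<phi> S t = chain_point \<phi>' S t"
    using \<phi>(4)[OF t(1)] \<phi>'(4)[OF t(1)] t(3) by simp
  then have "\<phi> j = \<phi>' j" if "j \<in> S" for j
    using flag_point_unique(2)[OF \<phi>(3) \<phi>'(3) t(1,1)] t(2) that by (auto simp: coord_faces_def)
  then have eq: "chain_point \<phi> S = chain_point \<phi>' S"
    unfolding chain_point_def by (intro ext sum.cong) auto
  have "connected_space (top_of_set (coord_simplex S))"
    by (rule path_connected_imp_connected_space[OF cube_retract_path_connected[OF cube_retract_coord_simplex[OF S]]])
  then have "\<kappa> u = \<kappa>' u" if "u \<in> coord_simplex S" for u
    by (rule covering_map_lift_unique[OF cov _ \<phi>(2) \<phi>'(2), of t]) (use \<phi>(4) \<phi>'(4) eq t that in auto)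
  then show ?thesis by (rule extensionalityI[OF \<phi>(1) \<phi>'(1)])
qed

lemma flag_cells_through:
  assumes K: "abstract_simplicial_complex K" and cov: "covering_map Y (realization K) q"
    and fl: "flag K S \<phi>" and t: "t \<in> coord_simplex S" and y: "y \<in> topspace Y" "q y = chain_point \<phi> S t"
  obtains \<kappa> where "\<kappa> \<in> flag_cells K Y q S" "\<kappa> t = y" "\<And>u. u \<in> coord_simplex S \<Longrightarrow> q (\<kappa> u) = chain_point \<phi> S u"
proof -
  have S: "finite S" "S \<noteq> {}" using fl by (auto simp: flag_def chain_on_def)
  have L: "has_lifts Y q (chain_point \<phi> S) (coord_simplex S)"
    by (rule has_lifts_cube_retract[OF cov cube_retract_coord_simplex[OF S] continuous_map_flag_point[OF K fl]])
  obtain \<kappa> where \<kappa>: "continuous_map (top_of_set (coord_simplex S)) Y \<kappa>"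
    "\<And>u. u \<in> coord_simplex S \<Longrightarrow> q (\<kappa> u) = chain_point \<phi> S u" "\<kappa> t = y"
    using has_liftsE[where f = "chain_point \<phi> S" and q = q and b = t and y = y, OF L t y] by blast
  let ?\<kappa> = "restrict \<kappa> (coord_simplex S)"
  have "continuous_map (top_of_set (coord_simplex S)) Y ?\<kappa>"
    by (rule continuous_map_top_of_set_eq[OF \<kappa>(1)]) simp
  then have "?\<kappa> \<in> flag_cells K Y q S"
    using fl \<kappa>(2) by (auto simp: flag_cells_def)
  then show thesis using that[of ?\<kappa>] \<kappa> t by simp
qed

lemma flag_cells_cover:
  assumes K: "abstract_simplicial_complex K" and cov: "covering_map Y (realization K) q"
    and y: "y \<in> topspace Y"
  obtains S \<kappa> t where "\<kappa> \<in> flag_cells K Y q S" "t \<in> coord_simplex S" "\<kappa> t = y"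
proof -
  have "q y \<in> realization_set K"
    using cov y unfolding covering_map_def by auto
  then obtain S \<phi> t where fl: "flag K S \<phi>" "t \<in> coord_simplex S" "q y = chain_point \<phi> S t"
    using realization_flag_exists[OF K] by metis
  then show thesis using flag_cells_through[OF K cov fl(1,2) y fl(3)] that by blast
qed

text \<open>The covering has the topology coherent with its cells. On a sheet, where
  \<open>q\<close> is injective, openness is tested on the image in the realization, and there on
  flags; each flag is lifted through the point in question, where the assumption applies.\<close>

lemma openin_by_flag_cells:
  assumes K: "abstract_simplicial_complex K" and cov: "covering_map Y (realization K) q"
    and W: "W \<subseteq> topspace Y"
    and op: "\<And>S \<kappa>. \<kappa> \<in> flag_cells K Y q S \<Longrightarrow>
        openin (top_of_set (coord_simplex S)) {t \<in> coord_simplex S. \<kappa> t \<in> W}"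
  shows "openin Y W"
proof (subst openin_subopen, intro ballI)
  fix y assume y: "y \<in> W"
  then have "y \<in> topspace Y" using W by blast
  then obtain V where V: "openin Y V" "y \<in> V" "inj_on q V"
    by (rule covering_map_injective_sheet[OF cov])
  have contq: "continuous_map Y (realization K) q" using cov by (simp add: covering_map_def)
  have "openin (realization K) (q ` (W \<inter> V))"
  proof (rule openin_realization_flags[OF K])
    show "q ` (W \<inter> V) \<subseteq> realization_set K"
      using contq W by (auto simp: continuous_map_def)
    fix S \<phi> assume fl: "flag K S \<phi>"
    show "openin (top_of_set (coord_simplex S)) {t \<in> coord_simplex S. chain_point \<phi> S t \<in> q ` (W \<inter> V)}"
    proof (subst openin_subopen, intro ballI)
      fix t assume "t \<in> {t \<in> coord_simplex S. chain_point \<phi> S t \<in> q ` (W \<inter> V)}"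
      then obtain z where t: "t \<in> coord_simplex S" and z: "z \<in> W" "z \<in> V" "q z = chain_point \<phi> S t" by auto
      have "z \<in> topspace Y" using z W by blast
      then obtain \<kappa> where \<kappa>: "\<kappa> \<in> flag_cells K Y q S" "\<kappa> t = z"
        "\<And>u. u \<in> coord_simplex S \<Longrightarrow> q (\<kappa> u) = chain_point \<phi> S u"
        using flag_cells_through[OF K cov fl t _ z(3)] by blast
      have "continuous_map (top_of_set (coord_simplex S)) Y \<kappa>"
        using \<kappa>(1) by (simp add: flag_cells_def)
      from openin_continuous_map_preimage[OF this V(1)]
      have "openin (top_of_set (coord_simplex S)) ({u \<in> coord_simplex S. \<kappa> u \<in> W} \<inter> {u \<in> coord_simplex S. \<kappa> u \<in> V})"
        using op[OF \<kappa>(1)] by (intro openin_Int) auto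
      moreover have "{u \<in> coord_simplex S. \<kappa> u \<in> W} \<inter> {u \<in> coord_simplex S. \<kappa> u \<in> V} \<subseteq>
          {t \<in> coord_simplex S. chain_point \<phi> S t \<in> q ` (W \<inter> V)}"
      proof
        fix u assume u: "u \<in> {u \<in> coord_simplex S. \<kappa> u \<in> W} \<inter> {u \<in> coord_simplex S. \<kappa> u \<in> V}"
        then have "chain_point \<phi> S u = q (\<kappa> u)" using \<kappa>(3)[of u] by simp
        then show "u \<in> {t \<in> coord_simplex S. chain_point \<phi> S t \<in> q ` (W \<inter> V)}"
          using u by blast
      qed
      moreover have "t \<in> {u \<in> coord_simplex S. \<kappa> u \<in> W} \<inter> {u \<in> coord_simplex S. \<kappa> u \<in> V}"
        using t z \<kappa>(2) by auto
      ultimately show "\<exists>T. openin (top_of_set (coord_simplex S)) T \<and> t \<in> T \<and>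
          T \<subseteq> {t \<in> coord_simplex S. chain_point \<phi> S t \<in> q ` (W \<inter> V)}" by blast
    qed
  qed
  then have "openin Y (V \<inter> {z \<in> topspace Y. q z \<in> q ` (W \<inter> V)})"
    using openin_continuous_map_preimage[OF contq] V(1) by blast
  moreover have "V \<inter> {z \<in> topspace Y. q z \<in> q ` (W \<inter> V)} \<subseteq> W"
    using V(3) by (auto simp: inj_on_def)
  moreover have "y \<in> V \<inter> {z \<in> topspace Y. q z \<in> q ` (W \<inter> V)}"
    using y V(2) \<open>y \<in> topspace Y\<close> by blast
  ultimately show "\<exists>T. openin Y T \<and> y \<in> T \<and> T \<subseteq> W" by blast
qed

lemma flag_cell_path_component:
  assumes \<kappa>: "\<kappa> \<in> flag_cells K Y q S" and t: "t \<in> coord_simplex S" "u \<in> coord_simplex S"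
  shows "path_component_of Y (\<kappa> t) (\<kappa> u)"
proof -
  obtain \<phi> where \<phi>: "continuous_map (top_of_set (coord_simplex S)) Y \<kappa>" "flag K S \<phi>"
    using flag_cellsE[OF \<kappa>] by blast
  have S: "finite S" "S \<noteq> {}" using \<phi>(2) by (auto simp: flag_def chain_on_def)
  have "path_connected_space (top_of_set (coord_simplex S))"
    by (rule cube_retract_path_connected[OF cube_retract_coord_simplex[OF S]])
  then obtain g where g: "pathin (top_of_set (coord_simplex S)) g" "g 0 = t" "g 1 = u"
    using t unfolding path_connected_space_def by auto
  then have "pathin Y (\<kappa> \<circ> g)" using \<phi>(1) by (intro pathin_compose)
  then show ?thesis using g unfolding path_component_of_def by auto
qed

text \<open>Cells are path-connected, so a path component contains a cell or misses it, and both the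
  component and its complement are open. This connects every lifting problem with the one point
  \<open>b\<close> whose fibre is controlled.\<close>

lemma covering_path_connected:
  assumes K: "abstract_simplicial_complex K" and cov: "covering_map Y (realization K) q"
    and conn: "connected_space Y" and xb: "x \<in> topspace Y" "b \<in> topspace Y"
  shows "path_component_of Y x b"
proof -
  let ?R = "{x \<in> topspace Y. path_component_of Y x b}"
  have inv: "path_component_of Y (\<kappa> t) b \<longleftrightarrow> path_component_of Y (\<kappa> u) b"
    if "\<kappa> \<in> flag_cells K Y q S" "t \<in> coord_simplex S" "u \<in> coord_simplex S" for \<kappa> S t u
    using flag_cell_path_component[OF that] path_component_of_trans path_component_of_sym by metis
  have top: "openin (top_of_set (coord_simplex S)) (coord_simplex S)" for S
    using openin_topspace[of "top_of_set (coord_simplex S)"] by simp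
  have in_Y: "\<kappa> t \<in> topspace Y" if "\<kappa> \<in> flag_cells K Y q S" "t \<in> coord_simplex S" for \<kappa> S t
    using that by (auto simp: flag_cells_def continuous_map_def)
  have "openin Y ?R"
  proof (rule openin_by_flag_cells[OF K cov])
    fix S \<kappa> assume \<kappa>: "\<kappa> \<in> flag_cells K Y q S"
    have "{t \<in> coord_simplex S. \<kappa> t \<in> ?R} = {} \<or> {t \<in> coord_simplex S. \<kappa> t \<in> ?R} = coord_simplex S"
      using inv[OF \<kappa>] in_Y[OF \<kappa>] by blast
    then show "openin (top_of_set (coord_simplex S)) {t \<in> coord_simplex S. \<kappa> t \<in> ?R}"
      by (elim disjE) (simp_all only: openin_empty top)
  qed auto
  moreover have "openin Y (topspace Y - ?R)"
  proof (rule openin_by_flag_cells[OF K cov])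
    fix S \<kappa> assume \<kappa>: "\<kappa> \<in> flag_cells K Y q S"
    have "{t \<in> coord_simplex S. \<kappa> t \<in> topspace Y - ?R} = {} \<or> {t \<in> coord_simplex S. \<kappa> t \<in> topspace Y - ?R} = coord_simplex S"
      using inv[OF \<kappa>] in_Y[OF \<kappa>] by blast
    then show "openin (top_of_set (coord_simplex S)) {t \<in> coord_simplex S. \<kappa> t \<in> topspace Y - ?R}"
      by (elim disjE) (simp_all only: openin_empty top)
  qed auto
  then have "closedin Y ?R" by (auto simp: closedin_def)
  moreover have "b \<in> ?R" using xb by (simp add: path_component_of_refl)
  ultimately have "?R = topspace Y" using conn unfolding connected_space_clopen_in by blast
  then show ?thesis using xb by blast
qed

section \<open>Covering by stars of groups of labels\<close>

text \<open>\<open>U\<close> uses the strict inequality to be open, the truncated cells the weak one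
  to be closed. The section over the truncated cells is restricted to the preimage of
  \<open>U\<close>, where continuity can be checked cell by cell.\<close>

lemma section_over_label_group:
  fixes K :: "'v set set" and Xb :: "'b topology" and E :: "'e topology"
  assumes K: "abstract_simplicial_complex K" and cov: "covering_map Xb (realization K) q"
    and conn: "connected_space Xb" and fib: "fibration E Xb p" and b: "b \<in> topspace Xb"
    and fibre: "n_connected_space (int k - 1) (subtopology E {e \<in> topspace E. p e = b})"
    and bound: "\<And>\<sigma>. \<sigma> \<in> K \<Longrightarrow> card \<sigma> \<le> N"
    and A: "finite A" "card A \<le> k + 1" and \<epsilon>: "0 < \<epsilon>" "\<epsilon> < 1"
  defines "U \<equiv> {x \<in> realization_set K. \<epsilon> < sum (flag_coords K x) A}"
  shows "openin (realization K) U"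
    and "\<exists>s. continuous_map (subtopology Xb {y \<in> topspace Xb. q y \<in> U}) E s \<and>
             (\<forall>y \<in> topspace Xb. q y \<in> U \<longrightarrow> p (s y) = y)"
proof -
  have op: "openin (top_of_set D) (D \<inter> (O' \<inter> {t. \<epsilon> < sum t A}))" if "open O'" for D O' :: "(nat \<Rightarrow> real) set"
    by (intro openin_open_Int open_Int that open_Collect_less continuous_on_const continuous_on_sum continuous_on_apply)
  show U: "openin (realization K) U"
  proof (rule openin_realization_flags[OF K])
    fix S \<phi> assume fl: "flag K S \<phi>"
    have "chain_point \<phi> S t \<in> U \<longleftrightarrow> \<epsilon> < sum t A" if "t \<in> coord_simplex S" for t
      using flag_coords_eq[OF fl that] flag_point_in_realization[OF K fl that] by (simp add: U_def)
    then have "{t \<in> coord_simplex S. chain_point \<phi> S t \<in> U} = coord_simplex S \<inter> (UNIV \<inter> {t. \<epsilon> < sum t A})"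
      by auto
    then show "openin (top_of_set (coord_simplex S)) {t \<in> coord_simplex S. chain_point \<phi> S t \<in> U}"
      using op[OF open_UNIV] by simp
  qed (auto simp: U_def)
  have path: "path_component_of Xb x b" if "x \<in> topspace Xb" for x
    by (rule covering_path_connected[OF K cov conn that b])
  let ?C = "flag_cells K Xb q" and ?P = "trunc_simplex A \<epsilon>"
  \<comment> \<open>Labels are numbers of vertices, so \<open>S\<close> lies between 0 and
    \<open>N\<close>; this crude bound is enough to end the induction over cells.\<close>
  have fin: "finite S \<and> card S \<le> Suc N" "S \<noteq> {}" if \<kappa>: "\<kappa> \<in> ?C S" for S \<kappa>
  proof -
    obtain \<phi> where fl: "flag K S \<phi>" using flag_cellsE[OF \<kappa>] by blast
    have "S \<subseteq> {..N}"
    proof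
      fix j assume "j \<in> S"
      then have "\<phi> j \<in> K" "card (\<phi> j) = j" using fl by (auto simp: flag_def chain_on_def)
      then show "j \<in> {..N}" using bound by force
    qed
    then show "finite S \<and> card S \<le> Suc N"
      using card_mono[of "{..N}" S] finite_subset[of S "{..N}"] by simp
    show "S \<noteq> {}" using fl by (simp add: flag_def)
  qed
  have cont: "continuous_map (top_of_set (coord_simplex S)) Xb \<kappa>" if "\<kappa> \<in> ?C S" for S \<kappa>
    using that by (simp add: flag_cells_def)
  have lift: "relative_lifting E Xb p (?P S) (coord_faces S)" if \<kappa>: "\<kappa> \<in> ?C S" and SA: "S \<inter> A \<noteq> {}" for S \<kappa>
  proof (cases "S \<subseteq> A")
    \<comment> \<open>The truncation is void, as the group carries the full weight 1, and
      \<open>card A \<le> k + 1\<close> bounds the dimension by k.\<close>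
    case True
    have "card S \<le> k + 1" using card_mono[OF A(1) True] A(2) by simp
    then show ?thesis
      using relative_lifting_simplex[OF fib _ fin(2)[OF \<kappa>] _ path fibre] fin(1)[OF \<kappa>]
        trunc_simplex_full[OF A(1) True] \<epsilon> by simp
  next
    case False
    then show ?thesis
      using relative_lifting_trunc_simplex[OF fib _ SA _ A(1) \<epsilon>] fin(1)[OF \<kappa>] by blast
  qed
  have "\<exists>s. \<forall>S. \<forall>\<kappa>\<in>?C S. continuous_map (top_of_set (?P S)) E (\<lambda>t. s (\<kappa> t)) \<and>
    (\<forall>t\<in>?P S. p (s (\<kappa> t)) = \<kappa> t)"
  proof (rule section_by_cells[where T = "\<lambda>y. flag_coords K (q y)" and N = "Suc N" and B = Xb])
    fix S \<kappa> assume \<kappa>: "\<kappa> \<in> ?C S"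
    show "finite S \<and> card S \<le> Suc N" by (rule fin(1)[OF \<kappa>])
    show "continuous_map (top_of_set (coord_simplex S)) Xb \<kappa>" by (rule cont[OF \<kappa>])
    show "flag_coords K (q (\<kappa> t)) = t" if "t \<in> coord_simplex S" for t
      by (rule flag_cells_coords[OF \<kappa> that])
    show "restrict \<kappa> (coord_simplex S') \<in> ?C S'" if "S' \<subseteq> S" "S' \<noteq> {}" for S'
      by (rule flag_cells_face[OF \<kappa> that])
    show "\<kappa> = \<kappa>'" if "\<kappa>' \<in> ?C S" "t \<in> coord_simplex S" "t \<notin> coord_faces S" "\<kappa> t = \<kappa>' t" for \<kappa>' t
      by (rule flag_cells_unique[OF cov \<kappa> that])
    show "relative_lifting E Xb p (?P S) (coord_faces S)" if "S \<inter> A \<noteq> {}"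
      by (rule lift[OF \<kappa> that])
  qed (rule A(1), rule \<epsilon>(1))
  then obtain s where
    s: "\<forall>S. \<forall>\<kappa>\<in>?C S. continuous_map (top_of_set (?P S)) E (\<lambda>t. s (\<kappa> t)) \<and>
      (\<forall>t\<in>?P S. p (s (\<kappa> t)) = \<kappa> t)" by blast
  have cont_s: "continuous_map (top_of_set (?P S)) E (\<lambda>t. s (\<kappa> t))" if "\<kappa> \<in> ?C S" for S \<kappa>
    using s that by simp
  have section_s: "p (s (\<kappa> t)) = \<kappa> t" if "\<kappa> \<in> ?C S" "t \<in> ?P S" for S \<kappa> t
    using s that by simp
  let ?V = "{y \<in> topspace Xb. q y \<in> U}"
  have in_U: "q (\<kappa> t) \<in> U \<longleftrightarrow> \<epsilon> < sum t A" if "\<kappa> \<in> ?C S" "t \<in> coord_simplex S" for \<kappa> S t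
  proof -
    have "\<kappa> t \<in> topspace Xb" using cont[OF that(1)] that(2) by (auto simp: continuous_map_def)
    then have "q (\<kappa> t) \<in> realization_set K" using cov unfolding covering_map_def by auto
    then show ?thesis using flag_cells_coords[OF that] by (simp add: U_def)
  qed
  have inP: "t \<in> ?P S" if "t \<in> coord_simplex S" "\<epsilon> < sum t A" for t S
    using that by (simp add: trunc_simplex_def)
  have ps: "p (s y) = y \<and> s y \<in> topspace E" if y: "y \<in> topspace Xb" "q y \<in> U" for y
  proof -
    obtain S \<kappa> t where \<kappa>: "\<kappa> \<in> ?C S" "t \<in> coord_simplex S" "\<kappa> t = y"
      by (rule flag_cells_cover[OF K cov y(1)])
    have "q (\<kappa> t) \<in> U" using y(2) \<kappa>(3) by simp
    then have "t \<in> ?P S" using in_U[OF \<kappa>(1,2)] inP[OF \<kappa>(2)] by simp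
    then show ?thesis
      using cont_s[OF \<kappa>(1)] section_s[OF \<kappa>(1)] \<kappa>(3) by (auto simp: continuous_map_def)
  qed
  have "continuous_map (subtopology Xb ?V) E s"
    unfolding continuous_map_def
  proof (intro conjI allI impI)
    show "s \<in> topspace (subtopology Xb ?V) \<rightarrow> topspace E" using ps by auto
    fix O1 assume O1: "openin E O1"
    let ?W = "{y \<in> ?V. s y \<in> O1}"
    have "openin Xb ?W"
    proof (rule openin_by_flag_cells[OF K cov])
      fix S \<kappa> assume \<kappa>: "\<kappa> \<in> ?C S"
      have "openin (top_of_set (?P S)) {t \<in> ?P S. s (\<kappa> t) \<in> O1}"
        using openin_continuous_map_preimage[OF cont_s[OF \<kappa>] O1] by simp
      then obtain O' where O': "open O'" "{t \<in> ?P S. s (\<kappa> t) \<in> O1} = ?P S \<inter> O'"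
        by (auto simp: openin_open)
      have in_Xb: "\<kappa> t \<in> topspace Xb" if "t \<in> coord_simplex S" for t
        using cont[OF \<kappa>] that by (auto simp: continuous_map_def)
      have "{t \<in> coord_simplex S. \<kappa> t \<in> ?W} = {t \<in> coord_simplex S. \<epsilon> < sum t A \<and> s (\<kappa> t) \<in> O1}"
        using in_U[OF \<kappa>] in_Xb by blast
      \<comment> \<open>The strict inequality turns relative openness in the closed truncated
        simplex into openness in the simplex.\<close>
      also have "\<dots> = coord_simplex S \<inter> (O' \<inter> {t. \<epsilon> < sum t A})"
        using O'(2) inP[of _ S] by blast
      finally show "openin (top_of_set (coord_simplex S)) {t \<in> coord_simplex S. \<kappa> t \<in> ?W}"
        using op[OF O'(1)] by simp
    qed auto
    then have "openin (subtopology Xb ?V) ?W"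
      by (intro subset_openin_subtopology) auto
    moreover have "{x \<in> topspace (subtopology Xb ?V). s x \<in> O1} = ?W" by auto
    ultimately show "openin (subtopology Xb ?V) {x \<in> topspace (subtopology Xb ?V). s x \<in> O1}" by simp
  qed
  then show "\<exists>s. continuous_map (subtopology Xb ?V) E s \<and> (\<forall>y \<in> topspace Xb. q y \<in> U \<longrightarrow> p (s y) = y)"
    using ps by blast
qed

text \<open>Pigeonhole: the c + 1 groups cover all labels, so weights of at most 1 / (c + 2) each
  would give a total of at most (c + 1) / (c + 2), which is less than 1.\<close>

lemma label_groups:
  fixes t :: "nat \<Rightarrow> real"
  assumes t: "t \<in> coord_simplex S" and S: "S \<subseteq> {1..(c + 1) * (k + 1)}"
  obtains i where "i \<le> c" "1 / (real c + 2) < sum t {i * (k + 1) + 1..(i + 1) * (k + 1)}"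
proof -
  let ?A = "\<lambda>i. {i * (k + 1) + 1..(i + 1) * (k + 1)}"
  have UA: "(\<Union>i\<le>c. ?A i) = {1..(c + 1) * (k + 1)}"
  proof (induction c)
    case (Suc c)
    have "(\<Union>i\<le>Suc c. ?A i) = ?A (Suc c) \<union> (\<Union>i\<le>c. ?A i)" by (simp only: atMost_Suc UN_insert)
    also have "\<dots> = {1..(Suc c + 1) * (k + 1)}" unfolding Suc.IH by auto
    finally show ?case .
  qed simp
  have "sum t S = sum t (\<Union>i\<le>c. ?A i)"
    unfolding UA using S t by (intro sum.mono_neutral_left) (auto simp: coord_simplex_def)
  also have "\<dots> \<le> (\<Sum>i\<le>c. sum t (?A i))"
  proof (induction c)
    case (Suc c)
    have "sum t (\<Union>i\<le>Suc c. ?A i) = sum t (?A (Suc c) \<union> (\<Union>i\<le>c. ?A i))"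
      by (simp only: atMost_Suc UN_insert)
    also have "\<dots> \<le> sum t (?A (Suc c)) + sum t (\<Union>i\<le>c. ?A i)"
    proof -
      have "0 \<le> sum t (?A (Suc c) \<inter> (\<Union>i\<le>c. ?A i))"
        using t by (intro sum_nonneg) (auto simp: coord_simplex_def)
      then show ?thesis by (subst sum_Un) auto
    qed
    finally show ?case using Suc by simp
  qed simp
  finally have "1 \<le> (\<Sum>i\<le>c. sum t (?A i))" using t by (simp add: coord_simplex_def)
  moreover have "(\<Sum>i\<le>c. sum t (?A i)) < 1" if "\<And>i. i \<le> c \<Longrightarrow> sum t (?A i) \<le> 1 / (real c + 2)"
  proof -
    have "(\<Sum>i\<le>c. sum t (?A i)) \<le> (\<Sum>i\<le>c. 1 / (real c + 2))" using that by (intro sum_mono) auto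
    also have "\<dots> < 1" by (simp add: field_simps)
    finally show ?thesis .
  qed
  ultimately show thesis using that by (meson not_le)
qed

theorem mainTheorem16:
  fixes K :: "'v set set"
    and Xb :: "'b topology" and E :: "'e topology"
    and q :: "'b \<Rightarrow> ('v \<Rightarrow> real)" and p :: "'e \<Rightarrow> 'b"
    and k :: nat
  assumes "abstract_simplicial_complex K"
    and "K \<noteq> {}"
    and "finite_dimensional_complex K"
    and "covering_map Xb (realization K) q"
    and "connected_space Xb"
    and "fibration E Xb p"
    and "\<exists>b\<in>topspace Xb. n_connected_space (int k - 1)
                             (subtopology E {e \<in> topspace E. p e = b})"
  shows "secat_tilde E Xb (realization K) p q
           \<le> enat (nat \<lceil>(complex_dim K - int k) / (int k + 1)\<rceil>)"
proof -
  define c where "c = nat \<lceil>(complex_dim K - int k) / (int k + 1)\<rceil>"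
  let ?A = "\<lambda>i. {i * (k + 1) + 1..(i + 1) * (k + 1)}"
  define \<epsilon> where "\<epsilon> = 1 / (real c + 2)"
  have \<epsilon>: "0 < \<epsilon>" "\<epsilon> < 1" by (auto simp: \<epsilon>_def)
  obtain b where b: "b \<in> topspace Xb"
    "n_connected_space (int k - 1) (subtopology E {e \<in> topspace E. p e = b})"
    using assms(7) by blast
  obtain d :: nat where d: "\<And>\<sigma>. \<sigma> \<in> K \<Longrightarrow> card \<sigma> \<le> d"
    using assms(3) unfolding finite_dimensional_complex_def by blast
  have "(\<lambda>\<sigma>. int (card \<sigma>) - 1) ` K \<subseteq> {-1..int d}" using d by force
  then have fin: "finite ((\<lambda>\<sigma>. int (card \<sigma>) - 1) ` K)" by (rule finite_subset) simp
  have dim: "int (card \<sigma>) \<le> complex_dim K + 1" if "\<sigma> \<in> K" for \<sigma>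
  proof -
    have "int (card \<sigma>) - 1 \<le> complex_dim K"
      unfolding complex_dim_def using fin that by (intro Max_ge) auto
    then show ?thesis by simp
  qed
  \<comment> \<open>\<open>nat\<close> replaces a negative ceiling by the larger value 0, so the
    bound also holds when the dimension is below k.\<close>
  have "(complex_dim K - int k) / (int k + 1) \<le> real c"
    unfolding c_def by linarith
  then have "real_of_int (complex_dim K - int k) \<le> real c * (real k + 1)"
    by (simp add: pos_divide_le_eq)
  \<comment> \<open>Adding k + 1 on both sides: c + 1 groups of k + 1 labels have room for all dim +
    1 labels.\<close>
  then have "real_of_int (complex_dim K + 1) \<le> real_of_int (int ((c + 1) * (k + 1)))"
    by (simp add: algebra_simps)
  then have dim_c: "complex_dim K + 1 \<le> int ((c + 1) * (k + 1))"
    by (simp only: of_int_le_iff)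
  define U where "U i = {x \<in> realization_set K. \<epsilon> < sum (flag_coords K x) (?A i)}" for i
  note sec = section_over_label_group[OF assms(1,4,5,6) b d _ _ \<epsilon>, of "?A i" for i, folded U_def]
  have "(\<Union>i\<le>c. U i) = topspace (realization K)"
  proof
    show "(\<Union>i\<le>c. U i) \<subseteq> topspace (realization K)" by (auto simp: U_def)
    show "topspace (realization K) \<subseteq> (\<Union>i\<le>c. U i)"
    proof
      fix x assume "x \<in> topspace (realization K)"
      then have x: "x \<in> realization_set K" by simp
      obtain S \<phi> t where fl: "flag K S \<phi>" "\<Union>(\<phi> ` S) \<subseteq> {v. x v \<noteq> 0}"
        "t \<in> coord_simplex S" "x = chain_point \<phi> S t"
        by (rule realization_flag_exists[OF assms(1) x])
      have "S \<subseteq> {1..(c + 1) * (k + 1)}"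
      proof
        fix j assume "j \<in> S"
        then have j: "\<phi> j \<in> K" "card (\<phi> j) = j" "0 < j" using fl(1) by (auto simp: flag_def chain_on_def)
        then have "int j \<le> int ((c + 1) * (k + 1))" using dim[OF j(1)] dim_c by linarith
        then have "j \<le> (c + 1) * (k + 1)" by (simp only: of_nat_le_iff)
        then show "j \<in> {1..(c + 1) * (k + 1)}" using j(3) by simp
      qed
      then obtain i where i: "i \<le> c" "\<epsilon> < sum t (?A i)"
        using label_groups[OF fl(3)] unfolding \<epsilon>_def by blast
      then have "x \<in> U i" using x flag_coords_eq[OF fl(1,3)] fl(4) by (simp add: U_def)
      then show "x \<in> (\<Union>i\<le>c. U i)" using i(1) by blast
    qed
  qed
  moreover have "\<forall>i\<le>c. openin (realization K) (U i)" using sec(1) by simp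
  moreover have "\<forall>i\<le>c. \<exists>s. continuous_map (subtopology Xb {y \<in> topspace Xb. q y \<in> U i}) E s \<and>
        (\<forall>y \<in> topspace Xb. q y \<in> U i \<longrightarrow> p (s y) = y)" using sec(2) by simp
  ultimately have "secat_tilde_cover E Xb (realization K) p q c"
    unfolding secat_tilde_cover_def by blast
  then show ?thesis
    unfolding secat_tilde_def c_def by (intro INF_lower) simp
qed

end
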